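(* Let $X$, $\Gamma$, $o$ be as in the context. If $\theta\in E^+$ is such that $\delta_\theta(\Gamma)>0$, and $\mu$ is a $\Gamma$-invariant $(b,\theta)$-density (for some $b\in\mathbb R^r$), then a radial limit point is not a point mass for $\mu$; that is, $\mu_o(\{\tilde\eta\})=0$ for every $\tilde\eta\in L_\Gamma^{rad}$.
   Context: A Hadamard space is a complete CAT(0) geodesic metric space. Let $(X_1,d_1),\dots,(X_r,d_r)$ be locally compact Hadamard spaces and $X=X_1\times\cdots\times X_r$ with $d=\sqrt{d_1^2+\cdots+d_r^2}$, which is again a locally compact Hadamard space. $\partial X$, $\partial X_i$ are the geometric boundaries (classes of asymptotic geodesic rays, with the cone topology). A geodesic line in a Hadamard space is rank one if it does not bound a flat half-plane. An isometry $h$ of a Hadamard space is axial if there are $l(h)>0$ and a geodesic line $\sigma$ (an axis) with $h(\sigma(t))=\sigma(t+l(h))$ for all $t$; $\mathrm{Ax}(h)$ is the set of points $x$ with $d(x,hx)=l(h)$. An axial isometry is rank one if it has a rank one axis; two rank one isometries are independent if their fixed point sets are disjoint. $\Gamma<\mathrm{Is}(X_1)\times\cdots\times\mathrm{Is}(X_r)$ is a group acting properly discontinuously by isometries on $X$ and containing two elements $h=(h_1,\dots,h_r)$, $g=(g_1,\dots,g_r)$ such that for every $i$ the isometries $g_i$ and $h_i$ of $X_i$ are independent rank one isometries. The base point $o=(o_1,\dots,o_r)\in\mathrm{Ax}(h)$ is fixed. $L_\Gamma=\overline{\Gamma\cdot x}\cap\partial X$ ($x\in X$ arbitrary) is the geometric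 limit set. Slopes: $E=\{\theta\in\mathbb R^r_{\ge0}:\|\theta\|=1\}$, $E^+=\{\theta\in\mathbb R^r_{>0}:\|\theta\|=1\}$, $I^+(\theta)=\{i:\theta_i>0\}$. Every geodesic ray $\sigma$ in $X$ can be written $\sigma(t)=(\sigma_1(t\theta_1),\dots,\sigma_r(t\theta_r))$ with $\theta\in E$ and unit speed geodesic rays $\sigma_i$ in $X_i$ (for $\theta_i=0$ the $i$-th component is constant). $\theta$ is the slope of $\sigma$ and depends only on the class of $\sigma$. $\partial X_\theta\subset\partial X$ is the set of points of slope $\theta$; a point $\tilde\eta\in\partial X_\theta$ is determined by its projections $\eta_i=\sigma_i(\infty)\in\partial X_i$, $i\in I^+(\theta)$. Radial limit set: $\tilde\xi\in\partial X_\theta$ ($\theta\in E$) is a radial limit point of $\Gamma$ if there is a sequence $\gamma_n=(\gamma_{n,1},\dots,\gamma_{n,r})\in\Gamma$ such that $\gamma_no$ converges to $\tilde\xi$ and for every $i\in I^+(\theta)$ the sequence $\gamma_{n,i}o_i$ stays at bounded distance of one (hence any) geodesic ray in the class $\xi_i\in\partial X_i$. $L_\Gamma^{rad}$ is the set of all radial limit points. Exponent of growth: for $\theta\in E$, $\varepsilon>0$ let $N_\theta^\varepsilon(n)$ be the number of $\gamma=(\gamma_1,\dots,\gamma_r)\in\Gamma$ with $0<d(o,\gamma o)<n$ and $\left|\frac{d_i(o_i,\gamma_io_i)}{d(o,\gamma o)}-\theta_i\right|<\varepsilon$ for all $i$; $\delta_\theta(\Gamma)=\lim_{\varepsilon\to0}\limsup_{n\to\infty}\frac{\ln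 N_\theta^\varepsilon(n)}{n}$. Busemann function: for $\eta_i\in\partial X_i$, $\beta_{\eta_i}(x_i,y_i)=\lim_{s\to\infty}(d_i(x_i,\sigma(s))-d_i(y_i,\sigma(s)))$ for any geodesic ray $\sigma$ in the class $\eta_i$. $(b,\theta)$-density: for $\theta\in E$ and $b\in\mathbb R^r$ with $b_i=0$ for $i\notin I^+(\theta)$, a $\Gamma$-invariant $(b,\theta)$-density is a map $\mu$, $x\mapsto\mu_x$, from $X$ to the positive finite Borel measures on $\partial X$ such that for all $x=(x_1,\dots,x_r)\in X$: (i) $\emptyset\ne\operatorname{supp}(\mu_x)\subset L_\Gamma\cap\partial X_\theta$; (ii) $\gamma_*\mu_x=\mu_{\gamma x}$ for all $\gamma\in\Gamma$ (where $\gamma_*\mu_x(A)=\mu_x(\gamma^{-1}A)$); (iii) for all $\tilde\eta\in\operatorname{supp}(\mu_o)$, $\frac{d\mu_x}{d\mu_o}(\tilde\eta)=\exp\big(\sum_{i\in I^+(\theta)}b_i\beta_{\eta_i}(o_i,x_i)\big)$. *)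

theory Defs
  imports "HOL-Analysis.Analysis" "HOL-Algebra.Product_Groups" "HOL-Algebra.Bij"
begin

section \<open>Hadamard spaces\<close>

text \<open>Geodesics and rays are total functions, but only their values on \<open>{0..mdist X x y}\<close> and
  \<open>{0..}\<close>, respectively, matter.\<close>

definition geodesic :: "'a metric \<Rightarrow> 'a \<Rightarrow> 'a \<Rightarrow> (real \<Rightarrow> 'a) \<Rightarrow> bool" where
  "geodesic X x y c \<longleftrightarrow>
     c 0 = x \<and> c (mdist X x y) = y \<and>
     (\<forall>s\<in>{0..mdist X x y}. c s \<in> mspace X) \<and>
     (\<forall>s\<in>{0..mdist X x y}. \<forall>t\<in>{0..mdist X x y}. mdist X (c s) (c t) = \<bar>s - t\<bar>)"

definition geodesic_ray :: "'a metric \<Rightarrow> (real \<Rightarrow> 'a) \<Rightarrow> bool" where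
  "geodesic_ray X c \<longleftrightarrow>
     (\<forall>s\<ge>0. c s \<in> mspace X) \<and> (\<forall>s\<ge>0. \<forall>t\<ge>0. mdist X (c s) (c t) = \<bar>s - t\<bar>)"

definition geodesic_line :: "'a metric \<Rightarrow> (real \<Rightarrow> 'a) \<Rightarrow> bool" where
  "geodesic_line X c \<longleftrightarrow>
     (\<forall>s. c s \<in> mspace X) \<and> (\<forall>s t. mdist X (c s) (c t) = \<bar>s - t\<bar>)"

definition geodesic_space :: "'a metric \<Rightarrow> bool" where
  "geodesic_space X \<longleftrightarrow> (\<forall>x\<in>mspace X. \<forall>y\<in>mspace X. \<exists>c. geodesic X x y c)"

text \<open>The comparison inequality for geodesic triangles with a comparison triangle \<open>x', y', z'\<close> in the
  Euclidean plane.  Two points on different sides of a triangle lie on two sides with a common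
  vertex, and the sides can be parametrised from that vertex; it is called \<open>x\<close> below.  Points on the
  same side satisfy the inequality trivially.\<close>

definition CAT0 :: "'a metric \<Rightarrow> bool" where
  "CAT0 X \<longleftrightarrow>
     (\<forall>x y z c1 c2 c3 s t. \<forall>x' y' z' p' q' :: real ^ 2.
        x \<in> mspace X \<and> y \<in> mspace X \<and> z \<in> mspace X \<and>
        geodesic X x y c1 \<and> geodesic X x z c2 \<and> geodesic X y z c3 \<and>
        dist x' y' = mdist X x y \<and> dist x' z' = mdist X x z \<and> dist y' z' = mdist X y z \<and>
        s \<in> {0..mdist X x y} \<and> p' \<in> closed_segment x' y' \<and> dist x' p' = s \<and>
        t \<in> {0..mdist X x z} \<and> q' \<in> closed_segment x' z' \<and> dist x' q' = t
        \<longrightarrow> mdist X (c1 s) (c2 t) \<le> dist p' q')"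

definition hadamard_space :: "'a metric \<Rightarrow> bool" where
  "hadamard_space X \<longleftrightarrow> mspace X \<noteq> {} \<and> mcomplete_of X \<and> geodesic_space X \<and> CAT0 X"


section \<open>Geometric boundary and cone topology\<close>

definition asymptotic :: "'a metric \<Rightarrow> (real \<Rightarrow> 'a) \<Rightarrow> (real \<Rightarrow> 'a) \<Rightarrow> bool" where
  "asymptotic X c c' \<longleftrightarrow> (\<exists>C. \<forall>t\<ge>0. mdist X (c t) (c' t) \<le> C)"

definition endpoint :: "'a metric \<Rightarrow> (real \<Rightarrow> 'a) \<Rightarrow> (real \<Rightarrow> 'a) set" where
  "endpoint X c = {c'. geodesic_ray X c' \<and> asymptotic X c c'}"

definition boundary :: "'a metric \<Rightarrow> (real \<Rightarrow> 'a) set set" where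
  "boundary X = endpoint X ` {c. geodesic_ray X c}"

text \<open>The bordification of \<open>X\<close> by its boundary is modelled in a sum type.  The set \<open>cone_nbhd X c R \<epsilon>\<close>
  consists of the points \<open>p\<close> such that the geodesic (ray) from \<open>c 0\<close> to \<open>p\<close> has length greater
  than \<open>R\<close> and is \<open>\<epsilon>\<close>-close to \<open>c\<close> at time \<open>R\<close>.  All origins \<open>c 0\<close> are allowed; for complete
  CAT(0) spaces every fixed origin gives the same topology.\<close>

definition cone_nbhd ::
    "'a metric \<Rightarrow> (real \<Rightarrow> 'a) \<Rightarrow> real \<Rightarrow> real \<Rightarrow> ('a + (real \<Rightarrow> 'a) set) set" where
  "cone_nbhd X c R \<epsilon> =
     Inl ` {y \<in> mspace X. mdist X (c 0) y > R \<and>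
              (\<exists>g. geodesic X (c 0) y g \<and> mdist X (g R) (c R) < \<epsilon>)} \<union>
     Inr ` {\<eta> \<in> boundary X. \<exists>g\<in>\<eta>. g 0 = c 0 \<and> mdist X (g R) (c R) < \<epsilon>}"

definition cone_topology :: "'a metric \<Rightarrow> ('a + (real \<Rightarrow> 'a) set) topology" where
  "cone_topology X = topology_generated_by
     ({Inl ` mball_of X x \<epsilon> | x \<epsilon>. x \<in> mspace X \<and> \<epsilon> > 0} \<union>
      {cone_nbhd X c R \<epsilon> | c R \<epsilon>. geodesic_ray X c \<and> R > 0 \<and> \<epsilon> > 0})"

definition boundary_topology :: "'a metric \<Rightarrow> (real \<Rightarrow> 'a) set topology" where
  "boundary_topology X = pullback_topology (boundary X) Inr (cone_topology X)"

definition boundary_borel :: "'a metric \<Rightarrow> (real \<Rightarrow> 'a) set measure" where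
  "boundary_borel X = sigma (boundary X) {U. openin (boundary_topology X) U}"

text \<open>Action of an isometry on the boundary.  The union over all representatives avoids a choice;
  all the united classes coincide.\<close>

definition boundary_map :: "'a metric \<Rightarrow> ('a \<Rightarrow> 'a) \<Rightarrow> (real \<Rightarrow> 'a) set \<Rightarrow> (real \<Rightarrow> 'a) set" where
  "boundary_map X h \<eta> = (\<Union>c\<in>\<eta>. endpoint X (h \<circ> c))"

text \<open>The Busemann function does not depend on the representative \<open>c\<close>, since \<open>X\<close> is a Hadamard space.\<close>

definition busemann :: "'a metric \<Rightarrow> (real \<Rightarrow> 'a) set \<Rightarrow> 'a \<Rightarrow> 'a \<Rightarrow> real" where
  "busemann X \<eta> x y =
     (let c = (SOME c. c \<in> \<eta>) in Lim at_top (\<lambda>s. mdist X x (c s) - mdist X y (c s)))"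


section \<open>Isometries\<close>

definition isometry_group :: "'a metric \<Rightarrow> ('a \<Rightarrow> 'a) monoid" where
  "isometry_group X = (BijGroup (mspace X))
     \<lparr>carrier := {f \<in> Bij (mspace X).
        \<forall>x\<in>mspace X. \<forall>y\<in>mspace X. mdist X (f x) (f y) = mdist X x y}\<rparr>"

definition bounds_flat_half_plane :: "'a metric \<Rightarrow> (real \<Rightarrow> 'a) \<Rightarrow> bool" where
  "bounds_flat_half_plane X c \<longleftrightarrow>
     (\<exists>F :: real \<times> real \<Rightarrow> 'a.
        (\<forall>p\<in>UNIV \<times> {0..}. F p \<in> mspace X) \<and>
        (\<forall>p\<in>UNIV \<times> {0..}. \<forall>q\<in>UNIV \<times> {0..}. mdist X (F p) (F q) = dist p q) \<and>
        (\<forall>s. F (s, 0) = c s))"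

definition rank_one_line :: "'a metric \<Rightarrow> (real \<Rightarrow> 'a) \<Rightarrow> bool" where
  "rank_one_line X c \<longleftrightarrow> geodesic_line X c \<and> \<not> bounds_flat_half_plane X c"

definition is_axis :: "'a metric \<Rightarrow> ('a \<Rightarrow> 'a) \<Rightarrow> real \<Rightarrow> (real \<Rightarrow> 'a) \<Rightarrow> bool" where
  "is_axis X h l c \<longleftrightarrow> l > 0 \<and> geodesic_line X c \<and> (\<forall>t. h (c t) = c (t + l))"

definition axial :: "'a metric \<Rightarrow> ('a \<Rightarrow> 'a) \<Rightarrow> bool" where
  "axial X h \<longleftrightarrow> h \<in> carrier (isometry_group X) \<and> (\<exists>l c. is_axis X h l c)"

text \<open>For an axial isometry the number \<open>l\<close> is the same for all axes.\<close>

definition translation_length :: "'a metric \<Rightarrow> ('a \<Rightarrow> 'a) \<Rightarrow> real" where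
  "translation_length X h = (THE l. \<exists>c. is_axis X h l c)"

definition Ax :: "'a metric \<Rightarrow> ('a \<Rightarrow> 'a) \<Rightarrow> 'a set" where
  "Ax X h = {x \<in> mspace X. mdist X x (h x) = translation_length X h}"

definition rank_one_isometry :: "'a metric \<Rightarrow> ('a \<Rightarrow> 'a) \<Rightarrow> bool" where
  "rank_one_isometry X h \<longleftrightarrow> axial X h \<and> (\<exists>l c. is_axis X h l c \<and> rank_one_line X c)"

text \<open>Fixed points in the bordification; axial isometries have none in \<open>X\<close> itself.\<close>

definition fixed_points :: "'a metric \<Rightarrow> ('a \<Rightarrow> 'a) \<Rightarrow> ('a + (real \<Rightarrow> 'a) set) set" where
  "fixed_points X h =
     Inl ` {x \<in> mspace X. h x = x} \<union> Inr ` {\<eta> \<in> boundary X. boundary_map X h \<eta> = \<eta>}"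

definition independent_rank_one :: "'a metric \<Rightarrow> ('a \<Rightarrow> 'a) \<Rightarrow> ('a \<Rightarrow> 'a) \<Rightarrow> bool" where
  "independent_rank_one X g h \<longleftrightarrow>
     rank_one_isometry X g \<and> rank_one_isometry X h \<and> fixed_points X g \<inter> fixed_points X h = {}"


section \<open>Products\<close>

text \<open>A product of \<open>r\<close> factors is indexed by \<open>{..<r}\<close>.  The factors are metric spaces carried by subsets
  of one type, which is no restriction since finitely many types embed into their sum.\<close>

definition product_space :: "nat \<Rightarrow> (nat \<Rightarrow> 'a metric) \<Rightarrow> (nat \<Rightarrow> 'a) metric" where
  "product_space r X =
     metric (\<Pi>\<^sub>E i\<in>{..<r}. mspace (X i), \<lambda>x y. L2_set (\<lambda>i. mdist (X i) (x i) (y i)) {..<r})"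

lemma Metric_space_product_space:
  fixes r :: nat
  shows "Metric_space (\<Pi>\<^sub>E i\<in>{..<r}. mspace (X i)) (\<lambda>x y. L2_set (\<lambda>i. mdist (X i) (x i) (y i)) {..<r})"
proof
  fix x y
  show "0 \<le> L2_set (\<lambda>i. mdist (X i) (x i) (y i)) {..<r}"
    by (rule L2_set_nonneg)
  show "L2_set (\<lambda>i. mdist (X i) (x i) (y i)) {..<r} = L2_set (\<lambda>i. mdist (X i) (y i) (x i)) {..<r}"
    by (simp add: mdist_commute)
next
  fix x y
  assume xy: "x \<in> (\<Pi>\<^sub>E i\<in>{..<r}. mspace (X i))" "y \<in> (\<Pi>\<^sub>E i\<in>{..<r}. mspace (X i))"
  have "L2_set (\<lambda>i. mdist (X i) (x i) (y i)) {..<r} = 0 \<longleftrightarrow>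
      (\<forall>i\<in>{..<r}. mdist (X i) (x i) (y i) = 0)"
    by (intro L2_set_eq_0_iff finite_lessThan)
  also have "\<dots> \<longleftrightarrow> (\<forall>i\<in>{..<r}. x i = y i)"
    using xy by (intro ball_cong refl mdist_zero) (auto simp: PiE_def Pi_def)
  also have "\<dots> \<longleftrightarrow> x = y"
    using xy by (auto intro: PiE_ext)
  finally show "L2_set (\<lambda>i. mdist (X i) (x i) (y i)) {..<r} = 0 \<longleftrightarrow> x = y" .
next
  fix x y z
  assume xyz: "x \<in> (\<Pi>\<^sub>E i\<in>{..<r}. mspace (X i))" "y \<in> (\<Pi>\<^sub>E i\<in>{..<r}. mspace (X i))"
    "z \<in> (\<Pi>\<^sub>E i\<in>{..<r}. mspace (X i))"
  have "L2_set (\<lambda>i. mdist (X i) (x i) (z i)) {..<r}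
      \<le> L2_set (\<lambda>i. mdist (X i) (x i) (y i) + mdist (X i) (y i) (z i)) {..<r}"
    using xyz by (intro L2_set_mono mdist_triangle) (auto simp: PiE_def Pi_def)
  also have "\<dots> \<le> L2_set (\<lambda>i. mdist (X i) (x i) (y i)) {..<r}
      + L2_set (\<lambda>i. mdist (X i) (y i) (z i)) {..<r}"
    by (rule L2_set_triangle_ineq)
  finally show "L2_set (\<lambda>i. mdist (X i) (x i) (z i)) {..<r}
      \<le> L2_set (\<lambda>i. mdist (X i) (x i) (y i)) {..<r}
      + L2_set (\<lambda>i. mdist (X i) (y i) (z i)) {..<r}" .
qed

lemma mspace_product_space [simp]:
  "mspace (product_space r X) = (\<Pi>\<^sub>E i\<in>{..<r}. mspace (X i))"
  by (simp add: product_space_def Metric_space.mspace_metric[OF Metric_space_product_space])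

lemma mdist_product_space [simp]:
  "mdist (product_space r X) x y = L2_set (\<lambda>i. mdist (X i) (x i) (y i)) {..<r}"
  by (simp add: product_space_def Metric_space.mdist_metric[OF Metric_space_product_space])

definition product_isometry_group ::
    "nat \<Rightarrow> (nat \<Rightarrow> 'a metric) \<Rightarrow> (nat \<Rightarrow> 'a \<Rightarrow> 'a) monoid" where
  "product_isometry_group r X = product_group {..<r} (\<lambda>i. isometry_group (X i))"

definition product_act ::
    "nat \<Rightarrow> (nat \<Rightarrow> 'a metric) \<Rightarrow> (nat \<Rightarrow> 'a \<Rightarrow> 'a) \<Rightarrow> (nat \<Rightarrow> 'a) \<Rightarrow> (nat \<Rightarrow> 'a)" where
  "product_act r X \<gamma> = (\<lambda>x\<in>mspace (product_space r X). \<lambda>i\<in>{..<r}. \<gamma> i (x i))"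

definition properly_discontinuous ::
    "nat \<Rightarrow> (nat \<Rightarrow> 'a metric) \<Rightarrow> (nat \<Rightarrow> 'a \<Rightarrow> 'a) set \<Rightarrow> bool" where
  "properly_discontinuous r X \<Gamma> \<longleftrightarrow>
     (\<forall>K. compactin (mtopology_of (product_space r X)) K \<longrightarrow>
        finite {\<gamma> \<in> \<Gamma>. product_act r X \<gamma> ` K \<inter> K \<noteq> {}})"

definition limit_set ::
    "nat \<Rightarrow> (nat \<Rightarrow> 'a metric) \<Rightarrow> (nat \<Rightarrow> 'a \<Rightarrow> 'a) set \<Rightarrow> (nat \<Rightarrow> 'a) \<Rightarrow>
     (real \<Rightarrow> nat \<Rightarrow> 'a) set set" where
  "limit_set r X \<Gamma> x =
     {\<eta> \<in> boundary (product_space r X).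
        Inr \<eta> \<in> cone_topology (product_space r X) closure_of
          (Inl ` (\<lambda>\<gamma>. product_act r X \<gamma> x) ` \<Gamma>)}"


section \<open>Slopes and projections to the factors\<close>

definition slopes :: "nat \<Rightarrow> (nat \<Rightarrow> real) set" where
  "slopes r = {\<theta>. (\<forall>i<r. \<theta> i \<ge> 0) \<and> L2_set \<theta> {..<r} = 1}"

definition regular_slopes :: "nat \<Rightarrow> (nat \<Rightarrow> real) set" where
  "regular_slopes r = {\<theta>. (\<forall>i<r. \<theta> i > 0) \<and> L2_set \<theta> {..<r} = 1}"

definition slope_support :: "nat \<Rightarrow> (nat \<Rightarrow> real) \<Rightarrow> nat set" where
  "slope_support r \<theta> = {i. i < r \<and> \<theta> i > 0}"

definition has_slope ::
    "nat \<Rightarrow> (nat \<Rightarrow> 'a metric) \<Rightarrow> (nat \<Rightarrow> real) \<Rightarrow> (real \<Rightarrow> nat \<Rightarrow> 'a) \<Rightarrow> bool" where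
  "has_slope r X \<theta> c \<longleftrightarrow>
     (\<exists>c'. (\<forall>i\<in>slope_support r \<theta>. geodesic_ray (X i) (c' i)) \<and>
           (\<forall>t\<ge>0. \<forall>i<r. c t i = c' i (t * \<theta> i)))"

definition boundary_slope ::
    "nat \<Rightarrow> (nat \<Rightarrow> 'a metric) \<Rightarrow> (nat \<Rightarrow> real) \<Rightarrow> (real \<Rightarrow> nat \<Rightarrow> 'a) set set" where
  "boundary_slope r X \<theta> = {\<eta> \<in> boundary (product_space r X). \<exists>c\<in>\<eta>. has_slope r X \<theta> c}"

text \<open>For \<open>\<eta> \<in> boundary_slope r X \<theta>\<close> and \<open>\<theta> i > 0\<close> this is the class of the \<open>i\<close>-th component of any
  representative, reparametrised to unit speed.\<close>

definition boundary_proj ::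
    "(nat \<Rightarrow> 'a metric) \<Rightarrow> (nat \<Rightarrow> real) \<Rightarrow> (real \<Rightarrow> nat \<Rightarrow> 'a) set \<Rightarrow> nat \<Rightarrow> (real \<Rightarrow> 'a) set" where
  "boundary_proj X \<theta> \<eta> i = (\<Union>c\<in>\<eta>. endpoint (X i) (\<lambda>t. c (t / \<theta> i) i))"

definition radial_limit_point ::
    "nat \<Rightarrow> (nat \<Rightarrow> 'a metric) \<Rightarrow> (nat \<Rightarrow> 'a \<Rightarrow> 'a) set \<Rightarrow> (nat \<Rightarrow> 'a) \<Rightarrow> (nat \<Rightarrow> real) \<Rightarrow>
     (real \<Rightarrow> nat \<Rightarrow> 'a) set \<Rightarrow> bool" where
  "radial_limit_point r X \<Gamma> p \<theta> \<xi> \<longleftrightarrow>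
     \<xi> \<in> boundary_slope r X \<theta> \<and>
     (\<exists>\<gamma> :: nat \<Rightarrow> nat \<Rightarrow> 'a \<Rightarrow> 'a.
        (\<forall>n. \<gamma> n \<in> \<Gamma>) \<and>
        limitin (cone_topology (product_space r X))
          (\<lambda>n. Inl (product_act r X (\<gamma> n) p)) (Inr \<xi>) sequentially \<and>
        (\<forall>i\<in>slope_support r \<theta>. \<exists>c\<in>boundary_proj X \<theta> \<xi> i. \<exists>C. \<forall>n. \<exists>t\<ge>0.
           mdist (X i) (\<gamma> n i (p i)) (c t) \<le> C))"

definition radial_limit_set ::
    "nat \<Rightarrow> (nat \<Rightarrow> 'a metric) \<Rightarrow> (nat \<Rightarrow> 'a \<Rightarrow> 'a) set \<Rightarrow> (nat \<Rightarrow> 'a) \<Rightarrow>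
     (real \<Rightarrow> nat \<Rightarrow> 'a) set set" where
  "radial_limit_set r X \<Gamma> p = {\<xi>. \<exists>\<theta>\<in>slopes r. radial_limit_point r X \<Gamma> p \<theta> \<xi>}"


section \<open>Exponent of growth of given slope\<close>

definition orbit_count ::
    "nat \<Rightarrow> (nat \<Rightarrow> 'a metric) \<Rightarrow> (nat \<Rightarrow> 'a \<Rightarrow> 'a) set \<Rightarrow> (nat \<Rightarrow> 'a) \<Rightarrow> (nat \<Rightarrow> real) \<Rightarrow>
     real \<Rightarrow> nat \<Rightarrow> nat" where
  "orbit_count r X \<Gamma> p \<theta> \<epsilon> n =
     card {\<gamma> \<in> \<Gamma>. 0 < mdist (product_space r X) p (product_act r X \<gamma> p) \<and>
        mdist (product_space r X) p (product_act r X \<gamma> p) < real n \<and>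
        (\<forall>i<r. \<bar>mdist (X i) (p i) (\<gamma> i (p i)) / mdist (product_space r X) p (product_act r X \<gamma> p)
                 - \<theta> i\<bar> < \<epsilon>)}"

text \<open>The convention \<open>ln 0 = -\<infinity>\<close> is used here, rather than the library's \<open>ln (0::real) = 0\<close>.\<close>

definition ln_count :: "nat \<Rightarrow> ereal" where
  "ln_count k = (if k = 0 then -\<infinity> else ereal (ln (real k)))"

definition growth_exponent ::
    "nat \<Rightarrow> (nat \<Rightarrow> 'a metric) \<Rightarrow> (nat \<Rightarrow> 'a \<Rightarrow> 'a) set \<Rightarrow> (nat \<Rightarrow> 'a) \<Rightarrow> (nat \<Rightarrow> real) \<Rightarrow> ereal" where
  "growth_exponent r X \<Gamma> p \<theta> =
     Lim (at_right 0)
       (\<lambda>\<epsilon>. limsup (\<lambda>n. ln_count (orbit_count r X \<Gamma> p \<theta> \<epsilon> n) / ereal (real n)))"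


section \<open>Generalised conformal densities\<close>

definition measure_support :: "'b topology \<Rightarrow> 'b measure \<Rightarrow> 'b set" where
  "measure_support T \<nu> = {x \<in> topspace T. \<forall>U. openin T U \<and> x \<in> U \<longrightarrow> emeasure \<nu> U > 0}"

text \<open>In the last clause \<open>RN_deriv (\<mu> p) (\<mu> x)\<close> is the Radon-Nikodym derivative of \<open>\<mu> x\<close> with respect to
  \<open>\<mu> p\<close>; as such it is only determined almost everywhere, whence \<open>AE\<close>.\<close>

definition invariant_density ::
    "nat \<Rightarrow> (nat \<Rightarrow> 'a metric) \<Rightarrow> (nat \<Rightarrow> 'a \<Rightarrow> 'a) set \<Rightarrow> (nat \<Rightarrow> 'a) \<Rightarrow> (nat \<Rightarrow> real) \<Rightarrow>
     (nat \<Rightarrow> real) \<Rightarrow> ((nat \<Rightarrow> 'a) \<Rightarrow> (real \<Rightarrow> nat \<Rightarrow> 'a) set measure) \<Rightarrow> bool" where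
  "invariant_density r X \<Gamma> p b \<theta> \<mu> \<longleftrightarrow>
     \<theta> \<in> slopes r \<and> (\<forall>i<r. i \<notin> slope_support r \<theta> \<longrightarrow> b i = 0) \<and>
     (\<forall>x\<in>mspace (product_space r X).
        finite_measure (\<mu> x) \<and>
        space (\<mu> x) = boundary (product_space r X) \<and>
        sets (\<mu> x) = sets (boundary_borel (product_space r X)) \<and>
        measure_support (boundary_topology (product_space r X)) (\<mu> x) \<noteq> {} \<and>
        measure_support (boundary_topology (product_space r X)) (\<mu> x)
          \<subseteq> limit_set r X \<Gamma> p \<inter> boundary_slope r X \<theta> \<and>
        (\<forall>\<gamma>\<in>\<Gamma>. \<forall>A\<in>sets (\<mu> x).
           emeasure (\<mu> (product_act r X \<gamma> x)) A =
           emeasure (\<mu> x)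
             (boundary_map (product_space r X) (product_act r X \<gamma>) -` A
                \<inter> boundary (product_space r X))) \<and>
        absolutely_continuous (\<mu> p) (\<mu> x) \<and>
        (AE \<eta> in \<mu> p. \<eta> \<in> measure_support (boundary_topology (product_space r X)) (\<mu> p) \<longrightarrow>
           RN_deriv (\<mu> p) (\<mu> x) \<eta> =
           ennreal (exp (\<Sum>i\<in>slope_support r \<theta>.
             b i * busemann (X i) (boundary_proj X \<theta> \<eta> i) (p i) (x i)))))"

end

theory Submission
  imports Defs
begin

text \<open>
Suppose that a radial limit point \<open>\<xi>\<close> is an atom of \<open>\<mu> p\<close>. Invariance and conformality say that for
\<open>\<gamma> \<in> \<Gamma>\<close> the point \<open>\<gamma>\<inverse>\<xi>\<close> has the mass of \<open>\<xi>\<close> multiplied by \<open>exp (\<Sum>i. b i * \<beta> i)\<close>, where \<open>\<beta> i\<close> is the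
Busemann function of \<open>X i\<close> at the \<open>i\<close>-th component of \<open>\<xi>\<close>, evaluated from \<open>p i\<close> to \<open>\<gamma> i (p i)\<close>
(\<open>atom_preimage\<close>). Along the elements \<open>\<gamma> n\<close> that
exhibit \<open>\<xi>\<close> as a radial limit point, \<open>\<beta> i\<close> is the distance from \<open>p i\<close> to \<open>\<gamma> n i (p i)\<close> up to a bounded
error, and these distances grow like \<open>T * \<theta> i\<close> where \<open>T\<close> is the distance from \<open>p\<close> to \<open>\<gamma> n p\<close>. Hence the
masses tend to infinity as soon as \<open>\<Sum>i. b i * \<theta> i > 0\<close>, which contradicts finiteness of \<open>\<mu> p\<close>
(\<open>radial_not_atom\<close>).

It remains to exclude \<open>\<Sum>i. b i * \<theta> i \<le> 0\<close>, and this is where positive growth and the rank one elements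
enter. Instead of a shadow lemma for arbitrary densities, the atom itself is used
(\<open>growth_exponent_of_atom\<close>). There is a finite set \<open>F \<subseteq> \<Gamma>\<close> such that for every \<open>\<gamma> \<in> \<Gamma>\<close> some \<open>f \<in> F\<close> moves
the atom to a position in which, in all factors at once, the geodesics from \<open>\<gamma> i (p i)\<close> to the \<open>i\<close>-th
component of \<open>f \<xi>\<close> pass near \<open>p i\<close> (\<open>finite_shadow\<close>). The Busemann functions at \<open>f \<xi>\<close> are then minus the
distances up to a bounded error, so for \<open>\<gamma>\<close> of slope close to \<open>\<theta>\<close> and displacement below \<open>n\<close> the
point \<open>\<gamma>\<inverse> f \<xi>\<close> has mass at least \<open>exp (- \<epsilon> n)\<close> up to constants. Finitely much mass allows only
\<open>exp (\<epsilon> n)\<close> such points. Each point arises from polynomially many \<open>\<gamma>\<close> only: the points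
\<open>\<gamma>\<inverse> p\<close> lie close to the product of the geodesics from \<open>p i\<close> towards the components of \<open>\<gamma>\<inverse> f \<xi>\<close>, and the
action is properly discontinuous (\<open>coset_multiplicity\<close>). So the growth exponent is not positive.

The finite set \<open>F\<close> comes from the geometry of rank one axes. Let \<open>\<sigma> i\<close> be a rank one axis of \<open>h i\<close>. It is
\<^emph>\<open>contracting\<close>: a geodesic whose endpoints project far apart on the axis passes close to
the axis in between (\<open>rank_one_contracting\<close>). By independence the translates \<open>g i ^ j (\<sigma> i)\<close> have pairwise
different ends (\<open>independent_rank_oneE\<close>), so a point can lie far out along at most one of them. There are \<open>r\<close> factors, so among
\<open>r + 1\<close> exponents \<open>j\<close> there is one for which \<open>\<gamma> p\<close> lies far out in no factor; the elements
\<open>f = g ^ j * h ^ N * g ^ m\<close> with \<open>N\<close> large push the atom far out along the \<open>j\<close>-th translate, where \<open>m\<close> is chosen by the same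
counting so that \<open>g ^ m \<xi>\<close> avoids the repelling ends.
\<close>

section \<open>Comparison geometry of Hadamard spaces\<close>

lemma mdist_self: "x \<in> mspace Y \<Longrightarrow> mdist Y x x = 0"
  by (simp add: mdist_zero)

text \<open>Two sides of a comparison triangle, as vectors from their common vertex.\<close>

lemma comparison_vectors:
  fixes N M D :: real
  assumes "0 < N" "0 < M" "D \<le> N + M" "N \<le> M + D" "M \<le> N + D"
  obtains y z :: "real ^ 2"
  where "norm y = N" "norm z = M" "y \<bullet> z = (N\<^sup>2 + M\<^sup>2 - D\<^sup>2) / 2"
proof -
  define a where "a = (N\<^sup>2 + M\<^sup>2 - D\<^sup>2) / 2"
  have D: "0 \<le> D" using assms by linarith
  have "D\<^sup>2 \<le> (N + M)\<^sup>2" using assms D by (intro power_mono) auto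
  then have 1: "- (N * M) \<le> a" by (simp add: a_def power2_sum)
  have "(N - M)\<^sup>2 \<le> D\<^sup>2" using assms by (simp add: abs_le_square_iff[symmetric])
  then have 2: "a \<le> N * M" by (simp add: a_def power2_diff)
  have "\<bar>a\<bar> \<le> N * M" using 1 2 by linarith
  then have "\<bar>a / N\<bar> \<le> M" using assms by (simp add: pos_divide_le_eq mult.commute)
  then have "\<bar>a / N\<bar>\<^sup>2 \<le> M\<^sup>2" by (intro power_mono) auto
  then have 3: "(a / N)\<^sup>2 \<le> M\<^sup>2" by (simp only: power2_abs)
  define y :: "real ^ 2" where "y = vector [N, 0]"
  define z :: "real ^ 2" where "z = vector [a / N, sqrt (M\<^sup>2 - (a / N)\<^sup>2)]"
  show thesis
  proof (rule that[of y z])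
    show "norm y = N" using assms by (simp add: y_def norm_eq_sqrt_inner inner_vec_def sum_2)
    show "norm z = M" using assms 3
      by (simp add: z_def norm_eq_sqrt_inner inner_vec_def sum_2 power2_eq_square)
    show "y \<bullet> z = (N\<^sup>2 + M\<^sup>2 - D\<^sup>2) / 2" using assms
      by (simp add: y_def z_def inner_vec_def sum_2 a_def)
  qed
qed

lemma geodesic_reverse:
  "geodesic Y x y c \<Longrightarrow> geodesic Y y x (\<lambda>s. c (mdist Y x y - s))"
  by (auto simp: geodesic_def mdist_commute)

lemma geodesicD:
  assumes "geodesic Y x y c"
  shows "c 0 = x" "c (mdist Y x y) = y"
    and "0 \<le> s \<Longrightarrow> s \<le> mdist Y x y \<Longrightarrow> c s \<in> mspace Y"
    and "0 \<le> s \<Longrightarrow> s \<le> mdist Y x y \<Longrightarrow> 0 \<le> t \<Longrightarrow> t \<le> mdist Y x y \<Longrightarrow>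
      mdist Y (c s) (c t) = \<bar>s - t\<bar>"
    and "0 \<le> s \<Longrightarrow> s \<le> mdist Y x y \<Longrightarrow> mdist Y x (c s) = s"
    and "0 \<le> s \<Longrightarrow> s \<le> mdist Y x y \<Longrightarrow> mdist Y (c s) y = mdist Y x y - s"
proof -
  show 0: "c 0 = x" "c (mdist Y x y) = y" using assms by (auto simp: geodesic_def)
  show "0 \<le> s \<Longrightarrow> s \<le> mdist Y x y \<Longrightarrow> c s \<in> mspace Y"
    and 1: "0 \<le> s \<Longrightarrow> s \<le> mdist Y x y \<Longrightarrow> 0 \<le> t \<Longrightarrow> t \<le> mdist Y x y \<Longrightarrow>
      mdist Y (c s) (c t) = \<bar>s - t\<bar>" for s t
    using assms by (auto simp: geodesic_def)
  show "0 \<le> s \<Longrightarrow> s \<le> mdist Y x y \<Longrightarrow> mdist Y x (c s) = s" using 1[of 0 s] 0 by auto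
  show "0 \<le> s \<Longrightarrow> s \<le> mdist Y x y \<Longrightarrow> mdist Y (c s) y = mdist Y x y - s"
    using 1[of s "mdist Y x y"] 0 by auto
qed

lemma geodesic_lineD:
  assumes "geodesic_line Y \<sigma>"
  shows "\<sigma> t \<in> mspace Y" "mdist Y (\<sigma> s) (\<sigma> t) = \<bar>s - t\<bar>"
  using assms by (auto simp: geodesic_line_def)

lemma geodesic_line_segment:
  assumes "geodesic_line Y \<sigma>" "a \<le> b"
  shows "geodesic Y (\<sigma> a) (\<sigma> b) (\<lambda>s. \<sigma> (a + s))"
  using assms by (auto simp: geodesic_def geodesic_lineD)

lemma geodesic_line_reverse:
  "geodesic_line Y \<sigma> \<Longrightarrow> geodesic_line Y (\<lambda>s. \<sigma> (- s))"
  by (auto simp: geodesic_line_def)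

lemma CAT0D:
  fixes x' y' z' p' q' :: "real ^ 2"
  assumes "CAT0 Y" "x \<in> mspace Y" "y \<in> mspace Y" "z \<in> mspace Y"
    "geodesic Y x y c1" "geodesic Y x z c2" "geodesic Y y z c3"
    "dist x' y' = mdist Y x y" "dist x' z' = mdist Y x z" "dist y' z' = mdist Y y z"
    "s \<in> {0..mdist Y x y}" "p' \<in> closed_segment x' y'" "dist x' p' = s"
    "t \<in> {0..mdist Y x z}" "q' \<in> closed_segment x' z'" "dist x' q' = t"
  shows "mdist Y (c1 s) (c2 t) \<le> dist p' q'"
proof -
  note CAT = assms(1)[unfolded CAT0_def]
  note C1 = CAT[THEN spec[of _ x], THEN spec[of _ y], THEN spec[of _ z], THEN spec[of _ c1],
      THEN spec[of _ c2], THEN spec[of _ c3], THEN spec[of _ s], THEN spec[of _ t]]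
  note C2 = C1[THEN spec[of _ x'], THEN spec[of _ y'], THEN spec[of _ z'], THEN spec[of _ p'],
      THEN spec[of _ q']]
  show ?thesis by (rule mp[OF C2]) (use assms in simp)
qed

locale hadamard =
  fixes Y :: "'a metric"
  assumes hadamard: "hadamard_space Y"
begin

abbreviation d :: "'a \<Rightarrow> 'a \<Rightarrow> real" where "d \<equiv> mdist Y"
abbreviation M :: "'a set" where "M \<equiv> mspace Y"

sublocale Metric_space M d by simp

lemma geodesic_exists: "x \<in> M \<Longrightarrow> y \<in> M \<Longrightarrow> \<exists>c. geodesic Y x y c"
  using hadamard by (auto simp: hadamard_space_def geodesic_space_def)

text \<open>The CAT(0) inequality in a form free of comparison triangles: the right hand side is the squared
distance of the comparison points, by the law of cosines. Written with \<open>N\<close>, \<open>L\<close> for the two sides and \<open>D\<close> for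
the third, the angle enters only through \<open>D\<^sup>2 - (N - L)\<^sup>2\<close>, which behaves well when
\<open>N\<close> and \<open>L\<close> tend to infinity with bounded difference. All comparison arguments below rest on this inequality.\<close>

lemma cat0_two_sides:
  assumes c1: "geodesic Y x y c1" and c2: "geodesic Y x z c2"
    and xyz: "x \<in> M" "y \<in> M" "z \<in> M" "x \<noteq> y" "x \<noteq> z"
    and s: "0 \<le> s" "s \<le> d x y" and t: "0 \<le> t" "t \<le> d x z"
  shows "(d (c1 s) (c2 t))\<^sup>2 \<le>
    (s - t)\<^sup>2 + s * t / (d x y * d x z) * ((d y z)\<^sup>2 - (d x y - d x z)\<^sup>2)"
proof -
  define N where "N = d x y"
  define L where "L = d x z"
  define D where "D = d y z"
  have pos: "0 < N" "0 < L" using xyz by (auto simp: N_def L_def)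
  have tri: "D \<le> N + L" "N \<le> L + D" "L \<le> N + D"
    using triangle[of y x z] triangle[of x z y] triangle[of x y z] xyz
    by (auto simp: N_def L_def D_def commute)
  obtain u v :: "real ^ 2"
    where u: "norm u = N" and v: "norm v = L" and uv: "u \<bullet> v = (N\<^sup>2 + L\<^sup>2 - D\<^sup>2) / 2"
    using comparison_vectors[OF pos tri] by blast
  have D0: "0 \<le> D" by (simp add: D_def)
  have "(dist u v)\<^sup>2 = D\<^sup>2"
    using u v uv dot_norm_neg[of u v] by (simp add: dist_norm)
  then have duv: "dist u v = D" using D0 by simp
  obtain c3 where c3: "geodesic Y y z c3" using geodesic_exists xyz by blast
  define p where "p = (s / N) *\<^sub>R u"
  define q where "q = (t / L) *\<^sub>R v"
  have p: "p \<in> closed_segment 0 u" "dist 0 p = s"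
    using s pos u by (auto simp: p_def closed_segment_def N_def[symmetric] intro!: exI[of _ "s / N"])
  have q: "q \<in> closed_segment 0 v" "dist 0 q = t"
    using t pos v by (auto simp: q_def closed_segment_def L_def[symmetric] intro!: exI[of _ "t / L"])
  have "CAT0 Y" using hadamard by (simp add: hadamard_space_def)
  then have "d (c1 s) (c2 t) \<le> dist p q"
    using xyz c1 c2 c3 u v duv s t p q
    by (intro CAT0D[of Y x y z c1 c2 c3 0 u v s p t q]) (auto simp: N_def L_def D_def)
  then have "(d (c1 s) (c2 t))\<^sup>2 \<le> (dist p q)\<^sup>2" by (intro power_mono) auto
  also have "\<dots> = s\<^sup>2 + t\<^sup>2 - 2 * (s / N) * (t / L) * (u \<bullet> v)"
  proof -
    have "(dist p q)\<^sup>2 = (norm p)\<^sup>2 + (norm q)\<^sup>2 - 2 * (p \<bullet> q)"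
      using dot_norm_neg[of p q] by (simp add: dist_norm)
    moreover have "norm p = s" "norm q = t" using p q by auto
    ultimately show ?thesis by (simp add: p_def q_def mult.commute mult.left_commute)
  qed
  also have "\<dots> = (s - t)\<^sup>2 + s * t / (N * L) * (D\<^sup>2 - (N - L)\<^sup>2)"
    using pos by (simp add: uv field_simps power2_eq_square)
  finally show ?thesis by (simp add: N_def L_def D_def)
qed

text \<open>The case of \<open>cat0_two_sides\<close> in which one of the two points is a vertex.\<close>

lemma stewart:
  assumes c: "geodesic Y y z c" and "x \<in> M" "y \<in> M" "z \<in> M" "y \<noteq> z"
    and s: "0 \<le> s" "s \<le> d y z"
  shows "(d x (c s))\<^sup>2 \<le>
    (1 - s / d y z) * (d x y)\<^sup>2 + (s / d y z) * (d x z)\<^sup>2 - s * (d y z - s)"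
proof (cases "x = y")
  case True
  have "c s \<in> M" "d y (c s) = s" using c s unfolding geodesic_def by force+
  then show ?thesis using True assms by (simp add: power2_eq_square field_simps)
next
  case False
  obtain e where e: "geodesic Y y x e" using geodesic_exists assms by blast
  have ex: "e (d y x) = x" using e by (auto simp: geodesic_def)
  have pos: "d y z > 0" "d y x > 0" using assms False by auto
  have "(d (c s) (e (d y x)))\<^sup>2 \<le>
    (s - d y x)\<^sup>2 + s * d y x / (d y z * d y x) * ((d z x)\<^sup>2 - (d y z - d y x)\<^sup>2)"
    by (rule cat0_two_sides[OF c e]) (use assms False in auto)
  also have "\<dots> = (1 - s / d y z) * (d x y)\<^sup>2 + (s / d y z) * (d x z)\<^sup>2 - s * (d y z - s)"
    using pos by (simp add: commute[of z x] commute[of x y] power2_eq_square field_simps)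
  finally show ?thesis by (simp add: ex commute[of x])
qed

lemma stewart_line:
  assumes \<sigma>: "geodesic_line Y \<sigma>" and x: "x \<in> M" and u: "0 \<le> u" "u \<le> 1"
  shows "(d x (\<sigma> ((1 - u) * a + u * b)))\<^sup>2 \<le>
    (1 - u) * (d x (\<sigma> a))\<^sup>2 + u * (d x (\<sigma> b))\<^sup>2 - u * (1 - u) * (a - b)\<^sup>2"
proof -
  have *: "(d x (\<sigma> ((1 - u) * a + u * b)))\<^sup>2 \<le>
    (1 - u) * (d x (\<sigma> a))\<^sup>2 + u * (d x (\<sigma> b))\<^sup>2 - u * (1 - u) * (a - b)\<^sup>2"
    if ab: "a < b" and u: "0 \<le> u" "u \<le> 1" for a b u
  proof -
    have dab: "d (\<sigma> a) (\<sigma> b) = b - a" using \<sigma> ab by (simp add: geodesic_lineD)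
    have pt: "a + u * (b - a) = (1 - u) * a + u * b" by (simp add: algebra_simps)
    have ne: "\<sigma> a \<noteq> \<sigma> b" using dab ab geodesic_lineD(1)[OF \<sigma>, of b] by auto
    have "(d x (\<sigma> (a + u * (b - a))))\<^sup>2 \<le>
      (1 - u * (b - a) / d (\<sigma> a) (\<sigma> b)) * (d x (\<sigma> a))\<^sup>2 +
      (u * (b - a) / d (\<sigma> a) (\<sigma> b)) * (d x (\<sigma> b))\<^sup>2
      - u * (b - a) * (d (\<sigma> a) (\<sigma> b) - u * (b - a))"
      by (rule stewart[OF geodesic_line_segment[OF \<sigma>]])
        (use ab u x ne \<sigma> in \<open>auto simp: geodesic_lineD mult_left_le_one_le\<close>)
    also have "\<dots> = (1 - u) * (d x (\<sigma> a))\<^sup>2 + u * (d x (\<sigma> b))\<^sup>2 - u * (1 - u) * (a - b)\<^sup>2"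
      using ab by (simp add: dab) (simp add: power2_eq_square algebra_simps)
    finally show ?thesis unfolding pt .
  qed
  consider "a < b" | "a = b" | "b < a" by linarith
  then show ?thesis
  proof cases
    case 2
    have "(1 - u) * b + u * b = b" by (simp add: algebra_simps)
    moreover have "(1 - u) * (d x (\<sigma> b))\<^sup>2 + u * (d x (\<sigma> b))\<^sup>2 = (d x (\<sigma> b))\<^sup>2"
      by (simp add: algebra_simps)
    ultimately show ?thesis using 2 by simp
  next
    case 3
    from *[OF 3, of "1 - u"] u show ?thesis
      by (simp add: algebra_simps power2_commute)
  qed (use * u in auto)
qed

lemma dist_line_lipschitz:
  assumes "geodesic_line Y \<sigma>" "x \<in> M"
  shows "\<bar>d x (\<sigma> s) - d x (\<sigma> t)\<bar> \<le> \<bar>s - t\<bar>"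
proof -
  have "d (\<sigma> s) (\<sigma> t) = \<bar>s - t\<bar>" "\<sigma> s \<in> M" "\<sigma> t \<in> M" using assms by (auto simp: geodesic_lineD)
  then show ?thesis using triangle[of x "\<sigma> s" "\<sigma> t"] triangle[of x "\<sigma> t" "\<sigma> s"] assms
    by (auto simp: commute)
qed

text \<open>If \<open>A\<close> and \<open>B\<close> are the distances at \<open>a\<close> and \<open>b\<close>, the square of their interpolation exceeds the bound of
\<open>stewart_line\<close> by \<open>u * (1 - u) * ((a - b)\<^sup>2 - (A - B)\<^sup>2)\<close>, which is nonnegative since distances to a line are 1-Lipschitz.\<close>

lemma dist_line_convex:
  assumes \<sigma>: "geodesic_line Y \<sigma>" and x: "x \<in> M"
  shows "convex_on UNIV (\<lambda>t. d x (\<sigma> t))"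
proof (intro convex_onI)
  fix u a b :: real assume u: "0 < u" "u < 1"
  define A where "A = d x (\<sigma> a)"
  define B where "B = d x (\<sigma> b)"
  have AB: "0 \<le> (1 - u) * A + u * B" using u by (simp add: A_def B_def)
  have "\<bar>A - B\<bar> \<le> \<bar>a - b\<bar>"
    using dist_line_lipschitz[OF \<sigma> x] by (simp add: A_def B_def)
  then have "(A - B)\<^sup>2 \<le> (a - b)\<^sup>2" by (simp add: abs_le_square_iff)
  then have "u * (1 - u) * (A - B)\<^sup>2 \<le> u * (1 - u) * (a - b)\<^sup>2"
    using u by (intro mult_left_mono) auto
  then have "(1 - u) * A\<^sup>2 + u * B\<^sup>2 - u * (1 - u) * (a - b)\<^sup>2 \<le> ((1 - u) * A + u * B)\<^sup>2"
    by (simp add: power2_eq_square algebra_simps)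
  then have "(d x (\<sigma> ((1 - u) * a + u * b)))\<^sup>2 \<le> ((1 - u) * A + u * B)\<^sup>2"
    using stewart_line[OF \<sigma> x, of u a b] u unfolding A_def B_def by linarith
  then have "d x (\<sigma> ((1 - u) * a + u * b)) \<le> (1 - u) * A + u * B"
    using AB by (rule power2_le_imp_le)
  then show "d x (\<sigma> ((1 - u) *\<^sub>R a + u *\<^sub>R b)) \<le> (1 - u) * d x (\<sigma> a) + u * d x (\<sigma> b)"
    by (simp add: A_def B_def)
qed (simp)

end

section \<open>Proper Hadamard spaces and flat half planes\<close>

text \<open>Otherwise every point of \<open>K\<close> has a neighbourhood that the sequence finally avoids, and finitely many of these cover
\<open>K\<close>. The topology \<open>T\<close> is arbitrary, so convergent subsequences need not exist.\<close>

lemma compactin_cluster: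
  fixes f :: "nat \<Rightarrow> 'b"
  assumes K: "compactin T K" and f: "\<And>n. f n \<in> K"
  obtains x where "x \<in> K" "\<forall>U n. openin T U \<longrightarrow> x \<in> U \<longrightarrow> (\<exists>m\<ge>n. f m \<in> U)"
proof (rule ccontr)
  assume "\<not> thesis"
  then have "\<forall>x\<in>K. \<exists>U n. openin T U \<and> x \<in> U \<and> (\<forall>m\<ge>n. f m \<notin> U)" using that by metis
  then obtain U n where Un: "\<And>x. x \<in> K \<Longrightarrow> openin T (U x)" "\<And>x. x \<in> K \<Longrightarrow> x \<in> U x"
    "\<And>x m. x \<in> K \<Longrightarrow> m \<ge> n x \<Longrightarrow> f m \<notin> U x" by metis
  have "\<exists>\<F>. finite \<F> \<and> \<F> \<subseteq> U ` K \<and> K \<subseteq> \<Union>\<F>"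
    using Un(1,2) by (intro compactinD[OF K]) auto
  then obtain J where J: "finite J" "J \<subseteq> K" "K \<subseteq> (\<Union>x\<in>J. U x)"
    by (metis finite_subset_image)
  define m where "m = (\<Sum>x\<in>J. n x)"
  have "f m \<notin> U x" if "x \<in> J" for x
    using that J Un(3)[of x m] by (auto simp: m_def intro!: member_le_sum)
  then show False using J f by blast
qed

locale proper_hadamard = hadamard +
  assumes locally_compact: "locally_compact_space (mtopology_of Y)"
begin

lemma mtopology_eq: "mtopology_of Y = mtopology"
  by (simp add: mtopology_of_def)

lemma complete: mcomplete
  using hadamard by (simp add: hadamard_space_def mcomplete_of_def)

lemma geodesic_shorten:
  assumes "a \<in> M" "x \<in> M" "0 \<le> r" "r \<le> d a x"
  obtains y where "y \<in> M" "d a y = r" "d y x = d a x - r"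
proof -
  obtain c where c: "geodesic Y a x c" using geodesic_exists assms by blast
  have "c 0 = a" "c (d a x) = x" "c r \<in> M"
    "\<And>s t. s \<in> {0..d a x} \<Longrightarrow> t \<in> {0..d a x} \<Longrightarrow> d (c s) (c t) = \<bar>s - t\<bar>"
    using c assms by (auto simp: geodesic_def)
  from this(3) this(4)[of 0 r] this(4)[of r "d a x"] this(1,2) show thesis
    using assms by (intro that[of "c r"]) auto
qed

text \<open>The Hopf--Rinow theorem. Let \<open>\<rho>\<close> be the supremum of the radii of compact balls about \<open>a\<close>. The ball of
radius \<open>\<rho>\<close> is totally bounded, because geodesics bring its points close to slightly smaller balls; hence it is
compact by completeness. A compact neighbourhood of it contains a ball of larger radius.\<close>

lemma compactin_mcball: "compactin mtopology (mcball a r)"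
proof (cases "a \<in> M")
  case False
  then have "mcball a r = {}" by auto
  then show ?thesis by simp
next
  case a: True
  define S where "S = {r. compactin mtopology (mcball a r)}"
  have down: "r \<in> S" if "r' \<in> S" "r \<le> r'" for r r'
  proof -
    have "mcball a r \<subseteq> mcball a r'" using that by auto
    then show ?thesis using that unfolding S_def by (auto intro: closed_compactin)
  qed
  have "x = a" if "x \<in> mcball a 0" for x
    using that by (metis in_mcball leD mdist_pos_less)
  then have "mcball a 0 = {a}" using a by auto
  then have S0: "0 \<in> S" using a by (simp add: S_def)
  show ?thesis
  proof (rule ccontr)
    assume "\<not> ?thesis"
    then have "r \<notin> S" by (simp add: S_def)
    then have bdd: "bdd_above S" using down by (meson bdd_above.I nle_le)
    define \<rho> where "\<rho> = Sup S"
    have \<rho>0: "0 \<le> \<rho>" unfolding \<rho>_def by (rule cSup_upper[OF S0 bdd])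
    have "mtotally_bounded (mcball a \<rho>)"
      unfolding mtotally_bounded_def
    proof (intro allI impI)
      fix \<epsilon> :: real assume \<epsilon>: "\<epsilon> > 0"
      have "\<rho> - \<epsilon> / 4 < Sup S" using \<epsilon> by (simp add: \<rho>_def)
      then obtain r1 where "r1 \<in> S" "\<rho> - \<epsilon> / 4 < r1" using S0 less_cSupE by blast
      moreover have "r1 \<le> \<rho>" unfolding \<rho>_def using \<open>r1 \<in> S\<close> bdd by (rule cSup_upper)
      ultimately obtain r0 where r0: "r0 \<in> S" "\<rho> - \<epsilon> / 4 < r0" "0 \<le> r0" "r0 \<le> \<rho>"
        using S0 \<rho>0 by (metis linorder_le_cases order_less_le_trans)
      have "mtotally_bounded (mcball a r0)"
        using r0 by (auto simp: S_def intro: compactin_imp_mtotally_bounded)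
      then obtain K where K: "finite K" "K \<subseteq> mcball a r0" "mcball a r0 \<subseteq> (\<Union>x\<in>K. mball x (\<epsilon> / 2))"
        using \<epsilon> unfolding mtotally_bounded_def by (meson half_gt_zero)
      have "mcball a \<rho> \<subseteq> (\<Union>x\<in>K. mball x \<epsilon>)"
      proof
        fix x assume x: "x \<in> mcball a \<rho>"
        have "\<exists>y. y \<in> mcball a r0 \<and> d y x < \<epsilon> / 2"
        proof (cases "d a x \<le> r0")
          case True
          then show ?thesis using x \<epsilon> by (intro exI[of _ x]) auto
        next
          case False
          obtain y where "y \<in> M" "d a y = r0" "d y x = d a x - r0"
            using geodesic_shorten[OF a, of x r0] x r0 False by auto
          then show ?thesis using x r0 a \<epsilon> by (intro exI[of _ y]) auto
        qed
        then obtain y z where "z \<in> K" "y \<in> mball z (\<epsilon> / 2)" "d y x < \<epsilon> / 2" using K by blast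
        then show "x \<in> (\<Union>x\<in>K. mball x \<epsilon>)" using triangle[of z y x] x by fastforce
      qed
      moreover have "K \<subseteq> mcball a \<rho>" using K(2) r0 by auto
      ultimately show "\<exists>K. finite K \<and> K \<subseteq> mcball a \<rho> \<and> mcball a \<rho> \<subseteq> (\<Union>x\<in>K. mball x \<epsilon>)"
        using K(1) by blast
    qed
    then have comp: "compactin mtopology (mcball a \<rho>)"
      using mtotally_bounded_eq_compact_closure_of[OF complete, of "mcball a \<rho>"]
      by (simp add: closure_of_closedin)
    obtain U L where UL: "openin mtopology U" "compactin mtopology L" "mcball a \<rho> \<subseteq> U" "U \<subseteq> L"
      using locally_compact comp Hausdorff_space_mtopology
      unfolding mtopology_eq by (metis locally_compact_space_compact_closed_compact)
    obtain \<delta> where \<delta>: "\<delta> > 0" "\<And>x. x \<in> mcball a \<rho> \<Longrightarrow> mball x \<delta> \<subseteq> U"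
      using lebesgue_number[OF comp, of "{U}"] UL by auto
    have "mcball a (\<rho> + \<delta> / 2) \<subseteq> L"
    proof
      fix x assume x: "x \<in> mcball a (\<rho> + \<delta> / 2)"
      show "x \<in> L"
      proof (cases "d a x \<le> \<rho>")
        case True
        then show ?thesis using x UL by auto
      next
        case False
        obtain y where "y \<in> M" "d a y = \<rho>" "d y x = d a x - \<rho>"
          using geodesic_shorten[OF a, of x \<rho>] x \<rho>0 False by auto
        then have "x \<in> mball y \<delta>" "y \<in> mcball a \<rho>" using x a \<delta>(1) by auto
        then show ?thesis using \<delta>(2) UL by blast
      qed
    qed
    then have "\<rho> + \<delta> / 2 \<in> S" unfolding S_def using UL by (auto intro: closed_compactin)
    then have "\<rho> + \<delta> / 2 \<le> \<rho>" unfolding \<rho>_def using bdd by (rule cSup_upper)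
    then show False using \<delta> by simp
  qed
qed

text \<open>Tychonoff's theorem replaces a diagonal argument here: a pointwise bounded sequence of functions on
an arbitrary set \<open>H\<close> has a cluster point for pointwise convergence. Two points at a time suffice to pass
information on distances to the limit.\<close>

lemma cluster_function:
  fixes f :: "nat \<Rightarrow> 'b \<Rightarrow> 'a"
  assumes fM: "\<And>n P. P \<in> H \<Longrightarrow> f n P \<in> M"
    and bd: "\<And>P. P \<in> H \<Longrightarrow> \<exists>a\<in>M. \<exists>R. \<forall>n. d a (f n P) \<le> R"
  obtains F where "\<And>P. P \<in> H \<Longrightarrow> F P \<in> M"
    "\<And>P Q e n0. P \<in> H \<Longrightarrow> Q \<in> H \<Longrightarrow> e > 0 \<Longrightarrow>
      \<exists>n\<ge>n0. d (f n P) (F P) < e \<and> d (f n Q) (F Q) < e"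
proof -
  obtain a R where aR: "\<And>P. P \<in> H \<Longrightarrow> a P \<in> M" "\<And>P n. P \<in> H \<Longrightarrow> d (a P) (f n P) \<le> R P"
    using bd by metis
  define K where "K = (\<Pi>\<^sub>E P\<in>H. mcball (a P) (R P))"
  define T where "T = product_topology (\<lambda>P. mtopology) H"
  have K: "compactin T K" unfolding T_def K_def by (simp add: compactin_PiE compactin_mcball)
  have fK: "restrict (f n) H \<in> K" for n using fM aR by (auto simp: K_def)
  obtain F where F: "F \<in> K"
      "\<forall>U n. openin T U \<longrightarrow> F \<in> U \<longrightarrow> (\<exists>m\<ge>n. restrict (f m) H \<in> U)"
    using compactin_cluster[where f = "\<lambda>n. restrict (f n) H", OF K fK] by blast
  have FM: "F P \<in> M" if "P \<in> H" for P using F(1) that by (auto simp: K_def)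
  have ext: "F \<in> extensional H" using F(1) by (auto simp: K_def PiE_def)
  have op: "openin T {G \<in> topspace T. G P \<in> mball (F P) e}" if "P \<in> H" for P e
    using continuous_map_product_projection[OF that, of "\<lambda>P. mtopology"]
    unfolding T_def continuous_map_def by auto
  show thesis
  proof (rule that[of F])
    fix P Q :: 'b and e :: real and n0 :: nat
    assume PQ: "P \<in> H" "Q \<in> H" "e > 0"
    let ?U = "{G \<in> topspace T. G P \<in> mball (F P) e} \<inter> {G \<in> topspace T. G Q \<in> mball (F Q) e}"
    have "openin T ?U" using op PQ by blast
    moreover have "F \<in> ?U" using FM PQ ext by (auto simp: T_def PiE_def Pi_def)
    ultimately obtain m where "m \<ge> n0" "restrict (f m) H \<in> ?U" using F(2) by blast
    then show "\<exists>n\<ge>n0. d (f n P) (F P) < e \<and> d (f n Q) (F Q) < e"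
      using PQ by (intro exI[of _ m]) (auto simp: commute)
  qed (rule FM)
qed

text \<open>If \<open>x n\<close> stayed bounded, its distance to \<open>\<sigma> t\<close> would be \<open>t\<close> up to a bounded error for large \<open>t\<close>, which excludes
\<open>l < 1\<close>.\<close>

lemma filterlim_dist_line:
  assumes \<sigma>: "geodesic_line Y \<sigma>" and x: "\<And>n. x n \<in> M" and l: "\<bar>l\<bar> < 1"
    and lim: "\<And>t. (\<lambda>n. d (x n) (\<sigma> t) - d (x n) (\<sigma> 0)) \<longlonglongrightarrow> l * t"
  shows "filterlim (\<lambda>n. d (x n) (\<sigma> t)) at_top sequentially"
  unfolding filterlim_at_top
proof
  fix Z :: real
  define T where "T = (2 * (\<bar>Z\<bar> + \<bar>t\<bar>) + 1) / (1 - l)"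
  have T: "T * (1 - l) = 2 * (\<bar>Z\<bar> + \<bar>t\<bar>) + 1" "T \<ge> 0" using l by (auto simp: T_def)
  have "\<forall>\<^sub>F n in sequentially. d (x n) (\<sigma> T) - d (x n) (\<sigma> 0) < l * T + 1"
    using lim[of T] by (rule order_tendstoD) simp
  then show "\<forall>\<^sub>F n in sequentially. Z \<le> d (x n) (\<sigma> t)"
  proof eventually_elim
    case (elim n)
    have "T \<le> d (x n) (\<sigma> T) + d (x n) (\<sigma> 0)"
      using triangle[of "\<sigma> 0" "x n" "\<sigma> T"] T x geodesic_lineD[OF \<sigma>] by (auto simp: commute)
    then have "T * (1 - l) - 1 \<le> 2 * d (x n) (\<sigma> 0)" using elim by (simp add: algebra_simps)
    moreover have "d (x n) (\<sigma> 0) - d (x n) (\<sigma> t) \<le> \<bar>t\<bar>"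
      using dist_line_lipschitz[OF \<sigma> x, of n 0 t] by simp
    ultimately have "\<bar>Z\<bar> \<le> d (x n) (\<sigma> t)" unfolding T(1) by argo
    then show ?case by linarith
  qed
qed

text \<open>If the distances from \<open>x n\<close> to the points of the line become affine with a slope \<open>l\<close> strictly between -1
and 1, then the triangles with vertex \<open>x n\<close> and base on the line converge to a flat half plane: an affine Busemann
function means that the rays towards the limit of \<open>x n\<close> meet the line at a constant angle.

The half plane is constructed with oblique coordinates. The point \<open>Q\<close> of the Euclidean half plane lies at
distance \<open>height Q\<close> from \<open>foot Q\<close> in the direction \<open>(- l, \<mu>)\<close> of the limit, and \<open>f n Q\<close> is the corresponding point on the
geodesic from \<open>\<sigma> (foot Q)\<close> to \<open>x n\<close>. A cluster point \<open>F\<close> of the maps \<open>f n\<close> is 1-Lipschitz by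
\<open>cat0_two_sides\<close>. It preserves distances to the boundary line, because a convex function below an affine one that
touches it is equal to it. It preserves all distances, because the segment between two points of the
half plane extends to the boundary line unless it is parallel to it.\<close>

lemma flat_half_plane_limit:
  assumes \<sigma>: "geodesic_line Y \<sigma>" and x: "\<And>n. x n \<in> M" and l: "\<bar>l\<bar> < 1"
    and lim: "\<And>t. (\<lambda>n. d (x n) (\<sigma> t) - d (x n) (\<sigma> 0)) \<longlonglongrightarrow> l * t"
  shows "bounds_flat_half_plane Y \<sigma>"
proof -
  define N where "N = (\<lambda>n t. d (x n) (\<sigma> t))"
  have \<sigma>M: "\<sigma> t \<in> M" for t using \<sigma> by (simp add: geodesic_lineD)
  have Nlim: "filterlim (\<lambda>n. N n t) at_top sequentially" for t
    unfolding N_def by (rule filterlim_dist_line[OF \<sigma> x l lim])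
  have Nev: "\<forall>\<^sub>F n in sequentially. s < N n t" for s t
    using Nlim[of t] by (simp add: filterlim_at_top_dense)
  define c where "c = (\<lambda>n t. SOME c. geodesic Y (x n) (\<sigma> t) c)"
  have c: "geodesic Y (x n) (\<sigma> t) (c n t)" for n t
    unfolding c_def using geodesic_exists[OF x \<sigma>M] by (rule someI_ex)
  define \<mu> where "\<mu> = sqrt (1 - l\<^sup>2)"
  have "l\<^sup>2 < 1" using l by (simp add: abs_square_less_1)
  then have \<mu>: "\<mu> > 0" "\<mu>\<^sup>2 = 1 - l\<^sup>2" by (auto simp: \<mu>_def)
  define H :: "(real \<times> real) set" where "H = UNIV \<times> {0..}"
  define foot where "foot = (\<lambda>P :: real \<times> real. fst P + l * (snd P / \<mu>))"
  define height where "height = (\<lambda>P :: real \<times> real. snd P / \<mu>)"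
  have h0: "0 \<le> height P" if "P \<in> H" for P using that \<mu> by (auto simp: height_def H_def)
  \<comment> \<open>The second branch is a default; for each \<open>P\<close> it occurs for finitely many \<open>n\<close> only.\<close>
  define f where "f = (\<lambda>n P. if height P \<le> N n (foot P)
    then c n (foot P) (N n (foot P) - height P) else \<sigma> (foot P))"
  have fM: "f n P \<in> M" if "P \<in> H" for n P
    using c[of n "foot P"] h0[OF that] \<sigma>M by (auto simp: f_def geodesic_def N_def)
  have f_foot: "d (\<sigma> (foot P)) (f n P) \<le> height P" if "P \<in> H" for n P
  proof (cases "height P \<le> N n (foot P)")
    case True
    let ?L = "d (x n) (\<sigma> (foot P))"
    have "d (c n (foot P) (?L - height P)) (\<sigma> (foot P)) = ?L - (?L - height P)"
      by (rule geodesicD[OF c]) (use h0[OF that] True in \<open>auto simp: N_def\<close>)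
    then show ?thesis using True h0[OF that] by (simp add: f_def N_def commute)
  qed (use h0[OF that] \<sigma>M in \<open>simp add: f_def\<close>)
  have sq: "(dist P Q)\<^sup>2 = (l * (foot P - foot Q) - height P + height Q)\<^sup>2
      + ((foot P - foot Q)\<^sup>2 - (l * (foot P - foot Q))\<^sup>2)" for P Q
  proof -
    obtain p1 p2 where P: "P = (p1, p2)" by force
    obtain q1 q2 where Q: "Q = (q1, q2)" by force
    define s where "s = p2 / \<mu>"
    define s' where "s' = q2 / \<mu>"
    have p2: "p2 = \<mu> * s" "q2 = \<mu> * s'" using \<mu> by (auto simp: s_def s'_def)
    have "(dist P Q)\<^sup>2 = (p1 - q1)\<^sup>2 + (p2 - q2)\<^sup>2"
      unfolding P Q dist_Pair_Pair by (simp add: dist_real_def)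
    also have "(p2 - q2)\<^sup>2 = \<mu>\<^sup>2 * (s - s')\<^sup>2"
      unfolding p2 by (simp add: power_mult_distrib[symmetric] algebra_simps)
    also have "(p1 - q1)\<^sup>2 + \<mu>\<^sup>2 * (s - s')\<^sup>2 =
      (l * ((p1 + l * s) - (q1 + l * s')) - s + s')\<^sup>2
      + (((p1 + l * s) - (q1 + l * s'))\<^sup>2 - (l * ((p1 + l * s) - (q1 + l * s')))\<^sup>2)"
      unfolding \<mu>(2) by (simp add: power2_eq_square algebra_simps)
    finally show ?thesis by (simp add: P Q foot_def height_def s_def s'_def)
  qed
  define B where "B = (\<lambda>n P Q. (N n (foot P) - N n (foot Q) - height P + height Q)\<^sup>2
    + (1 - height P / N n (foot P)) * (1 - height Q / N n (foot Q))
      * ((foot P - foot Q)\<^sup>2 - (N n (foot P) - N n (foot Q))\<^sup>2))"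
  have Blim: "(\<lambda>n. B n P Q) \<longlonglongrightarrow> (dist P Q)\<^sup>2" for P Q
  proof -
    have "(\<lambda>n. N n (foot P) - N n (foot Q)) \<longlonglongrightarrow> l * foot P - l * foot Q"
      using tendsto_diff[OF lim[of "foot P"] lim[of "foot Q"]] by (simp add: N_def)
    then have 1: "(\<lambda>n. N n (foot P) - N n (foot Q)) \<longlonglongrightarrow> l * (foot P - foot Q)"
      by (simp add: algebra_simps)
    have 2: "(\<lambda>n. h / N n t) \<longlonglongrightarrow> 0" for h t
      using Nlim[of t] by (intro tendsto_divide_0[OF tendsto_const] filterlim_at_top_imp_at_infinity)
    have "(\<lambda>n. B n P Q) \<longlonglongrightarrow> (l * (foot P - foot Q) - height P + height Q)\<^sup>2
      + (1 - 0) * (1 - 0) * ((foot P - foot Q)\<^sup>2 - (l * (foot P - foot Q))\<^sup>2)"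
      unfolding B_def by (intro tendsto_intros 1 2)
    then show ?thesis by (simp add: sq)
  qed
  have fB: "\<forall>\<^sub>F n in sequentially. (d (f n P) (f n Q))\<^sup>2 \<le> B n P Q" if "P \<in> H" "Q \<in> H" for P Q
    using Nev[of "height P" "foot P"] Nev[of "height Q" "foot Q"]
  proof eventually_elim
    case (elim n)
    have pos: "0 < N n (foot P)" "0 < N n (foot Q)"
      using elim h0 that by (meson order_le_less_trans)+
    then have ne: "x n \<noteq> \<sigma> (foot P)" "x n \<noteq> \<sigma> (foot Q)" using \<sigma>M by (auto simp: N_def)
    have "(d (c n (foot P) (N n (foot P) - height P)) (c n (foot Q) (N n (foot Q) - height Q)))\<^sup>2
      \<le> ((N n (foot P) - height P) - (N n (foot Q) - height Q))\<^sup>2 +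
        (N n (foot P) - height P) * (N n (foot Q) - height Q)
          / (d (x n) (\<sigma> (foot P)) * d (x n) (\<sigma> (foot Q)))
        * ((d (\<sigma> (foot P)) (\<sigma> (foot Q)))\<^sup>2 - (d (x n) (\<sigma> (foot P)) - d (x n) (\<sigma> (foot Q)))\<^sup>2)"
      by (rule cat0_two_sides[OF c c]) (use x \<sigma>M ne elim h0 that in \<open>auto simp: N_def\<close>)
    also have "\<dots> = B n P Q"
    proof -
      have 1: "(N n (foot P) - height P) * (N n (foot Q) - height Q) / (N n (foot P) * N n (foot Q))
        = (1 - height P / N n (foot P)) * (1 - height Q / N n (foot Q))"
        using pos by (simp add: diff_divide_distrib flip: times_divide_times_eq)
      have 2: "(d (\<sigma> (foot P)) (\<sigma> (foot Q)))\<^sup>2 = (foot P - foot Q)\<^sup>2"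
        by (simp add: geodesic_lineD[OF \<sigma>])
      have 3: "(N n (foot P) - height P) - (N n (foot Q) - height Q)
        = N n (foot P) - N n (foot Q) - height P + height Q" by simp
      have 4: "d (x n) (\<sigma> t) = N n t" for t by (simp add: N_def)
      show ?thesis unfolding B_def 2 3 4 1 ..
    qed
    finally show ?case using elim by (simp add: f_def)
  qed
  have bd: "\<exists>a\<in>M. \<exists>R. \<forall>n. d a (f n P) \<le> R" if "P \<in> H" for P
    using f_foot[OF that] \<sigma>M by blast
  obtain F where FM: "\<And>P. P \<in> H \<Longrightarrow> F P \<in> M"
    and F: "\<And>P Q e n0. P \<in> H \<Longrightarrow> Q \<in> H \<Longrightarrow> e > 0 \<Longrightarrow>
      \<exists>n\<ge>n0. d (f n P) (F P) < e \<and> d (f n Q) (F Q) < e"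
    using cluster_function[of H f, OF fM bd] by blast
  have upper: "d (F P) (F Q) \<le> dist P Q" if PQ: "P \<in> H" "Q \<in> H" for P Q
  proof (rule field_le_epsilon)
    fix e :: real assume e: "e > 0"
    have "(dist P Q)\<^sup>2 < (dist P Q + e / 3)\<^sup>2" using e by (intro power_strict_mono) auto
    then have "\<forall>\<^sub>F n in sequentially. B n P Q < (dist P Q + e / 3)\<^sup>2"
      by (rule order_tendstoD(2)[OF Blim])
    then have "\<forall>\<^sub>F n in sequentially. (d (f n P) (f n Q))\<^sup>2 < (dist P Q + e / 3)\<^sup>2"
      using fB[OF PQ] by eventually_elim linarith
    then obtain n0 where n0: "\<And>n. n \<ge> n0 \<Longrightarrow> (d (f n P) (f n Q))\<^sup>2 < (dist P Q + e / 3)\<^sup>2"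
      by (auto simp: eventually_sequentially)
    obtain n where n: "n \<ge> n0" "d (f n P) (F P) < e / 3" "d (f n Q) (F Q) < e / 3"
      using F[OF PQ, of "e / 3" n0] e by auto
    have "d (f n P) (f n Q) < dist P Q + e / 3"
      using n0[OF n(1)] by (rule power2_less_imp_less) (use e in auto)
    then show "d (F P) (F Q) \<le> dist P Q + e"
      using n(2,3) triangle[of "F P" "f n P" "F Q"] triangle[of "f n P" "f n Q" "F Q"]
        FM[OF PQ(1)] FM[OF PQ(2)] fM[OF PQ(1), of n] fM[OF PQ(2), of n]
      by (simp add: commute[of "F P" "f n P"])
  qed
  have F0: "F (t, 0) = \<sigma> t" for t
  proof -
    have H: "(t, 0) \<in> H" by (simp add: H_def)
    have f0: "f n (t, 0) = \<sigma> t" for n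
      using c[of n t] by (auto simp: f_def foot_def height_def N_def geodesic_def)
    have "d (\<sigma> t) (F (t, 0)) \<le> 0"
    proof (rule field_le_epsilon)
      fix e :: real assume "e > 0"
      then show "d (\<sigma> t) (F (t, 0)) \<le> 0 + e" using F[OF H H, of e 0] by (auto simp: f0)
    qed
    then show ?thesis using \<sigma>M FM[OF H] by (simp add: order_antisym_conv)
  qed
  have H0: "(t, 0) \<in> H" for t by (simp add: H_def)
  have upper0: "d (F P) (\<sigma> t) \<le> dist P (t, 0)" if "P \<in> H" for P t
    using upper[OF that H0, of t] by (simp add: F0)
  have foot_height: "dist P (foot P, 0) = height P" if PH: "P \<in> H" for P
  proof -
    have "(dist P (foot P, 0))\<^sup>2 = (height P)\<^sup>2"
      unfolding sq by (simp add: foot_def height_def power2_eq_square)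
    then show ?thesis using h0[OF PH] by simp
  qed
  have foot_dist: "d (F P) (\<sigma> (foot P)) = height P" if PH: "P \<in> H" for P
  proof -
    have "d (F P) (\<sigma> (foot P)) \<ge> height P"
    proof (rule field_le_epsilon)
      fix e :: real assume e: "e > 0"
      obtain n0 where n0: "\<And>n. n \<ge> n0 \<Longrightarrow> height P < N n (foot P)"
        using Nev[of "height P" "foot P"] by (auto simp: eventually_sequentially)
      obtain n where n: "n \<ge> n0" "d (f n P) (F P) < e" using F[OF PH PH e, of n0] by blast
      let ?L = "d (x n) (\<sigma> (foot P))"
      have "d (c n (foot P) (?L - height P)) (\<sigma> (foot P)) = ?L - (?L - height P)"
        by (rule geodesicD[OF c]) (use h0[OF PH] n0[OF n(1)] in \<open>auto simp: N_def\<close>)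
      then have "d (f n P) (\<sigma> (foot P)) = height P"
        using n0[OF n(1)] h0[OF PH] by (simp add: f_def N_def)
      then show "height P \<le> d (F P) (\<sigma> (foot P)) + e"
        using n(2) triangle[of "f n P" "F P" "\<sigma> (foot P)"] FM[OF PH] fM[OF PH] \<sigma>M by force
    qed
    then show ?thesis using upper0[OF PH, of "foot P"] by (simp add: foot_height[OF PH])
  qed
  have lower0: "d (F P) (\<sigma> t) = dist P (t, 0)" if PH: "P \<in> H" for P t
  proof -
    \<comment> \<open>Reflect \<open>t\<close> at the foot: the upper bound at \<open>t'\<close> gives the lower bound at \<open>t\<close>.\<close>
    define t' where "t' = 2 * foot P - t"
    have mid: "(1 - 1/2) * t + 1/2 * t' = foot P" by (simp add: t'_def field_simps)
    have "(height P)\<^sup>2 \<le> 1/2 * (d (F P) (\<sigma> t))\<^sup>2 + 1/2 * (d (F P) (\<sigma> t'))\<^sup>2 - 1/4 * (t - t')\<^sup>2"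
      using stewart_line[OF \<sigma> FM[OF PH], of "1/2" t t'] unfolding mid foot_dist[OF PH] by simp
    moreover have "(d (F P) (\<sigma> t'))\<^sup>2 \<le> (dist P (t', 0))\<^sup>2"
      using upper0[OF PH] by (intro power_mono) auto
    moreover have "(dist P (t, 0))\<^sup>2 = 2 * (height P)\<^sup>2 + 1/2 * (t - t')\<^sup>2 - (dist P (t', 0))\<^sup>2"
    proof -
      have d0: "(dist P (\<tau>, 0))\<^sup>2 = (fst P - \<tau>)\<^sup>2 + (snd P)\<^sup>2" for \<tau>
        by (cases P) (simp add: dist_Pair_Pair dist_real_def)
      show ?thesis
        unfolding foot_height[OF PH, symmetric] d0
        by (simp add: t'_def power2_eq_square algebra_simps)
    qed
    ultimately have "(dist P (t, 0))\<^sup>2 \<le> (d (F P) (\<sigma> t))\<^sup>2" by linarith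
    then have "dist P (t, 0) \<le> d (F P) (\<sigma> t)" by (rule power2_le_imp_le) simp
    then show ?thesis using upper0[OF PH, of t] by simp
  qed
  have low1: "dist P Q \<le> d (F P) (F Q)" if PQ: "P \<in> H" "Q \<in> H" "snd P < snd Q" for P Q
  proof -
    define k where "k = snd P / (snd Q - snd P)"
    have k: "k \<ge> 0" "snd P + k * (snd P - snd Q) = 0"
      using PQ by (auto simp: k_def H_def field_simps)
    \<comment> \<open>\<open>R\<close> is the point where the line from \<open>Q\<close> through \<open>P\<close> hits the boundary.\<close>
    define R where "R = P + k *\<^sub>R (P - Q)"
    have R: "R = (fst R, 0)" using k(2) by (intro prod_eqI) (auto simp: R_def)
    have RP: "dist P R = k * dist P Q" using k by (simp add: R_def dist_norm)
    have "R - Q = (1 + k) *\<^sub>R (P - Q)" by (simp add: R_def algebra_simps)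
    then have "dist R Q = norm ((1 + k) *\<^sub>R (P - Q))" by (simp only: dist_norm)
    then have RQ: "dist Q R = (1 + k) * dist P Q" using k by (simp add: dist_commute[of Q R]) (simp add: dist_norm)
    have "dist P Q = dist Q R - dist P R" using RP RQ by (simp add: algebra_simps)
    also have "\<dots> = d (F Q) (\<sigma> (fst R)) - d (F P) (\<sigma> (fst R))"
      using lower0 PQ R by metis
    also have "\<dots> \<le> d (F P) (F Q)"
      using triangle[of "F Q" "F P" "\<sigma> (fst R)"] FM PQ \<sigma>M by (auto simp: commute)
    finally show ?thesis .
  qed
  have low: "dist P Q \<le> d (F P) (F Q)" if PQ: "P \<in> H" "Q \<in> H" for P Q
  proof -
    consider "snd P < snd Q" | "snd Q < snd P" | "snd P = snd Q" by linarith
    then show ?thesis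
    proof cases
      case 3
      show ?thesis
      proof (rule field_le_epsilon)
        fix e :: real assume e: "e > 0"
        \<comment> \<open>A segment parallel to the boundary is tilted slightly.\<close>
        define Q' where "Q' = (fst Q, snd Q + e / 2)"
        have Q': "Q' \<in> H" "snd P < snd Q'" "dist Q' Q = e / 2"
          using PQ e 3 by (auto simp: Q'_def H_def dist_prod_def dist_real_def)
        have "d (F P) (F Q') \<le> d (F P) (F Q) + d (F Q') (F Q)"
          using triangle[of "F P" "F Q" "F Q'"] FM PQ Q' by (auto simp: commute)
        then show "dist P Q \<le> d (F P) (F Q) + e"
          using low1[OF PQ(1) Q'(1,2)] upper[OF Q'(1) PQ(2)] Q'(3) dist_triangle[of P Q Q'] by linarith
      qed
    next
      case 2
      then show ?thesis using low1[of Q P] PQ by (simp add: dist_commute commute)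
    qed (use low1 PQ in auto)
  qed
  have "d (F P) (F Q) = dist P Q" if "P \<in> H" "Q \<in> H" for P Q
    using low[OF that] upper[OF that] by simp
  then show ?thesis unfolding bounds_flat_half_plane_def using FM F0
    by (intro exI[of _ F]) (auto simp: H_def)
qed

end

section \<open>Contracting lines\<close>

text \<open>The predicates \<open>beyond\<close> and \<open>before\<close> express the position of the projection of \<open>x\<close> to the line without mentioning
projections: the distance to \<open>\<sigma> t\<close> is convex in \<open>t\<close>, so \<open>beyond Y \<sigma> t x\<close> implies that it attains its minimum on
\<open>{t - 1..}\<close>, and \<open>before Y \<sigma> t x\<close> that it attains its minimum on \<open>{..t + 1}\<close>. The unit step makes either predicate hold when the
other one fails, up to a shift.\<close>

definition beyond :: "'a metric \<Rightarrow> (real \<Rightarrow> 'a) \<Rightarrow> real \<Rightarrow> 'a \<Rightarrow> bool" where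
  "beyond Y \<sigma> t x \<longleftrightarrow> mdist Y x (\<sigma> t) \<le> mdist Y x (\<sigma> (t - 1))"

definition before :: "'a metric \<Rightarrow> (real \<Rightarrow> 'a) \<Rightarrow> real \<Rightarrow> 'a \<Rightarrow> bool" where
  "before Y \<sigma> t x \<longleftrightarrow> mdist Y x (\<sigma> t) \<le> mdist Y x (\<sigma> (t + 1))"

lemma beyond_reverse: "beyond Y (\<lambda>s. \<sigma> (- s)) t x \<longleftrightarrow> before Y \<sigma> (- t) x"
  by (simp add: beyond_def before_def)

lemma before_reverse: "before Y (\<lambda>s. \<sigma> (- s)) t x \<longleftrightarrow> beyond Y \<sigma> (- t) x"
  by (simp add: beyond_def before_def)

lemma not_beyond: "\<not> beyond Y \<sigma> t x \<Longrightarrow> before Y \<sigma> (t - 1) x"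
  by (simp add: beyond_def before_def)

definition passes_near :: "'a metric \<Rightarrow> 'a \<Rightarrow> 'a \<Rightarrow> 'a \<Rightarrow> real \<Rightarrow> bool" where
  "passes_near Y x y q R \<longleftrightarrow>
     (\<forall>c. geodesic Y x y c \<longrightarrow> (\<exists>s\<in>{0..mdist Y x y}. mdist Y (c s) q \<le> R))"

lemma passes_near_mono: "passes_near Y x y q R \<Longrightarrow> R \<le> R' \<Longrightarrow> passes_near Y x y q R'"
  unfolding passes_near_def by (meson order_trans)

text \<open>This is the coarse contraction property of a line: a geodesic between points that project to
different sides of \<open>\<sigma> q\<close>, both at distance at least about \<open>C\<close> from it, passes near \<open>\<sigma> q\<close>.\<close>

definition contracting :: "'a metric \<Rightarrow> (real \<Rightarrow> 'a) \<Rightarrow> real \<Rightarrow> bool" where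
  "contracting Y \<sigma> C \<longleftrightarrow> geodesic_line Y \<sigma> \<and> 0 \<le> C \<and>
     (\<forall>x\<in>mspace Y. \<forall>y\<in>mspace Y. \<forall>a b q.
        before Y \<sigma> a x \<and> beyond Y \<sigma> b y \<and> a + C \<le> q \<and> q \<le> b - C \<longrightarrow>
        passes_near Y x y (\<sigma> q) C)"

lemma contractingD:
  assumes "contracting Y \<sigma> C" "x \<in> mspace Y" "y \<in> mspace Y" "before Y \<sigma> a x" "beyond Y \<sigma> b y"
    "a + C \<le> q" "q \<le> b - C" "geodesic Y x y c"
  obtains s where "0 \<le> s" "s \<le> mdist Y x y" "mdist Y (c s) (\<sigma> q) \<le> C"
  using assms unfolding contracting_def passes_near_def by (meson atLeastAtMost_iff)

lemma contracting_reverse: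
  assumes "contracting Y \<sigma> C"
  shows "contracting Y (\<lambda>s. \<sigma> (- s)) C"
  unfolding contracting_def passes_near_def
proof (intro conjI ballI allI impI; (elim conjE)?)
  fix x y a b q c
  assume xy: "x \<in> mspace Y" "y \<in> mspace Y"
    and ab: "before Y (\<lambda>s. \<sigma> (- s)) a x" "beyond Y (\<lambda>s. \<sigma> (- s)) b y"
    and q: "a + C \<le> q" "q \<le> b - C" and c: "geodesic Y x y c"
  obtain s where "0 \<le> s" "s \<le> mdist Y y x" "mdist Y (c (mdist Y x y - s)) (\<sigma> (- q)) \<le> C"
    using contractingD[OF assms xy(2) xy(1) ab(2)[unfolded beyond_reverse]
        ab(1)[unfolded before_reverse] _ _ geodesic_reverse[OF c], of "- q"] q by auto
  then show "\<exists>s\<in>{0..mdist Y x y}. mdist Y (c s) (\<sigma> (- q)) \<le> C"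
    by (intro bexI[of _ "mdist Y x y - s"]) (auto simp: mdist_commute)
qed (use assms in \<open>auto simp: contracting_def geodesic_line_reverse\<close>)

text \<open>Of an axis only its effect on distances matters; in this form the property is visibly invariant under
reversal of the line, and \<open>x\<close> can be moved along the line by any multiple of the period.\<close>

definition periodic_line :: "'a metric \<Rightarrow> (real \<Rightarrow> 'a) \<Rightarrow> real \<Rightarrow> bool" where
  "periodic_line Y \<sigma> l \<longleftrightarrow> geodesic_line Y \<sigma> \<and> 0 < l \<and>
     (\<forall>x\<in>mspace Y. \<forall>k::int. \<exists>x'\<in>mspace Y. \<forall>t. mdist Y x' (\<sigma> (t + of_int k * l)) = mdist Y x (\<sigma> t))"

lemma periodic_line_reverse:
  assumes "periodic_line Y \<sigma> l"
  shows "periodic_line Y (\<lambda>s. \<sigma> (- s)) l"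
  unfolding periodic_line_def
proof (intro conjI ballI allI)
  fix x and k :: int
  assume "x \<in> mspace Y"
  then obtain x' where "x' \<in> mspace Y"
    "\<And>t. mdist Y x' (\<sigma> (t + of_int (- k) * l)) = mdist Y x (\<sigma> t)"
    using assms unfolding periodic_line_def by blast
  from this(1) this(2)[of "- t" for t]
  show "\<exists>x'\<in>mspace Y. \<forall>t. mdist Y x' (\<sigma> (- (t + of_int k * l))) = mdist Y x (\<sigma> (- t))"
    by (intro bexI[of _ x']) auto
qed (use assms in \<open>auto simp: periodic_line_def geodesic_line_reverse\<close>)

lemma bounds_flat_half_plane_reverse:
  fixes Y :: "'a metric"
  assumes "bounds_flat_half_plane Y (\<lambda>s. \<sigma> (- s))"
  shows "bounds_flat_half_plane Y \<sigma>"
proof -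
  obtain F :: "real \<times> real \<Rightarrow> 'a" where F: "\<forall>p\<in>UNIV \<times> {0..}. F p \<in> mspace Y"
    "\<forall>p\<in>UNIV \<times> {0..}. \<forall>q\<in>UNIV \<times> {0..}. mdist Y (F p) (F q) = dist p q"
    "\<forall>s. F (s, 0) = \<sigma> (- s)"
    using assms unfolding bounds_flat_half_plane_def by blast
  have "dist (- a, b) (- c, e) = dist (a, b) (c, e)" for a b c e :: real
    by (simp add: dist_Pair_Pair dist_real_def abs_minus_commute)
  then show ?thesis unfolding bounds_flat_half_plane_def
    using F by (intro exI[of _ "\<lambda>p. F (- fst p, snd p)"]) auto
qed

text \<open>The intervals \<open>{s..s + h}\<close> and \<open>{t..t + h}\<close> may overlap: \<open>s + h\<close> and \<open>t\<close> are convex combinations of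
\<open>s\<close> and \<open>t + h\<close> with exchanged coefficients.\<close>

lemma convex_slope_mono:
  fixes \<phi> :: "real \<Rightarrow> real"
  assumes \<phi>: "convex_on UNIV \<phi>" and "s \<le> t" "0 < h"
  shows "\<phi> (s + h) - \<phi> s \<le> \<phi> (t + h) - \<phi> t"
proof -
  define L where "L = t + h - s"
  have L: "L > 0" using assms by (simp add: L_def)
  have *: "\<phi> ((1 - u) * s + u * (t + h)) \<le> (1 - u) * \<phi> s + u * \<phi> (t + h)" if "0 \<le> u" "u \<le> 1" for u
    using convex_onD[OF \<phi>, of u s "t + h"] that by simp
  have e1: "(1 - (t - s) / L) * s + (t - s) / L * (t + h) = t"
  proof -
    have "(1 - (t - s) / L) * s + (t - s) / L * (t + h) = s + (t - s) * (L / L)"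
      by (simp add: L_def field_simps)
    then show ?thesis using L by simp
  qed
  have e2: "(1 - h / L) * s + h / L * (t + h) = s + h"
  proof -
    have "(1 - h / L) * s + h / L * (t + h) = s + h * (L / L)"
      by (simp add: L_def field_simps)
    then show ?thesis using L by simp
  qed
  have "\<phi> t \<le> (1 - (t - s) / L) * \<phi> s + (t - s) / L * \<phi> (t + h)"
    using *[of "(t - s) / L"] assms L unfolding e1 by (simp add: L_def)
  moreover have "\<phi> (s + h) \<le> (1 - h / L) * \<phi> s + h / L * \<phi> (t + h)"
    using *[of "h / L"] assms L unfolding e2 by (simp add: L_def)
  moreover have "(t - s) / L = 1 - h / L" using L by (simp add: L_def field_simps)
  ultimately show ?thesis by (simp add: algebra_simps)
qed

lemma convex_secant_upper:
  fixes \<phi> :: "real \<Rightarrow> real"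
  assumes \<phi>: "convex_on UNIV \<phi>" and "0 \<le> t"
  shows "\<phi> (s + t) - \<phi> s \<le> t * (\<phi> (s + t + 1) - \<phi> (s + t))"
proof -
  define u where "u = t / (t + 1)"
  have u: "0 \<le> u" "u \<le> 1" using assms by (auto simp: u_def)
  have "(1 - u) * s + u * (s + t + 1) = s + u * (t + 1)" by (simp add: algebra_simps)
  also have "u * (t + 1) = t" using assms by (simp add: u_def)
  finally have "\<phi> (s + t) \<le> (1 - u) * \<phi> s + u * \<phi> (s + t + 1)"
    using convex_onD[OF \<phi>, of u s "s + t + 1"] u by simp
  then have "(t + 1) * \<phi> (s + t) \<le> (t + 1) * ((1 - u) * \<phi> s + u * \<phi> (s + t + 1))"
    using assms by (intro mult_left_mono) auto
  also have "\<dots> = (t + 1) * \<phi> s - ((t + 1) * u) * \<phi> s + ((t + 1) * u) * \<phi> (s + t + 1)"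
    by (simp add: algebra_simps)
  also have "(t + 1) * u = t" using assms by (simp add: u_def)
  also have "(t + 1) * \<phi> s - t * \<phi> s + t * \<phi> (s + t + 1) = \<phi> s + t * \<phi> (s + t + 1)"
    by (simp add: algebra_simps)
  finally show ?thesis by (simp add: algebra_simps)
qed

lemma convex_reflect:
  fixes \<phi> :: "real \<Rightarrow> real"
  assumes \<phi>: "convex_on UNIV \<phi>"
  shows "convex_on UNIV (\<lambda>t. \<phi> (- t))"
proof (intro convex_onI)
  fix u a b :: real assume "0 < u" "u < 1"
  then show "\<phi> (- ((1 - u) *\<^sub>R a + u *\<^sub>R b)) \<le> (1 - u) * \<phi> (- a) + u * \<phi> (- b)"
    using convex_onD[OF \<phi>, of u "- a" "- b"] by (simp add: algebra_simps)
qed simp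

lemma convex_secant_lower:
  fixes \<phi> :: "real \<Rightarrow> real"
  assumes \<phi>: "convex_on UNIV \<phi>" and "0 \<le> t"
  shows "t * (\<phi> s - \<phi> (s - 1)) \<le> \<phi> (s + t) - \<phi> s"
proof -
  have "\<phi> s - \<phi> (s + t) \<le> t * (\<phi> (s - 1) - \<phi> s)"
    using convex_secant_upper[OF convex_reflect[OF \<phi>], of t "- (s + t)"] assms by (simp add: add.commute)
  then show ?thesis by (simp add: algebra_simps)
qed

context hadamard
begin

lemma abs_dist_diff_le:
  "x \<in> M \<Longrightarrow> y \<in> M \<Longrightarrow> w \<in> M \<Longrightarrow> \<bar>d x w - d y w\<bar> \<le> d x y"
  using triangle[of x y w] triangle[of y x w] by (simp add: commute abs_le_iff)

lemma dist_line_slope_mono: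
  assumes "geodesic_line Y \<sigma>" "x \<in> M" "s \<le> t"
  shows "d x (\<sigma> (s + 1)) - d x (\<sigma> s) \<le> d x (\<sigma> (t + 1)) - d x (\<sigma> t)"
  using convex_slope_mono[OF dist_line_convex[OF assms(1,2)] assms(3)] by simp

lemma before_antimono:
  assumes "geodesic_line Y \<sigma>" "x \<in> M" "s \<le> t" "before Y \<sigma> s x"
  shows "before Y \<sigma> t x"
  using dist_line_slope_mono[OF assms(1-3)] assms(4) by (simp add: before_def)

lemma beyond_mono:
  assumes "geodesic_line Y \<sigma>" "x \<in> M" "s \<le> t" "beyond Y \<sigma> t x"
  shows "beyond Y \<sigma> s x"
  using dist_line_slope_mono[OF assms(1,2), of "s - 1" "t - 1"] assms(3,4) by (simp add: beyond_def)

text \<open>Otherwise the distance to the line would never increase, although it tends to infinity.\<close>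

lemma before_exists:
  assumes \<sigma>: "geodesic_line Y \<sigma>" and x: "x \<in> M"
  obtains a where "before Y \<sigma> a x"
proof (rule ccontr)
  assume "\<not> thesis"
  then have *: "\<not> before Y \<sigma> a x" for a using that by blast
  let ?t = "2 * d x (\<sigma> 0) + 2"
  have t0: "?t \<ge> 0" using nonneg[of x "\<sigma> 0"] by linarith
  have "d x (\<sigma> (0 + ?t)) - d x (\<sigma> 0) \<le> ?t * (d x (\<sigma> (0 + ?t + 1)) - d x (\<sigma> (0 + ?t)))"
    by (rule convex_secant_upper[OF dist_line_convex[OF \<sigma> x] t0])
  also have "\<dots> \<le> 0" using *[of ?t] t0 by (intro mult_nonneg_nonpos) (auto simp: before_def)
  finally have "d x (\<sigma> ?t) \<le> d x (\<sigma> 0)" by simp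
  moreover have "?t \<le> d x (\<sigma> 0) + d x (\<sigma> ?t)"
    using triangle[of "\<sigma> 0" x "\<sigma> ?t"] geodesic_lineD[OF \<sigma>] x t0 by (simp add: commute)
  ultimately show False by simp
qed

end

context proper_hadamard
begin

text \<open>Viewed from a point of the axis that lies far ahead of the projection of \<open>x\<close>, the point \<open>x\<close> is almost straight behind.
Here the absence of a flat half plane is used. Let \<open>S T\<close> be the infimum of the slopes of distance
functions at distance at least \<open>T\<close> ahead of the projection, and let \<open>\<kappa>\<close> be its supremum over \<open>T\<close>. If
\<open>\<kappa> < 1\<close>, there are points \<open>x n\<close> whose distance functions have slopes between \<open>S n\<close> and \<open>\<kappa> + 1 / (n + 1)\<close> on an interval of length
\<open>2 * n\<close>: by convexity a slope close to \<open>\<kappa>\<close> at its right end suffices. Translation along the axis centres these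
intervals near \<open>0\<close>, and \<open>flat_half_plane_limit\<close> applies.\<close>

lemma slope_near_one:
  assumes per: "periodic_line Y \<sigma> l" and flat: "\<not> bounds_flat_half_plane Y \<sigma>" and \<epsilon>: "0 < \<epsilon>"
  shows "\<exists>T\<ge>0. \<forall>x\<in>M. \<forall>a t. before Y \<sigma> a x \<and> a + T \<le> t \<longrightarrow> 1 - \<epsilon> \<le> d x (\<sigma> (t + 1)) - d x (\<sigma> t)"
proof (rule ccontr)
  assume neg: "\<not> ?thesis"
  have \<sigma>: "geodesic_line Y \<sigma>" and l: "l > 0" using per by (auto simp: periodic_line_def)
  define slope where "slope = (\<lambda>x t. d x (\<sigma> (t + 1)) - d x (\<sigma> t))"
  define A where "A = (\<lambda>T. {slope x t | x a t. x \<in> M \<and> before Y \<sigma> a x \<and> a + T \<le> t})"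
  define S where "S = (\<lambda>T. Inf (A T))"
  have slope0: "0 \<le> slope x t" if "x \<in> M" "before Y \<sigma> a x" "a \<le> t" for x a t
    using before_antimono[OF \<sigma> that(1) that(3,2)] by (simp add: before_def slope_def)
  have Apos: "0 \<le> y" if yA: "y \<in> A T" and T: "T \<ge> 0" for y T
  proof -
    obtain x a t where "y = slope x t" "x \<in> M" "before Y \<sigma> a x" "a + T \<le> t"
      using yA by (auto simp: A_def)
    then show ?thesis using slope0[of x a t] T by simp
  qed
  have bdd: "bdd_below (A T)" if "T \<ge> 0" for T by (rule bdd_belowI[of _ 0]) (use Apos that in auto)
  have Amono: "A T' \<subseteq> A T" if "T \<le> T'" for T T'
  proof
    fix y assume "y \<in> A T'"
    then obtain x a t where "y = slope x t" "x \<in> M" "before Y \<sigma> a x" "a + T' \<le> t"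
      by (auto simp: A_def)
    moreover have "a + T \<le> t" using that calculation(4) by linarith
    ultimately show "y \<in> A T" by (auto simp: A_def)
  qed
  have Ane: "A T \<noteq> {}" for T
  proof -
    have "before Y \<sigma> 0 (\<sigma> 0)" by (simp add: before_def geodesic_lineD[OF \<sigma>])
    then have "slope (\<sigma> 0) (0 + T) \<in> A T" using geodesic_lineD(1)[OF \<sigma>] by (fastforce simp: A_def)
    then show ?thesis by blast
  qed
  have Sle: "S T \<le> y" if "y \<in> A T" "T \<ge> 0" for y T
    unfolding S_def using that bdd by (intro cInf_lower) auto
  have Smono: "S T \<le> S T'" if "0 \<le> T" "T \<le> T'" for T T'
    unfolding S_def using that Ane bdd Amono by (intro cInf_superset_mono) auto
  have S0: "0 \<le> S T" if "T \<ge> 0" for T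
    unfolding S_def using Ane Apos that by (intro cInf_greatest) auto
  have S1: "S T \<le> 1 - \<epsilon>" if T: "T \<ge> 0" for T
  proof -
    obtain x a t where "x \<in> M" "before Y \<sigma> a x" "a + T \<le> t" "slope x t < 1 - \<epsilon>"
      using neg T unfolding slope_def by (meson not_le)
    then have "slope x t \<in> A T" "slope x t < 1 - \<epsilon>" by (auto simp: A_def)
    then show ?thesis using Sle T by force
  qed
  define \<kappa> where "\<kappa> = (SUP n. S (real n))"
  have bddS: "bdd_above (range (\<lambda>n. S (real n)))" using S1 by (intro bdd_aboveI[of _ "1 - \<epsilon>"]) auto
  have Slim: "(\<lambda>n. S (real n)) \<longlonglongrightarrow> \<kappa>"
    unfolding \<kappa>_def by (rule LIMSEQ_incseq_SUP[OF bddS]) (auto simp: incseq_def intro!: Smono)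
  have S\<kappa>: "S (real n) \<le> \<kappa>" for n unfolding \<kappa>_def using bddS by (intro cSUP_upper) auto
  have \<kappa>: "0 \<le> \<kappa>" "\<kappa> \<le> 1 - \<epsilon>"
    using S\<kappa>[of 0] S0[of 0] LIMSEQ_le_const2[OF Slim, of "1 - \<epsilon>"] S1 by auto
  have "\<exists>x\<in>M. \<forall>\<tau>. \<bar>\<tau>\<bar> \<le> real n - l \<longrightarrow> S (real n) \<le> slope x \<tau> \<and> slope x \<tau> \<le> \<kappa> + 1 / real (n + 1)" for n
  proof -
    have "Inf (A (real (3 * n))) < \<kappa> + 1 / real (n + 1)"
      using S\<kappa>[of "3 * n"] unfolding S_def by (smt (verit) of_nat_0_less_iff zero_less_divide_1_iff zero_less_Suc Suc_eq_plus1)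
    then obtain y where "y \<in> A (real (3 * n))" "y < \<kappa> + 1 / real (n + 1)"
      using Ane by (meson cInf_lessD)
    then obtain x a t where x: "x \<in> M" "before Y \<sigma> a x" "a + 3 * real n \<le> t"
      and st: "slope x t < \<kappa> + 1 / real (n + 1)" by (auto simp: A_def)
    have in_range: "S (real n) \<le> slope x \<tau> \<and> slope x \<tau> \<le> \<kappa> + 1 / real (n + 1)"
      if "t - 2 * real n \<le> \<tau>" "\<tau> \<le> t" for \<tau>
    proof
      have "slope x \<tau> \<in> A (real n)" using x that unfolding A_def by fastforce
      then show "S (real n) \<le> slope x \<tau>" using Sle by simp
      show "slope x \<tau> \<le> \<kappa> + 1 / real (n + 1)"
        using dist_line_slope_mono[OF \<sigma> x(1) that(2)] st by (simp add: slope_def)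
    qed
    define s where "s = t - real n"
    define k where "k = - \<lfloor>s / l\<rfloor>"
    have "of_int \<lfloor>s / l\<rfloor> * l \<le> s" "s < (of_int \<lfloor>s / l\<rfloor> + 1) * l"
      using l floor_divide_lower floor_divide_upper by auto
    then have k: "0 \<le> s + of_int k * l" "s + of_int k * l \<le> l" by (auto simp: k_def algebra_simps)
    obtain x' where x': "x' \<in> M" "\<And>t. d x' (\<sigma> (t + of_int k * l)) = d x (\<sigma> t)"
      using per x(1) unfolding periodic_line_def by blast
    have "slope x' \<tau> = slope x (\<tau> - of_int k * l)" for \<tau>
      using x'(2)[of "\<tau> - of_int k * l"] x'(2)[of "\<tau> - of_int k * l + 1"]
      by (simp add: slope_def add.commute add.left_commute)
    moreover have "t - 2 * real n \<le> \<tau> - of_int k * l" "\<tau> - of_int k * l \<le> t"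
      if "\<bar>\<tau>\<bar> \<le> real n - l" for \<tau>
      using that k by (auto simp: s_def)
    ultimately show ?thesis using in_range x'(1) by (intro bexI[of _ x']) auto
  qed
  then obtain x where x: "\<And>n. x n \<in> M"
    and xs: "\<And>n \<tau>. \<bar>\<tau>\<bar> \<le> real n - l \<Longrightarrow> S (real n) \<le> slope (x n) \<tau> \<and> slope (x n) \<tau> \<le> \<kappa> + 1 / real (n + 1)"
    by metis
  have inv: "(\<lambda>n. \<kappa> + 1 / real (n + 1)) \<longlonglongrightarrow> \<kappa>"
    using LIMSEQ_inverse_real_of_nat_add[of \<kappa>] by (simp add: inverse_eq_divide)
  have slim: "(\<lambda>n. slope (x n) \<tau>) \<longlonglongrightarrow> \<kappa>" for \<tau>
  proof (rule real_tendsto_sandwich[OF _ _ Slim inv])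
    have "\<forall>\<^sub>F n in sequentially. \<bar>\<tau>\<bar> + l \<le> real n"
      using filterlim_real_sequentially by (simp add: filterlim_at_top)
    then have ev: "\<forall>\<^sub>F n in sequentially. \<bar>\<tau>\<bar> \<le> real n - l" by eventually_elim simp
    show "\<forall>\<^sub>F n in sequentially. S (real n) \<le> slope (x n) \<tau>"
      using ev by eventually_elim (use xs in blast)
    show "\<forall>\<^sub>F n in sequentially. slope (x n) \<tau> \<le> \<kappa> + 1 / real (n + 1)"
      using ev by eventually_elim (use xs in blast)
  qed
  have "(\<lambda>n. d (x n) (\<sigma> t) - d (x n) (\<sigma> 0)) \<longlonglongrightarrow> \<kappa> * t" for t
  proof (cases "t \<ge> 0")
    case True
    have 1: "t * slope (x n) (- 1) \<le> d (x n) (\<sigma> t) - d (x n) (\<sigma> 0)" for n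
      using convex_secant_lower[OF dist_line_convex[OF \<sigma> x] True, of n 0] by (simp add: slope_def)
    have 2: "d (x n) (\<sigma> t) - d (x n) (\<sigma> 0) \<le> t * slope (x n) t" for n
      using convex_secant_upper[OF dist_line_convex[OF \<sigma> x] True, of n 0] by (simp add: slope_def)
    show ?thesis
      by (rule real_tendsto_sandwich[where f = "\<lambda>n. t * slope (x n) (- 1)" and h = "\<lambda>n. t * slope (x n) t"])
        (use 1 2 tendsto_mult_left[OF slim, of t] in \<open>auto simp: mult.commute\<close>)
  next
    case False
    then have t: "- t \<ge> 0" by simp
    have 1: "- t * slope (x n) (t - 1) \<le> d (x n) (\<sigma> 0) - d (x n) (\<sigma> t)" for n
      using convex_secant_lower[OF dist_line_convex[OF \<sigma> x] t, of n t] by (simp add: slope_def)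
    have 2: "d (x n) (\<sigma> 0) - d (x n) (\<sigma> t) \<le> - t * slope (x n) 0" for n
      using convex_secant_upper[OF dist_line_convex[OF \<sigma> x] t, of n t] by (simp add: slope_def)
    have lo: "t * slope (x n) 0 \<le> d (x n) (\<sigma> t) - d (x n) (\<sigma> 0)" for n using 2[of n] by simp
    have up: "d (x n) (\<sigma> t) - d (x n) (\<sigma> 0) \<le> t * slope (x n) (t - 1)" for n using 1[of n] by simp
    show ?thesis
      by (rule real_tendsto_sandwich[where f = "\<lambda>n. t * slope (x n) 0" and h = "\<lambda>n. t * slope (x n) (t - 1)"])
        (use lo up tendsto_mult_left[OF slim, of t] in \<open>auto simp: mult.commute\<close>)
  qed
  then have "bounds_flat_half_plane Y \<sigma>"
    using \<kappa> \<epsilon> by (intro flat_half_plane_limit[OF \<sigma> x, of \<kappa>]) auto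
  then show False using flat by simp
qed

end

context hadamard
begin

text \<open>If \<open>\<alpha>\<close> is the comparison angle at \<open>a\<close>, this is \<open>2 - 2 * cos \<alpha>\<close>, the squared chord of \<open>\<alpha>\<close> on the unit
circle. Chords can be handled by the triangle inequality, and trigonometry is avoided.\<close>

definition chord_sq :: "'a \<Rightarrow> 'a \<Rightarrow> 'a \<Rightarrow> real" where
  "chord_sq a x y = ((d x y)\<^sup>2 - (d a x - d a y)\<^sup>2) / (d a x * d a y)"

lemma dist_le_chord:
  assumes "geodesic Y a x c1" "geodesic Y a y c2" "a \<in> M" "x \<in> M" "y \<in> M" "a \<noteq> x" "a \<noteq> y"
    and "0 \<le> s" "s \<le> d a x" "s \<le> d a y"
  shows "(d (c1 s) (c2 s))\<^sup>2 \<le> s\<^sup>2 * chord_sq a x y"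
  using cat0_two_sides[OF assms(1,2), of s s] assms by (simp add: chord_sq_def power2_eq_square)

text \<open>The sum of two angles of a Euclidean triangle is at most \<open>\<pi>\<close>, that is, the sum of their cosines is nonnegative.\<close>

lemma chord_sq_sum_le:
  assumes "v \<in> M" "x \<in> M" "z \<in> M" "v \<noteq> x" "v \<noteq> z" "x \<noteq> z"
  shows "chord_sq v x z + chord_sq z x v \<le> 4"
proof -
  define D where "D = d v x"
  define L where "L = d v z"
  define N where "N = d x z"
  have pos: "D > 0" "L > 0" "N > 0" using assms by (auto simp: D_def L_def N_def)
  have "\<bar>N - D\<bar> \<le> L"
    using triangle[of x v z] triangle[of v z x] assms by (auto simp: D_def L_def N_def commute)
  then have "(N - D)\<^sup>2 \<le> L\<^sup>2" using pos by (simp add: abs_le_square_iff[symmetric])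
  then have key: "0 \<le> (N + D) * (L\<^sup>2 - (N - D)\<^sup>2)" using pos by simp
  have "4 - (chord_sq v x z + chord_sq z x v)
    = 4 - ((N\<^sup>2 - (D - L)\<^sup>2) / (D * L) + (D\<^sup>2 - (N - L)\<^sup>2) / (N * L))"
    by (simp add: chord_sq_def D_def L_def N_def commute)
  also have "\<dots> = (4 * N * D * L - N * (N\<^sup>2 - (D - L)\<^sup>2) - D * (D\<^sup>2 - (N - L)\<^sup>2)) / (N * D * L)"
    using pos by (simp add: field_simps)
  also have "4 * N * D * L - N * (N\<^sup>2 - (D - L)\<^sup>2) - D * (D\<^sup>2 - (N - L)\<^sup>2) = (N + D) * (L\<^sup>2 - (N - D)\<^sup>2)"
    by (simp add: power2_eq_square algebra_simps)
  finally show ?thesis using key pos by (smt (verit) divide_nonneg_pos mult_pos_pos)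
qed

text \<open>If the distance to \<open>x\<close> decreases almost at unit speed from \<open>\<sigma> v\<close> in the direction \<open>\<epsilon>\<close>, then the geodesic to \<open>x\<close>
starts almost in that direction. It is evaluated at time \<open>1/2\<close> because \<open>x\<close> may be slightly closer to \<open>\<sigma> v\<close> than 1.\<close>

lemma chord_line_small:
  assumes \<sigma>: "geodesic_line Y \<sigma>" and x: "x \<in> M" and e: "geodesic Y (\<sigma> v) x e"
    and slope: "1 - 1/2048 \<le> d x (\<sigma> v) - d x (\<sigma> (v + \<epsilon>))" and \<epsilon>: "\<epsilon> = 1 \<or> \<epsilon> = -1"
  shows "d (e (1/2)) (\<sigma> (v + \<epsilon> / 2)) \<le> 1 / 64"
proof -
  define D where "D = d (\<sigma> v) x"
  define D' where "D' = d x (\<sigma> (v + \<epsilon>))"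
  have \<sigma>M: "\<sigma> t \<in> M" for t using \<sigma> by (simp add: geodesic_lineD)
  have D': "0 \<le> D'" "D' \<le> D - 1 + 1/2048" using slope by (auto simp: D_def D'_def commute)
  then have D: "D \<ge> 1 - 1/2048" by simp
  have e2: "geodesic Y (\<sigma> v) (\<sigma> (v + \<epsilon>)) (\<lambda>s. \<sigma> (v + \<epsilon> * s))"
    using \<epsilon> by (auto simp: geodesic_def geodesic_lineD[OF \<sigma>])
  have d1: "d (\<sigma> v) (\<sigma> (v + \<epsilon>)) = 1" using \<epsilon> by (auto simp: geodesic_lineD[OF \<sigma>])
  have ne: "\<sigma> v \<noteq> \<sigma> (v + \<epsilon>)" "\<sigma> v \<noteq> x"
    using d1 D \<sigma>M[of v] by (auto simp: D_def)
  have "(d (e (1/2)) (\<sigma> (v + \<epsilon> * (1/2))))\<^sup>2 \<le> (1/2)\<^sup>2 * chord_sq (\<sigma> v) x (\<sigma> (v + \<epsilon>))"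
    by (rule dist_le_chord[OF e e2]) (use \<sigma>M x ne d1 D in \<open>auto simp: D_def\<close>)
  also have "chord_sq (\<sigma> v) x (\<sigma> (v + \<epsilon>)) = (D'\<^sup>2 - (D - 1)\<^sup>2) / D"
    by (simp add: chord_sq_def d1 D_def D'_def)
  also have "\<dots> \<le> 1 / 1024"
  proof -
    have "D'\<^sup>2 \<le> (D - 1 + 1/2048)\<^sup>2" using D' by (intro power_mono)
    then have "D'\<^sup>2 - (D - 1)\<^sup>2 \<le> D / 1024" by (simp add: power2_eq_square algebra_simps)
    then show ?thesis using D by (simp add: pos_divide_le_eq)
  qed
  finally have "(d (e (1/2)) (\<sigma> (v + \<epsilon> / 2)))\<^sup>2 \<le> (1/64)\<^sup>2" by (simp add: power2_eq_square)
  then show ?thesis by (rule power2_le_imp_le) simp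
qed

text \<open>If \<open>x\<close> and \<open>z\<close> are seen from \<open>\<sigma> v\<close> in almost opposite directions, then the comparison angle at \<open>\<sigma> v\<close> is almost \<open>\<pi>\<close>, and
hence the one at \<open>z\<close> is small. The constant \<open>1/4\<close> is what \<open>rank_one_contracting\<close> needs: the
slope defect \<open>1/2048\<close> gives chords of squared length at most \<open>1/1024\<close> at \<open>\<sigma> v\<close>, hence a chord of length at
least \<open>31/16\<close> between the directions to \<open>x\<close> and \<open>z\<close>, and \<open>4 - (31/16)\<^sup>2 \<le> 1/4\<close>.\<close>

lemma chord_opposite_small:
  assumes \<sigma>: "geodesic_line Y \<sigma>" and x: "x \<in> M" and z: "z \<in> M" and "x \<noteq> z"
    and sx: "1 - 1/2048 \<le> d x (\<sigma> v) - d x (\<sigma> (v - 1))"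
    and sz: "1 - 1/2048 \<le> d z (\<sigma> v) - d z (\<sigma> (v + 1))"
  shows "chord_sq z x (\<sigma> v) \<le> 1/4"
proof -
  have \<sigma>M: "\<sigma> t \<in> M" for t using \<sigma> by (simp add: geodesic_lineD)
  have D: "d (\<sigma> v) x \<ge> 1/2" "d (\<sigma> v) z \<ge> 1/2"
    using sx sz nonneg[of x "\<sigma> (v - 1)"] nonneg[of z "\<sigma> (v + 1)"]
    unfolding commute[of "\<sigma> v"] by linarith+
  have ne: "\<sigma> v \<noteq> x" "\<sigma> v \<noteq> z" using D \<sigma>M[of v] by auto
  obtain e1 e2 where e: "geodesic Y (\<sigma> v) x e1" "geodesic Y (\<sigma> v) z e2"
    using geodesic_exists \<sigma>M x z by meson
  have eM: "e1 (1/2) \<in> M" "e2 (1/2) \<in> M" using e D by (auto intro!: geodesicD(3))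
  have 1: "d (e1 (1/2)) (\<sigma> (v - 1/2)) \<le> 1/64"
    using chord_line_small[OF \<sigma> x e(1), of "-1"] sx by simp
  have 2: "d (e2 (1/2)) (\<sigma> (v + 1/2)) \<le> 1/64"
    using chord_line_small[OF \<sigma> z e(2), of 1] sz by simp
  have "d (\<sigma> (v - 1/2)) (\<sigma> (v + 1/2)) = 1" by (simp add: geodesic_lineD[OF \<sigma>])
  then have "31/32 \<le> d (e1 (1/2)) (e2 (1/2))"
    using 1 2 triangle[of "\<sigma> (v - 1/2)" "e1 (1/2)" "\<sigma> (v + 1/2)"]
      triangle[of "e1 (1/2)" "e2 (1/2)" "\<sigma> (v + 1/2)"] \<sigma>M eM
    by (simp add: commute[of "\<sigma> (v - 1/2)"])
  then have "(31/32)\<^sup>2 \<le> (d (e1 (1/2)) (e2 (1/2)))\<^sup>2" by (intro power_mono) auto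
  also have "\<dots> \<le> (1/2)\<^sup>2 * chord_sq (\<sigma> v) x z"
    by (rule dist_le_chord[OF e]) (use \<sigma>M x z ne D in auto)
  finally have "961/256 \<le> chord_sq (\<sigma> v) x z" by (simp add: power2_eq_square)
  then show ?thesis using chord_sq_sum_le[OF \<sigma>M x z ne \<open>x \<noteq> z\<close>] by simp
qed

lemma geodesic_from_middle:
  assumes c: "geodesic Y x y c" and s0: "0 \<le> s0" "s0 \<le> d x y"
  shows "geodesic Y (c s0) y (\<lambda>s. c (s0 + s))" "geodesic Y (c s0) x (\<lambda>s. c (s0 - s))"
proof -
  have 1: "d (c s0) y = d x y - s0" using geodesicD(6)[OF c s0] .
  have 2: "d (c s0) x = s0" using geodesicD(5)[OF c s0] by (simp add: commute)
  show "geodesic Y (c s0) y (\<lambda>s. c (s0 + s))"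
    unfolding geodesic_def 1
    using s0 geodesicD(1,2)[OF c] by (auto intro!: geodesicD(3)[OF c] simp: geodesicD(4)[OF c])
  show "geodesic Y (c s0) x (\<lambda>s. c (s0 - s))"
    unfolding geodesic_def 2
    using s0 geodesicD(1,2)[OF c] by (auto intro!: geodesicD(3)[OF c] simp: geodesicD(4)[OF c])
qed

end

context proper_hadamard
begin

text \<open>Choose by continuity a point \<open>z\<close> of the geodesic from \<open>x\<close> to \<open>y\<close> that projects near \<open>q\<close>, and points \<open>\<sigma> v\<close>, \<open>\<sigma> v'\<close> of the axis
on both sides of \<open>q\<close>. Seen from \<open>\<sigma> v\<close>, the points \<open>x\<close> and \<open>z\<close> lie in almost opposite directions, so at \<open>z\<close> the
directions to \<open>x\<close> and \<open>\<sigma> v\<close> almost agree; likewise those to \<open>y\<close> and \<open>\<sigma> v'\<close>. If \<open>z\<close> were far from the axis,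
the directions from \<open>z\<close> to \<open>\<sigma> v\<close> and \<open>\<sigma> v'\<close> would almost agree too. But the directions from \<open>z\<close> to \<open>x\<close> and
\<open>y\<close> are opposite: the chords satisfy \<open>2 < 1/2 + 1 + 1/2\<close>, a contradiction.\<close>

theorem rank_one_contracting:
  assumes per: "periodic_line Y \<sigma> l" and flat: "\<not> bounds_flat_half_plane Y \<sigma>"
  shows "\<exists>C. contracting Y \<sigma> C"
proof -
  have \<sigma>: "geodesic_line Y \<sigma>" using per by (simp add: periodic_line_def)
  have \<sigma>M: "\<sigma> t \<in> M" for t using \<sigma> by (simp add: geodesic_lineD)
  let ?\<epsilon> = "1/2048 :: real"
  obtain T1 where T1: "T1 \<ge> 0"
    "\<And>x a t. x \<in> M \<Longrightarrow> before Y \<sigma> a x \<Longrightarrow> a + T1 \<le> t \<Longrightarrow> 1 - ?\<epsilon> \<le> d x (\<sigma> (t + 1)) - d x (\<sigma> t)"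
    using slope_near_one[OF per flat, of ?\<epsilon>] by auto
  have flat': "\<not> bounds_flat_half_plane Y (\<lambda>s. \<sigma> (- s))"
    using bounds_flat_half_plane_reverse flat by blast
  obtain T2 where T2: "T2 \<ge> 0"
    "\<And>x a t. x \<in> M \<Longrightarrow> beyond Y \<sigma> (- a) x \<Longrightarrow> a + T2 \<le> t \<Longrightarrow>
      1 - ?\<epsilon> \<le> d x (\<sigma> (- (t + 1))) - d x (\<sigma> (- t))"
    using slope_near_one[OF periodic_line_reverse[OF per] flat', of ?\<epsilon>] unfolding before_reverse by auto
  define T where "T = max T1 T2"
  have T: "T \<ge> 0" using T1 by (simp add: T_def)
  have fwd: "1 - ?\<epsilon> \<le> d x (\<sigma> (t + 1)) - d x (\<sigma> t)"
    if "x \<in> M" "before Y \<sigma> a x" "a + T \<le> t" for x a t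
    using T1(2)[OF that(1,2), of t] that(3) by (simp add: T_def)
  have bwd: "1 - ?\<epsilon> \<le> d x (\<sigma> (t - 1)) - d x (\<sigma> t)"
    if "x \<in> M" "beyond Y \<sigma> b x" "t \<le> b - T" for x b t
    using T2(2)[of x "- b" "- t"] that by (simp add: T_def)
  define C where "C = 6 * T + 10"
  have "\<exists>s\<in>{0..d x y}. d (c s) (\<sigma> q) \<le> C"
    if x: "x \<in> M" and y: "y \<in> M" and ab: "before Y \<sigma> a x" "beyond Y \<sigma> b y"
      and q: "a + C \<le> q" "q \<le> b - C" and c: "geodesic Y x y c" for x y a b q c
  proof -
    define g where "g = (\<lambda>s. d (c s) (\<sigma> (q + 1)) - d (c s) (\<sigma> q))"
    have cont: "continuous_on {0..d x y} g"
    proof (rule continuous_onI)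
      fix s e assume s: "s \<in> {0..d x y}" and e: "(e :: real) > 0"
      show "\<exists>\<delta>>0. \<forall>s'\<in>{0..d x y}. dist s' s < \<delta> \<longrightarrow> dist (g s') (g s) \<le> e"
      proof (intro exI[of _ "e / 2"] conjI ballI impI)
        fix s' assume s': "s' \<in> {0..d x y}" "dist s' s < e / 2"
        have "d (c s') (c s) = \<bar>s' - s\<bar>" "c s' \<in> M" "c s \<in> M"
          using s s' geodesicD[OF c] by auto
        then have "\<bar>d (c s') (\<sigma> t) - d (c s) (\<sigma> t)\<bar> \<le> \<bar>s' - s\<bar>" for t
          using abs_dist_diff_le[of "c s'" "c s" "\<sigma> t"] \<sigma>M by simp
        from this[of q] this[of "q + 1"] show "dist (g s') (g s) \<le> e"
          using s' unfolding g_def dist_real_def by linarith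
      qed (use e in simp)
    qed
    have g0: "g 0 > 0"
      using fwd[OF x ab(1), of q] q T by (simp add: g_def geodesicD(1)[OF c] C_def)
    have g1: "g (d x y) < 0"
      using bwd[OF y ab(2), of "q + 1"] q T by (simp add: g_def geodesicD(2)[OF c] C_def)
    obtain s0 where s0: "0 \<le> s0" "s0 \<le> d x y" "g s0 = 0"
      using IVT2'[of g "d x y" 0 0] cont g0 g1 by auto
    define z where "z = c s0"
    have z: "z \<in> M" using geodesicD(3)[OF c s0(1,2)] by (simp add: z_def)
    have zx: "z \<noteq> x" "z \<noteq> y" using s0 g0 g1 by (auto simp: g_def z_def geodesicD(1,2)[OF c])
    have zq: "before Y \<sigma> q z" "beyond Y \<sigma> (q + 1) z"
      using s0(3) by (auto simp: before_def beyond_def g_def z_def)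
    define v where "v = q - T"
    define v' where "v' = q + 1 + T"
    have chx: "chord_sq z x (\<sigma> v) \<le> 1/4"
      using fwd[OF x ab(1), of "v - 1"] bwd[OF z zq(2), of "v + 1"] q T zx
      by (intro chord_opposite_small[OF \<sigma> x z]) (auto simp: v_def C_def)
    have y_away: "1 - ?\<epsilon> \<le> d y (\<sigma> v') - d y (\<sigma> (v' + 1))"
      using bwd[OF y ab(2), of "v' + 1"] q T by (simp add: v'_def C_def add.commute add.left_commute)
    have z_away: "1 - ?\<epsilon> \<le> d z (\<sigma> v') - d z (\<sigma> (v' - 1))"
      using fwd[OF z zq(1), of "v' - 1"] T by (simp add: v'_def add.commute add.left_commute)
    have neg: "- (- v' - 1) = v' + 1" "- (- v' + 1) = v' - 1" by simp_all
    have chy: "chord_sq z y (\<sigma> v') \<le> 1/4"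
      using chord_opposite_small[OF geodesic_line_reverse[OF \<sigma>] y z zx(2)[symmetric], of "- v'",
          unfolded neg minus_minus] y_away z_away .
    have "d z (\<sigma> v) \<le> 2 * T + 1 \<or> d z (\<sigma> v') \<le> 2 * T + 1"
    proof (rule ccontr)
      assume "\<not> ?thesis"
      then have far: "d z (\<sigma> v) > 2 * T + 1" "d z (\<sigma> v') > 2 * T + 1" by auto
      then have ne: "z \<noteq> \<sigma> v" "z \<noteq> \<sigma> v'" using T z by auto
      define \<tau> where "\<tau> = min (min (d z x) (d z y)) (min (d z (\<sigma> v)) (d z (\<sigma> v')))"
      have \<tau>: "\<tau> > 0" "\<tau> \<le> d z x" "\<tau> \<le> d z y" "\<tau> \<le> d z (\<sigma> v)" "\<tau> \<le> d z (\<sigma> v')"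
        using zx ne z x y \<sigma>M by (auto simp: \<tau>_def)
      obtain e e' where e: "geodesic Y z (\<sigma> v) e" "geodesic Y z (\<sigma> v') e'"
        using geodesic_exists z \<sigma>M by meson
      note to_y = geodesic_from_middle(1)[OF c s0(1,2), folded z_def]
      note to_x = geodesic_from_middle(2)[OF c s0(1,2), folded z_def]
      have in_M: "c (s0 - \<tau>) \<in> M" "c (s0 + \<tau>) \<in> M" "e \<tau> \<in> M" "e' \<tau> \<in> M"
        using geodesicD(3)[OF to_x, of \<tau>] geodesicD(3)[OF to_y, of \<tau>] geodesicD(3)[OF e(1), of \<tau>]
          geodesicD(3)[OF e(2), of \<tau>] \<tau> by auto
      have "(d (c (s0 - \<tau>)) (e \<tau>))\<^sup>2 \<le> \<tau>\<^sup>2 * chord_sq z x (\<sigma> v)"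
        by (rule dist_le_chord[OF to_x e(1)]) (use z x \<sigma>M zx ne \<tau> in auto)
      also have "\<dots> \<le> \<tau>\<^sup>2 * (1/4)" using chx by (intro mult_left_mono) auto
      finally have "(d (c (s0 - \<tau>)) (e \<tau>))\<^sup>2 \<le> (\<tau> / 2)\<^sup>2" by (simp add: power2_eq_square)
      then have 1: "d (c (s0 - \<tau>)) (e \<tau>) \<le> \<tau> / 2" by (rule power2_le_imp_le) (use \<tau> in simp)
      have "(d (c (s0 + \<tau>)) (e' \<tau>))\<^sup>2 \<le> \<tau>\<^sup>2 * chord_sq z y (\<sigma> v')"
        by (rule dist_le_chord[OF to_y e(2)]) (use z y \<sigma>M zx ne \<tau> in auto)
      also have "\<dots> \<le> \<tau>\<^sup>2 * (1/4)" using chy by (intro mult_left_mono) auto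
      finally have "(d (c (s0 + \<tau>)) (e' \<tau>))\<^sup>2 \<le> (\<tau> / 2)\<^sup>2" by (simp add: power2_eq_square)
      then have 2: "d (c (s0 + \<tau>)) (e' \<tau>) \<le> \<tau> / 2" by (rule power2_le_imp_le) (use \<tau> in simp)
      have "chord_sq z (\<sigma> v) (\<sigma> v') < 1"
      proof -
        have "d (\<sigma> v) (\<sigma> v') = 2 * T + 1"
          using T by (simp add: geodesic_lineD[OF \<sigma>] v_def v'_def)
        then have "(d (\<sigma> v) (\<sigma> v'))\<^sup>2 - (d z (\<sigma> v) - d z (\<sigma> v'))\<^sup>2 \<le> (2 * T + 1) * (2 * T + 1)"
          by (simp add: power2_eq_square)
        also have "\<dots> < d z (\<sigma> v) * d z (\<sigma> v')"
          using far T by (intro mult_strict_mono) auto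
        finally show ?thesis using far T by (simp add: chord_sq_def divide_less_eq)
      qed
      then have "\<tau>\<^sup>2 * chord_sq z (\<sigma> v) (\<sigma> v') < \<tau>\<^sup>2" using \<tau> by (simp add: mult_less_cancel_left2)
      moreover have "(d (e \<tau>) (e' \<tau>))\<^sup>2 \<le> \<tau>\<^sup>2 * chord_sq z (\<sigma> v) (\<sigma> v')"
        by (rule dist_le_chord[OF e]) (use z \<sigma>M ne \<tau> in auto)
      ultimately have "(d (e \<tau>) (e' \<tau>))\<^sup>2 < \<tau>\<^sup>2" by simp
      then have 3: "d (e \<tau>) (e' \<tau>) < \<tau>" by (rule power2_less_imp_less) (use \<tau> in simp)
      have dd: "d z x = s0" "d z y = d x y - s0"
        using geodesicD(5,6)[OF c s0(1,2)] by (auto simp: z_def commute)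
      have "d (c (s0 - \<tau>)) (c (s0 + \<tau>)) = \<bar>(s0 - \<tau>) - (s0 + \<tau>)\<bar>"
        by (rule geodesicD(4)[OF c]) (use \<tau> s0 dd in linarith)+
      then have "d (c (s0 - \<tau>)) (c (s0 + \<tau>)) = 2 * \<tau>" using \<tau> by simp
      then show False
        using 1 2 3 triangle[of "c (s0 - \<tau>)" "e \<tau>" "c (s0 + \<tau>)"] triangle[of "e \<tau>" "e' \<tau>" "c (s0 + \<tau>)"] in_M
        by (simp add: commute[of "e' \<tau>"])
    qed
    moreover have "d (\<sigma> v) (\<sigma> q) = T" "d (\<sigma> v') (\<sigma> q) = T + 1"
      using T by (auto simp: geodesic_lineD[OF \<sigma>] v_def v'_def)
    then have "d z (\<sigma> q) \<le> d z (\<sigma> v) + T" "d z (\<sigma> q) \<le> d z (\<sigma> v') + (T + 1)"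
      using triangle[of z "\<sigma> v" "\<sigma> q"] triangle[of z "\<sigma> v'" "\<sigma> q"] z \<sigma>M by auto
    ultimately have "d z (\<sigma> q) \<le> C" using T unfolding C_def by linarith
    then show ?thesis using s0 by (intro bexI[of _ s0]) (auto simp: z_def)
  qed
  then have "contracting Y \<sigma> C"
    unfolding contracting_def passes_near_def using \<sigma> T by (auto simp: C_def)
  then show ?thesis ..
qed

end

section \<open>Rays, isometries and contracting axes\<close>

text \<open>The maps are total functions of which only the values on the space matter, so that powers and compositions
can be taken as ordinary functions.\<close>

definition isom :: "'a metric \<Rightarrow> ('a \<Rightarrow> 'a) \<Rightarrow> bool" where
  "isom Y f \<longleftrightarrow> bij_betw f (mspace Y) (mspace Y) \<and>
     (\<forall>x\<in>mspace Y. \<forall>y\<in>mspace Y. mdist Y (f x) (f y) = mdist Y x y)"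

lemma isom_mspace: "isom Y f \<Longrightarrow> x \<in> mspace Y \<Longrightarrow> f x \<in> mspace Y"
  by (auto simp: isom_def bij_betw_def)

lemma isom_mdist: "isom Y f \<Longrightarrow> x \<in> mspace Y \<Longrightarrow> y \<in> mspace Y \<Longrightarrow> mdist Y (f x) (f y) = mdist Y x y"
  by (auto simp: isom_def)

lemma isom_surj:
  assumes "isom Y f" "y \<in> mspace Y"
  obtains x where "x \<in> mspace Y" "f x = y"
proof -
  have "f ` mspace Y = mspace Y" using assms(1) by (auto simp: isom_def bij_betw_def)
  then show thesis using assms(2) that by (metis imageE)
qed

lemma isom_id: "isom Y id"
  by (simp add: isom_def)

lemma isom_comp: "isom Y f \<Longrightarrow> isom Y g \<Longrightarrow> isom Y (f \<circ> g)"
  using bij_betw_trans[of g "mspace Y" "mspace Y" f "mspace Y"] isom_mspace[of Y g]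
  by (simp add: isom_def)

lemma isom_funpow: "isom Y f \<Longrightarrow> isom Y (f ^^ n)"
  by (induction n) (auto simp: isom_id isom_comp simp flip: id_def)

lemma isometry_group_isom: "f \<in> carrier (isometry_group Y) \<Longrightarrow> isom Y f"
  by (auto simp: isometry_group_def isom_def Bij_def)

lemma funpow_axis:
  fixes l :: real
  assumes "\<And>t. f (\<sigma> t) = \<sigma> (t + l)"
  shows "(f ^^ n) (\<sigma> t) = \<sigma> (t + real n * l)"
  by (induction n) (auto simp: assms algebra_simps)

lemma geodesic_rayD:
  assumes "geodesic_ray Y c" "0 \<le> s"
  shows "c s \<in> mspace Y" "0 \<le> t \<Longrightarrow> mdist Y (c s) (c t) = \<bar>s - t\<bar>"
  using assms by (auto simp: geodesic_ray_def)

lemma geodesic_line_ray: "geodesic_line Y \<sigma> \<Longrightarrow> geodesic_ray Y \<sigma>"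
  by (auto simp: geodesic_line_def geodesic_ray_def)

lemma geodesic_ray_isom: "isom Y f \<Longrightarrow> geodesic_ray Y c \<Longrightarrow> geodesic_ray Y (f \<circ> c)"
  by (auto simp: geodesic_ray_def isom_mspace isom_mdist)

lemma geodesic_line_isom: "isom Y f \<Longrightarrow> geodesic_line Y c \<Longrightarrow> geodesic_line Y (f \<circ> c)"
  by (auto simp: geodesic_line_def isom_mspace isom_mdist)

lemma geodesic_ray_segment:
  assumes "geodesic_ray Y c" "0 \<le> s"
  shows "geodesic Y (c 0) (c s) c" "mdist Y (c 0) (c s) = s"
  using assms by (auto simp: geodesic_def geodesic_rayD)

lemma asymptotic_sym: "asymptotic Y c c' \<Longrightarrow> asymptotic Y c' c"
  by (simp add: asymptotic_def mdist_commute)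

lemma asymptotic_trans:
  assumes "asymptotic Y c c'" "asymptotic Y c' c''"
    and M: "\<And>t. t \<ge> 0 \<Longrightarrow> c t \<in> mspace Y" "\<And>t. t \<ge> 0 \<Longrightarrow> c' t \<in> mspace Y"
      "\<And>t. t \<ge> 0 \<Longrightarrow> c'' t \<in> mspace Y"
  shows "asymptotic Y c c''"
proof -
  obtain C D where "\<And>t. t \<ge> 0 \<Longrightarrow> mdist Y (c t) (c' t) \<le> C" "\<And>t. t \<ge> 0 \<Longrightarrow> mdist Y (c' t) (c'' t) \<le> D"
    using assms(1,2) unfolding asymptotic_def by blast
  then have "mdist Y (c t) (c'' t) \<le> C + D" if "t \<ge> 0" for t
    using that mdist_triangle[OF M[OF that]] by (meson add_mono order_trans)
  then show ?thesis unfolding asymptotic_def by blast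
qed

lemma asymptotic_isom:
  assumes "isom Y f" "\<And>t. t \<ge> 0 \<Longrightarrow> c t \<in> mspace Y" "\<And>t. t \<ge> 0 \<Longrightarrow> c' t \<in> mspace Y"
  shows "asymptotic Y (f \<circ> c) (f \<circ> c') \<longleftrightarrow> asymptotic Y c c'"
  using assms by (simp add: asymptotic_def isom_mdist)

lemma endpoint_eq:
  assumes "asymptotic Y c c'" "\<And>t. t \<ge> 0 \<Longrightarrow> c t \<in> mspace Y" "\<And>t. t \<ge> 0 \<Longrightarrow> c' t \<in> mspace Y"
  shows "endpoint Y c = endpoint Y c'"
proof -
  have "asymptotic Y c e \<longleftrightarrow> asymptotic Y c' e" if e: "geodesic_ray Y e" for e
  proof -
    have eM: "e t \<in> mspace Y" if "t \<ge> 0" for t using e that by (simp add: geodesic_rayD)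
    show ?thesis
    proof
      assume "asymptotic Y c' e"
      then show "asymptotic Y c e" by (rule asymptotic_trans[OF assms(1) _ assms(2,3) eM])
    next
      assume "asymptotic Y c e"
      then show "asymptotic Y c' e"
        by (rule asymptotic_trans[OF asymptotic_sym[OF assms(1)] _ assms(3,2) eM])
    qed
  qed
  then show ?thesis unfolding endpoint_def by blast
qed

lemma beyond_isom:
  assumes "isom Y f" "geodesic_line Y \<sigma>" "x \<in> mspace Y"
  shows "beyond Y (f \<circ> \<sigma>) t (f x) \<longleftrightarrow> beyond Y \<sigma> t x"
  using assms by (simp add: beyond_def isom_mdist geodesic_lineD)

lemma before_isom:
  assumes "isom Y f" "geodesic_line Y \<sigma>" "x \<in> mspace Y"
  shows "before Y (f \<circ> \<sigma>) t (f x) \<longleftrightarrow> before Y \<sigma> t x"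
  using assms by (simp add: before_def isom_mdist geodesic_lineD)

lemma geodesic_isom:
  assumes f: "isom Y f" and k: "geodesic Y x y k" and xy: "x \<in> mspace Y" "y \<in> mspace Y"
  shows "geodesic Y (f x) (f y) (f \<circ> k)"
  unfolding geodesic_def isom_mdist[OF f xy]
  using geodesicD(1-4)[OF k] isom_mspace[OF f] isom_mdist[OF f] by auto

lemma isom_inverse:
  assumes f: "isom Y f"
  obtains f' where "isom Y f'" "\<And>x. x \<in> mspace Y \<Longrightarrow> f (f' x) = x"
proof -
  let ?f' = "inv_into (mspace Y) f"
  have b: "bij_betw f (mspace Y) (mspace Y)" using f by (simp add: isom_def)
  have ff': "f (?f' x) = x" if "x \<in> mspace Y" for x by (rule bij_betw_inv_into_right[OF b that])
  have M: "?f' x \<in> mspace Y" if "x \<in> mspace Y" for x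
    by (rule bij_betw_apply[OF bij_betw_inv_into[OF b] that])
  have "isom Y ?f'"
    unfolding isom_def
  proof (intro conjI ballI)
    fix x y assume xy: "x \<in> mspace Y" "y \<in> mspace Y"
    show "mdist Y (?f' x) (?f' y) = mdist Y x y"
      using isom_mdist[OF f M[OF xy(1)] M[OF xy(2)]] by (simp add: ff' xy)
  qed (rule bij_betw_inv_into[OF b])
  then show thesis using that ff' by blast
qed

lemma contracting_isom:
  assumes f: "isom Y f" and \<sigma>: "contracting Y \<sigma> C"
  shows "contracting Y (f \<circ> \<sigma>) C"
proof -
  have line: "geodesic_line Y \<sigma>" using \<sigma> by (simp add: contracting_def)
  obtain f' where f': "isom Y f'" "\<And>x. x \<in> mspace Y \<Longrightarrow> f (f' x) = x"
    using isom_inverse[OF f] by metis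
  have "\<exists>s\<in>{0..mdist Y x y}. mdist Y (c s) ((f \<circ> \<sigma>) q) \<le> C"
    if xy: "x \<in> mspace Y" "y \<in> mspace Y" and ab: "before Y (f \<circ> \<sigma>) a x" "beyond Y (f \<circ> \<sigma>) b y"
      and q: "a + C \<le> q" "q \<le> b - C" and c: "geodesic Y x y c" for x y a b q c
  proof -
    note M = isom_mspace[OF f'(1) xy(1)] isom_mspace[OF f'(1) xy(2)]
    have "before Y \<sigma> a (f' x)" "beyond Y \<sigma> b (f' y)"
      using ab before_isom[OF f line M(1)] beyond_isom[OF f line M(2)] by (auto simp: f'(2) xy)
    then obtain s where s: "0 \<le> s" "s \<le> mdist Y (f' x) (f' y)" "mdist Y ((f' \<circ> c) s) (\<sigma> q) \<le> C"
      using contractingD[OF \<sigma> M _ _ q geodesic_isom[OF f'(1) c xy]] by blast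
    have sxy: "s \<le> mdist Y x y" using s(2) isom_mdist[OF f'(1) xy] by simp
    have cs: "c s \<in> mspace Y" by (rule geodesicD(3)[OF c s(1) sxy])
    have "mdist Y (f (f' (c s))) (f (\<sigma> q)) \<le> C"
      using s(3) isom_mdist[OF f isom_mspace[OF f'(1) cs] geodesic_lineD(1)[OF line]] by simp
    then show ?thesis using s(1) sxy by (auto simp: f'(2)[OF cs])
  qed
  then show ?thesis
    using \<sigma> geodesic_line_isom[OF f line] unfolding contracting_def passes_near_def by blast
qed

lemma periodic_line_axis:
  assumes f: "isom Y f" and \<sigma>: "geodesic_line Y \<sigma>" and l: "l > 0" and ax: "\<And>t. f (\<sigma> t) = \<sigma> (t + l)"
  shows "periodic_line Y \<sigma> l"
  unfolding periodic_line_def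
proof (intro conjI ballI allI \<sigma> l)
  fix x and k :: int assume x: "x \<in> mspace Y"
  have \<sigma>M: "\<sigma> t \<in> mspace Y" for t using \<sigma> by (simp add: geodesic_lineD)
  show "\<exists>x'\<in>mspace Y. \<forall>t. mdist Y x' (\<sigma> (t + of_int k * l)) = mdist Y x (\<sigma> t)"
  proof (cases "k \<ge> 0")
    case True
    then have k: "of_int k = real (nat k)" by simp
    have "(f ^^ nat k) (\<sigma> t) = \<sigma> (t + of_int k * l)" for t
      unfolding k by (rule funpow_axis) (rule ax)
    then have "mdist Y ((f ^^ nat k) x) (\<sigma> (t + of_int k * l)) = mdist Y x (\<sigma> t)" for t
      using isom_mdist[OF isom_funpow[OF f] x \<sigma>M, of "nat k" t] by simp
    then show ?thesis using isom_mspace[OF isom_funpow[OF f] x, of "nat k"] by blast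
  next
    case False
    then have k: "of_int k = - real (nat (- k))" by simp
    obtain x' where x': "x' \<in> mspace Y" "(f ^^ nat (- k)) x' = x"
      using isom_surj[OF isom_funpow[OF f] x] .
    show ?thesis
    proof (intro bexI[OF _ x'(1)] allI)
      fix t
      have "(f ^^ nat (- k)) (\<sigma> (t + of_int k * l)) = \<sigma> t"
        using funpow_axis[of f \<sigma> l "nat (- k)" "t + of_int k * l", OF ax] unfolding k by simp
      then show "mdist Y x' (\<sigma> (t + of_int k * l)) = mdist Y x (\<sigma> t)"
        using isom_mdist[OF isom_funpow[OF f] x'(1) \<sigma>M, of "nat (- k)" "t + of_int k * l"] x'(2) by simp
    qed
  qed
qed

context hadamard
begin

text \<open>A ray whose projection to the line is unbounded passes near \<open>\<sigma> t\<close> for every large \<open>t\<close>, by contraction, and it does so at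
about the time \<open>t\<close>.\<close>

lemma asymptotic_of_beyond:
  assumes \<sigma>: "contracting Y \<sigma> C" and c: "geodesic_ray Y c"
    and unb: "\<And>b. \<exists>s\<ge>0. beyond Y \<sigma> b (c s)"
  shows "asymptotic Y c \<sigma>"
proof -
  have line: "geodesic_line Y \<sigma>" and C: "0 \<le> C" using \<sigma> by (auto simp: contracting_def)
  have \<sigma>M: "\<sigma> t \<in> M" for t using line by (simp add: geodesic_lineD)
  have cM: "c t \<in> M" if "t \<ge> 0" for t using c that by (simp add: geodesic_rayD)
  obtain a where a: "before Y \<sigma> a (c 0)" using before_exists[OF line cM] by auto
  define E where "E = d (c 0) (\<sigma> 0)"
  define t0 where "t0 = max 0 (a + C)"
  have t0: "0 \<le> t0" by (simp add: t0_def)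
  have E: "d (c 0) (\<sigma> t) \<le> t + E" "t - E \<le> d (c 0) (\<sigma> t)" if "t \<ge> 0" for t
    using dist_line_lipschitz[OF line cM[of 0], of t 0] triangle[of "\<sigma> 0" "c 0" "\<sigma> t"]
      geodesic_lineD[OF line] cM[of 0] that by (auto simp: E_def commute)
  have "d (c t) (\<sigma> t) \<le> 2 * C + E + 2 * t0" if t: "t \<ge> 0" for t
  proof (cases "t \<ge> t0")
    case True
    obtain s where s: "s \<ge> 0" "beyond Y \<sigma> (t + C) (c s)" using unb by blast
    obtain u where u: "0 \<le> u" "u \<le> d (c 0) (c s)" "d (c u) (\<sigma> t) \<le> C"
      using contractingD[OF \<sigma> cM[of 0] cM[OF s(1)] a s(2) _ _ geodesic_ray_segment(1)[OF c s(1)], of t]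
        True by (auto simp: t0_def)
    have "d (c 0) (c u) = u" "d (c t) (c u) = \<bar>t - u\<bar>"
      using geodesic_rayD(2)[OF c] u t by auto
    moreover have "\<bar>d (c 0) (c u) - d (c 0) (\<sigma> t)\<bar> \<le> C"
      using abs_dist_diff_le[of "c u" "\<sigma> t" "c 0"] cM[OF u(1)] cM[of 0] \<sigma>M u(3) by (simp add: commute)
    ultimately have "\<bar>t - u\<bar> \<le> C + E" using E[OF t] by linarith
    then have "d (c t) (\<sigma> t) \<le> C + E + C"
      using triangle[of "c t" "c u" "\<sigma> t"] cM[OF u(1)] cM[OF t] \<sigma>M u(3) \<open>d (c t) (c u) = \<bar>t - u\<bar>\<close> by force
    then show ?thesis using t0 by simp
  next
    case False
    have "d (c t) (\<sigma> t) \<le> d (c t) (c 0) + d (c 0) (\<sigma> t)" using triangle cM t \<sigma>M by auto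
    also have "\<dots> \<le> t + (t + E)" using geodesic_rayD(2)[OF c t, of 0] E[OF t] t by auto
    finally show ?thesis using False C by simp
  qed
  then show ?thesis unfolding asymptotic_def by blast
qed

lemma beyond_of_not_asymptotic:
  assumes \<sigma>: "contracting Y \<sigma> C" and c: "geodesic_ray Y c"
    and nas: "\<not> asymptotic Y c (\<lambda>t. \<sigma> (- t))"
  shows "\<exists>a. \<forall>s\<ge>0. beyond Y \<sigma> a (c s)"
proof -
  obtain b where b: "\<And>s. s \<ge> 0 \<Longrightarrow> \<not> beyond Y (\<lambda>t. \<sigma> (- t)) b (c s)"
    using asymptotic_of_beyond[OF contracting_reverse[OF \<sigma>] c] nas by metis
  have "beyond Y \<sigma> (- (b - 1)) (c s)" if "s \<ge> 0" for s
    using not_beyond[OF b[OF that]] unfolding before_reverse .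
  then show ?thesis by blast
qed

text \<open>If points lay arbitrarily far out along both lines, then the geodesics to them from a fixed point would
follow both lines for an arbitrarily long time, and the lines would be asymptotic.\<close>

lemma contracting_diverge:
  assumes \<sigma>1: "contracting Y \<sigma>1 C1" and \<sigma>2: "contracting Y \<sigma>2 C2" and nas: "\<not> asymptotic Y \<sigma>1 \<sigma>2"
  shows "\<exists>K. \<forall>y\<in>M. \<not> (beyond Y \<sigma>1 K y \<and> beyond Y \<sigma>2 K y)"
proof (rule ccontr)
  assume "\<not> ?thesis"
  then have ex: "\<And>K. \<exists>y\<in>M. beyond Y \<sigma>1 K y \<and> beyond Y \<sigma>2 K y" by blast
  have line: "geodesic_line Y \<sigma>1" "geodesic_line Y \<sigma>2" and C: "0 \<le> C1" "0 \<le> C2"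
    using \<sigma>1 \<sigma>2 by (auto simp: contracting_def)
  have \<sigma>M: "\<sigma>1 t \<in> M" "\<sigma>2 t \<in> M" for t using line by (auto simp: geodesic_lineD)
  obtain a1 where a1: "before Y \<sigma>1 a1 (\<sigma>1 0)" using before_exists[OF line(1) \<sigma>M(1)] by auto
  obtain a2 where a2: "before Y \<sigma>2 a2 (\<sigma>1 0)" using before_exists[OF line(2) \<sigma>M(1)] by auto
  define E where "E = d (\<sigma>1 0) (\<sigma>2 0)"
  define t0 where "t0 = max 0 (max (a1 + C1) (a2 + C2))"
  have t0: "0 \<le> t0" by (simp add: t0_def)
  have E: "d (\<sigma>1 0) (\<sigma>2 t) \<le> t + E" "t - E \<le> d (\<sigma>1 0) (\<sigma>2 t)" if "t \<ge> 0" for t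
    using dist_line_lipschitz[OF line(2) \<sigma>M(1)[of 0], of t 0] triangle[of "\<sigma>2 0" "\<sigma>1 0" "\<sigma>2 t"]
      geodesic_lineD[OF line(2)] \<sigma>M that by (auto simp: E_def commute)
  have E1: "d (\<sigma>1 0) (\<sigma>1 t) = t" if "t \<ge> 0" for t using geodesic_lineD[OF line(1)] that by simp
  have "d (\<sigma>1 t) (\<sigma>2 t) \<le> 2 * C1 + 2 * C2 + E + 2 * t0" if t: "t \<ge> 0" for t
  proof (cases "t \<ge> t0")
    case True
    obtain y where y: "y \<in> M" "beyond Y \<sigma>1 (t + max C1 C2) y" "beyond Y \<sigma>2 (t + max C1 C2) y"
      using ex by blast
    obtain c where c: "geodesic Y (\<sigma>1 0) y c" using geodesic_exists \<sigma>M y by blast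
    obtain u1 where u1: "0 \<le> u1" "u1 \<le> d (\<sigma>1 0) y" "d (c u1) (\<sigma>1 t) \<le> C1"
      using contractingD[OF \<sigma>1 \<sigma>M(1) y(1) a1 y(2) _ _ c, of t] True by (auto simp: t0_def)
    obtain u2 where u2: "0 \<le> u2" "u2 \<le> d (\<sigma>1 0) y" "d (c u2) (\<sigma>2 t) \<le> C2"
      using contractingD[OF \<sigma>2 \<sigma>M(1) y(1) a2 y(3) _ _ c, of t] True by (auto simp: t0_def)
    have cM: "c u1 \<in> M" "c u2 \<in> M" using geodesicD(3)[OF c] u1 u2 by auto
    have "\<bar>d (c u1) (\<sigma>1 0) - d (\<sigma>1 t) (\<sigma>1 0)\<bar> \<le> C1"
      using abs_dist_diff_le[of "c u1" "\<sigma>1 t" "\<sigma>1 0"] cM \<sigma>M u1(3) by simp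
    moreover have "\<bar>d (c u2) (\<sigma>1 0) - d (\<sigma>2 t) (\<sigma>1 0)\<bar> \<le> C2"
      using abs_dist_diff_le[of "c u2" "\<sigma>2 t" "\<sigma>1 0"] cM \<sigma>M u2(3) by simp
    moreover have "d (\<sigma>1 0) (c u1) = u1" "d (\<sigma>1 0) (c u2) = u2" "d (c u1) (c u2) = \<bar>u1 - u2\<bar>"
      using geodesicD(4,5)[OF c] u1 u2 by auto
    ultimately have "d (c u1) (c u2) \<le> C1 + C2 + E"
      using E[OF t] E1[OF t] by (simp add: commute[of _ "\<sigma>1 0"])
    then have "d (\<sigma>1 t) (\<sigma>2 t) \<le> 2 * C1 + 2 * C2 + E"
      using triangle[of "\<sigma>1 t" "c u1" "\<sigma>2 t"] triangle[of "c u1" "c u2" "\<sigma>2 t"] cM \<sigma>M u1(3) u2(3)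
      by (simp add: commute[of "\<sigma>1 t"])
    then show ?thesis using t0 by simp
  next
    case False
    have "d (\<sigma>1 t) (\<sigma>2 t) \<le> d (\<sigma>1 t) (\<sigma>1 0) + d (\<sigma>1 0) (\<sigma>2 t)" using triangle \<sigma>M by auto
    then show ?thesis using False C E[OF t] E1[OF t] by (simp add: commute[of "\<sigma>1 t"])
  qed
  then show False using nas unfolding asymptotic_def by blast
qed

text \<open>The ray \<open>c\<close> projects to a bounded part of the axis by \<open>asymptotic_of_beyond\<close>. A high power of \<open>g ^^ k\<close> shifts this
part off itself, so geodesics from \<open>c s\<close> to its image pass near a fixed point of the axis, and their length grows with
\<open>s\<close>. If \<open>c\<close> were asymptotic to its image under \<open>g ^^ k\<close>, this length would be bounded.\<close>

lemma funpow_not_asymptotic: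
  assumes \<rho>: "contracting Y \<rho> C" and g: "isom Y g" and l: "l > 0" and ax: "\<And>t. g (\<rho> t) = \<rho> (t + l)"
    and c: "geodesic_ray Y c"
    and nas: "\<not> asymptotic Y c \<rho>" "\<not> asymptotic Y c (\<lambda>t. \<rho> (- t))" and k: "k \<ge> 1"
  shows "\<not> asymptotic Y ((g ^^ k) \<circ> c) c"
proof
  assume "asymptotic Y ((g ^^ k) \<circ> c) c"
  then obtain D where D: "\<And>t. t \<ge> 0 \<Longrightarrow> d ((g ^^ k) (c t)) (c t) \<le> D"
    by (auto simp: asymptotic_def)
  have line: "geodesic_line Y \<rho>" and C: "0 \<le> C" using \<rho> by (auto simp: contracting_def)
  have \<rho>M: "\<rho> t \<in> M" for t using line by (simp add: geodesic_lineD)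
  have cM: "c t \<in> M" if "t \<ge> 0" for t using c that by (simp add: geodesic_rayD)
  obtain b' where b': "\<And>s. s \<ge> 0 \<Longrightarrow> \<not> beyond Y \<rho> b' (c s)"
    using asymptotic_of_beyond[OF \<rho> c] nas(1) by metis
  define b where "b = b' - 1"
  have b: "before Y \<rho> b (c s)" if "s \<ge> 0" for s
    unfolding b_def by (rule not_beyond[OF b'[OF that]])
  obtain a where a: "\<And>s. s \<ge> 0 \<Longrightarrow> beyond Y \<rho> a (c s)"
    using beyond_of_not_asymptotic[OF \<rho> c nas(2)] by blast
  define n where "n = nat \<lceil>(b + 2 * C - a) / l\<rceil>"
  have "(b + 2 * C - a) / l \<le> real n" by (simp add: n_def real_nat_ceiling_ge)
  then have "b + 2 * C - a \<le> real n * l" using l by (simp add: pos_divide_le_eq)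
  also have "\<dots> \<le> real (k * n) * l"
    using k l by (intro mult_right_mono) (auto simp: mult_le_cancel_right1)
  finally have n: "b + C \<le> (a + real (k * n) * l) - C" by simp
  define G where "G = g ^^ (k * n)"
  have G: "isom Y G" by (simp add: G_def isom_funpow g)
  have Gc: "d (G (c s)) (c s) \<le> real n * D" if s: "s \<ge> 0" for s
  proof -
    have "d ((g ^^ (k * m)) (c s)) (c s) \<le> real m * D" for m
    proof (induction m)
      case 0
      then show ?case using cM[OF s] by simp
    next
      case (Suc m)
      have in_M: "(g ^^ n) (c s) \<in> M" for n using isom_mspace[OF isom_funpow[OF g]] cM[OF s] by blast
      have "g ^^ (k * Suc m) = (g ^^ (k * m)) \<circ> (g ^^ k)"
        by (simp add: funpow_add[symmetric] add.commute)
      then have "d ((g ^^ (k * Suc m)) (c s)) ((g ^^ (k * m)) (c s)) = d ((g ^^ k) (c s)) (c s)"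
        using isom_mdist[OF isom_funpow[OF g] in_M cM[OF s]] by simp
      then show ?case
        using Suc D[OF s] triangle[of "(g ^^ (k * Suc m)) (c s)" "(g ^^ (k * m)) (c s)" "c s"] in_M cM[OF s]
        by (simp add: algebra_simps)
    qed
    then show ?thesis by (simp add: G_def)
  qed
  define q where "q = b + C"
  define s where "s = real n * D + d (c 0) (\<rho> q) + C + 1"
  have D0: "0 \<le> D" using D[of 0] nonneg order_trans by blast
  have s: "s \<ge> 0" using D0 C by (simp add: s_def)
  have GM: "G (c s) \<in> M" using isom_mspace[OF G cM[OF s]] .
  have be: "beyond Y \<rho> (a + real (k * n) * l) (G (c s))"
  proof -
    have e: "G (\<rho> t) = \<rho> (t + real (k * n) * l)" for t
      unfolding G_def by (rule funpow_axis) (rule ax)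
    have "d (G (c s)) (G (\<rho> t)) = d (c s) (\<rho> t)" for t
      using isom_mdist[OF G cM[OF s] \<rho>M] .
    from this[of a] this[of "a - 1"] show ?thesis
      using a[OF s] unfolding beyond_def e by (simp add: algebra_simps)
  qed
  obtain e where e: "geodesic Y (c s) (G (c s)) e" using geodesic_exists[OF cM[OF s] GM] by blast
  obtain u where u: "0 \<le> u" "u \<le> d (c s) (G (c s))" "d (e u) (\<rho> q) \<le> C"
    by (rule contractingD[OF \<rho> cM[OF s] GM b[OF s] be _ _ e, of q]) (use n in \<open>auto simp: q_def\<close>)
  have "d (c s) (e u) = u" "e u \<in> M" using geodesicD(3,5)[OF e] u by auto
  then have "d (c s) (\<rho> q) \<le> real n * D + C"
    using u Gc[OF s] triangle[of "c s" "e u" "\<rho> q"] cM[OF s] \<rho>M by (simp add: commute)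
  moreover have "s \<le> d (c s) (\<rho> q) + d (c 0) (\<rho> q)"
    using triangle[of "c 0" "\<rho> q" "c s"] geodesic_ray_segment(2)[OF c s] cM[OF s] cM[of 0] \<rho>M
    by (simp add: commute)
  ultimately show False by (simp add: s_def)
qed

lemma funpow_isom_mspace: "isom Y f \<Longrightarrow> x \<in> M \<Longrightarrow> (f ^^ n) x \<in> M"
  using isom_mspace[OF isom_funpow] .

lemma translates_not_asymptotic:
  assumes g: "isom Y g" and c: "\<And>t. t \<ge> 0 \<Longrightarrow> c t \<in> M"
    and nas: "\<And>k. k \<ge> 1 \<Longrightarrow> \<not> asymptotic Y ((g ^^ k) \<circ> c) c" and ij: "i \<noteq> j"
  shows "\<not> asymptotic Y ((g ^^ i) \<circ> c) ((g ^^ j) \<circ> c)"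
proof -
  have *: "\<not> asymptotic Y ((g ^^ i) \<circ> c) ((g ^^ j) \<circ> c)" if "i < j" for i j
  proof -
    have e: "(g ^^ j) \<circ> c = (g ^^ i) \<circ> ((g ^^ (j - i)) \<circ> c)"
      using that by (simp add: funpow_add[symmetric] flip: comp_assoc)
    have "asymptotic Y ((g ^^ i) \<circ> c) ((g ^^ j) \<circ> c) \<longleftrightarrow> asymptotic Y c ((g ^^ (j - i)) \<circ> c)"
      unfolding e by (rule asymptotic_isom) (use c g in \<open>auto simp: isom_funpow funpow_isom_mspace\<close>)
    then show ?thesis using nas[of "j - i"] that asymptotic_sym[of Y c "(g ^^ (j - i)) \<circ> c"] by linarith
  qed
  show ?thesis using *[of i j] *[of j i] ij asymptotic_sym by (metis linorder_neqE_nat)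
qed

text \<open>At most one translate of a given ray is asymptotic to \<open>e\<close>; otherwise a positive power of \<open>g\<close> would fix the class of \<open>e\<close>.\<close>

lemma translate_asymptotic_unique:
  assumes g: "isom Y g" and c: "\<And>t. t \<ge> 0 \<Longrightarrow> c t \<in> M" and e: "\<And>t. t \<ge> 0 \<Longrightarrow> e t \<in> M"
    and nas: "\<And>k. k \<ge> 1 \<Longrightarrow> \<not> asymptotic Y ((g ^^ k) \<circ> e) e"
    and i: "asymptotic Y ((g ^^ i) \<circ> c) e" and j: "asymptotic Y ((g ^^ j) \<circ> c) e"
  shows "i = j"
proof -
  have *: False if "i < j" and i: "asymptotic Y ((g ^^ i) \<circ> c) e" and j: "asymptotic Y ((g ^^ j) \<circ> c) e" for i j
  proof -
    have eq: "(g ^^ j) \<circ> c = (g ^^ (j - i)) \<circ> ((g ^^ i) \<circ> c)"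
      using that by (simp add: funpow_add[symmetric] flip: comp_assoc)
    have "asymptotic Y ((g ^^ (j - i)) \<circ> ((g ^^ i) \<circ> c)) ((g ^^ (j - i)) \<circ> e) \<longleftrightarrow> asymptotic Y ((g ^^ i) \<circ> c) e"
      by (rule asymptotic_isom) (use c e g in \<open>auto simp: isom_funpow funpow_isom_mspace\<close>)
    then have "asymptotic Y ((g ^^ (j - i)) \<circ> e) ((g ^^ j) \<circ> c)" unfolding eq using i asymptotic_sym by blast
    then have "asymptotic Y ((g ^^ (j - i)) \<circ> e) e"
      by (rule asymptotic_trans[OF _ j]) (use c e g in \<open>auto simp: funpow_isom_mspace\<close>)
    then show False using nas[of "j - i"] that by simp
  qed
  show ?thesis using *[of i j] *[of j i] i j by (metis linorder_neqE_nat)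
qed

text \<open>By \<open>contracting_diverge\<close> no point is far out along two of the first \<open>r + 1\<close> translates of \<open>\<sigma>\<close>.\<close>

lemma translates_barrier:
  fixes r :: nat
  assumes \<sigma>: "contracting Y \<sigma> C" and g: "isom Y g"
    and nas: "\<And>k. k \<ge> 1 \<Longrightarrow> \<not> asymptotic Y ((g ^^ k) \<circ> \<sigma>) \<sigma>"
  shows "\<exists>K. \<forall>y\<in>M. \<forall>i\<le>r. \<forall>j\<le>r.
    beyond Y ((g ^^ i) \<circ> \<sigma>) K y \<and> beyond Y ((g ^^ j) \<circ> \<sigma>) K y \<longrightarrow> i = j"
proof -
  have line: "geodesic_line Y \<sigma>" using \<sigma> by (simp add: contracting_def)
  have line': "geodesic_line Y ((g ^^ i) \<circ> \<sigma>)" for i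
    using geodesic_line_isom[OF isom_funpow[OF g] line] .
  have "\<exists>K. i \<noteq> j \<longrightarrow> (\<forall>y\<in>M. \<not> (beyond Y ((g ^^ i) \<circ> \<sigma>) K y \<and> beyond Y ((g ^^ j) \<circ> \<sigma>) K y))" for i j
  proof (cases "i = j")
    case False
    have "\<not> asymptotic Y ((g ^^ i) \<circ> \<sigma>) ((g ^^ j) \<circ> \<sigma>)"
      by (rule translates_not_asymptotic[OF g _ nas False]) (use line in \<open>auto simp: geodesic_lineD\<close>)
    then show ?thesis
      using contracting_diverge[OF contracting_isom[OF isom_funpow[OF g] \<sigma>] contracting_isom[OF isom_funpow[OF g] \<sigma>]]
      by blast
  qed simp
  then obtain K where K: "\<And>i j y. i \<noteq> j \<Longrightarrow> y \<in> M \<Longrightarrow>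
      \<not> (beyond Y ((g ^^ i) \<circ> \<sigma>) (K i j) y \<and> beyond Y ((g ^^ j) \<circ> \<sigma>) (K i j) y)"
    by metis
  define L where "L = Max ((\<lambda>(i, j). K i j) ` ({..r} \<times> {..r}))"
  have L: "K i j \<le> L" if "i \<le> r" "j \<le> r" for i j
    unfolding L_def using that by (intro Max_ge) auto
  show ?thesis
  proof (intro exI[of _ L] ballI allI impI)
    fix y i j assume y: "y \<in> M" and ij: "i \<le> r" "j \<le> r"
      and b: "beyond Y ((g ^^ i) \<circ> \<sigma>) L y \<and> beyond Y ((g ^^ j) \<circ> \<sigma>) L y"
    have "beyond Y ((g ^^ i) \<circ> \<sigma>) (K i j) y" "beyond Y ((g ^^ j) \<circ> \<sigma>) (K i j) y"
      using b beyond_mono[OF line' y L[OF ij]] by auto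
    then show "i = j" using K y by blast
  qed
qed

text \<open>The power \<open>h ^^ N\<close> shifts the curve \<open>c\<close> far out along \<open>\<sigma>\<close>, so a geodesic to \<open>(g ^^ j) ((h ^^ N) (c s))\<close> from a
point that is not far out along the \<open>j\<close>-th translate passes near a fixed point of this translate. The bounds are uniform in
\<open>N\<close>, since a common \<open>N\<close> is needed for all factors of a product.\<close>

lemma geodesics_to_translates_pass_near:
  fixes r :: nat and K :: real
  assumes \<sigma>: "contracting Y \<sigma> C" and l: "l > 0" and ax: "\<And>t. h (\<sigma> t) = \<sigma> (t + l)"
    and g: "isom Y g" and h: "isom Y h" and p: "p \<in> M"
    and c: "\<And>s. s \<ge> 0 \<Longrightarrow> c s \<in> M" "\<And>s. s \<ge> 0 \<Longrightarrow> beyond Y \<sigma> a (c s)"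
  shows "\<exists>N0 R. \<forall>N\<ge>N0. \<forall>j\<le>r. \<forall>y\<in>M. \<not> beyond Y ((g ^^ j) \<circ> \<sigma>) K y \<longrightarrow>
    (\<forall>s\<ge>0. passes_near Y y ((g ^^ j) ((h ^^ N) (c s))) p R)"
proof -
  have line: "geodesic_line Y \<sigma>" using \<sigma> by (simp add: contracting_def)
  have \<sigma>M: "\<sigma> t \<in> M" for t using line by (simp add: geodesic_lineD)
  define q where "q = K - 1 + C"
  define N0 where "N0 = nat \<lceil>(q + C - a) / l\<rceil>"
  define R where "R = C + (\<Sum>j\<le>r. d ((g ^^ j) (\<sigma> q)) p)"
  show ?thesis
    unfolding passes_near_def
  proof (rule exI[of _ N0], rule exI[of _ R], intro allI impI ballI)
    fix N j y s e
    assume N: "N0 \<le> N" and j: "j \<le> r" and y: "y \<in> M" and nb: "\<not> beyond Y ((g ^^ j) \<circ> \<sigma>) K y"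
      and s: "0 \<le> s" and e: "geodesic Y y ((g ^^ j) ((h ^^ N) (c s))) e"
    let ?z = "(g ^^ j) ((h ^^ N) (c s))"
    have hc: "(h ^^ N) (c s) \<in> M" using funpow_isom_mspace[OF h c(1)[OF s]] .
    have z: "?z \<in> M" using funpow_isom_mspace[OF g hc] .
    have "(q + C - a) / l \<le> real N0" by (simp add: N0_def real_nat_ceiling_ge)
    also have "\<dots> \<le> real N" using N by simp
    finally have qN: "q \<le> (a + real N * l) - C" using l by (simp add: pos_divide_le_eq)
    have "beyond Y \<sigma> (a + real N * l) ((h ^^ N) (c s))"
    proof -
      have e: "(h ^^ N) (\<sigma> t) = \<sigma> (t + real N * l)" for t by (rule funpow_axis) (rule ax)
      have "d ((h ^^ N) (c s)) ((h ^^ N) (\<sigma> t)) = d (c s) (\<sigma> t)" for t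
        using isom_mdist[OF isom_funpow[OF h] c(1)[OF s] \<sigma>M] .
      from this[of a] this[of "a - 1"] show ?thesis
        using c(2)[OF s] unfolding beyond_def e by (simp add: algebra_simps)
    qed
    then have bz: "beyond Y ((g ^^ j) \<circ> \<sigma>) (a + real N * l) ?z"
      using beyond_isom[OF isom_funpow[OF g] line hc] by simp
    obtain u where u: "0 \<le> u" "u \<le> d y ?z" "d (e u) (((g ^^ j) \<circ> \<sigma>) q) \<le> C"
      by (rule contractingD[OF contracting_isom[OF isom_funpow[OF g] \<sigma>] y z not_beyond[OF nb] bz _ qN e])
        (auto simp: q_def)
    have "d ((g ^^ j) (\<sigma> q)) p \<le> (\<Sum>j\<le>r. d ((g ^^ j) (\<sigma> q)) p)"
      using j by (intro member_le_sum) auto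
    moreover have "e u \<in> M" "(g ^^ j) (\<sigma> q) \<in> M"
      using geodesicD(3)[OF e u(1,2)] funpow_isom_mspace[OF g \<sigma>M] by auto
    ultimately have "d (e u) p \<le> R"
      using u(3) triangle[of "e u" "(g ^^ j) (\<sigma> q)" p] p by (simp add: R_def)
    then show "\<exists>u\<in>{0..d y ?z}. d (e u) p \<le> R" using u by auto
  qed
qed

lemma endpoint_fixed:
  assumes f: "isom Y f" and c: "geodesic_ray Y c" and as: "asymptotic Y (f \<circ> c) c"
  shows "Inr (endpoint Y c) \<in> fixed_points Y f"
proof -
  have cM: "c t \<in> M" if "t \<ge> 0" for t using c that by (simp add: geodesic_rayD)
  have "endpoint Y (f \<circ> e) = endpoint Y c" if "e \<in> endpoint Y c" for e
  proof -
    have e: "geodesic_ray Y e" "asymptotic Y c e" using that by (auto simp: endpoint_def)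
    have eM: "e t \<in> M" if "t \<ge> 0" for t using e that by (simp add: geodesic_rayD)
    have "asymptotic Y (f \<circ> e) (f \<circ> c) \<longleftrightarrow> asymptotic Y e c" by (rule asymptotic_isom[OF f eM cM])
    then have "asymptotic Y (f \<circ> e) (f \<circ> c)" using asymptotic_sym[OF e(2)] by simp
    then have "asymptotic Y (f \<circ> e) c"
      by (rule asymptotic_trans[OF _ as]) (use eM cM isom_mspace[OF f] in auto)
    then show ?thesis by (rule endpoint_eq) (use eM cM isom_mspace[OF f] in auto)
  qed
  moreover have "c \<in> endpoint Y c" using c cM by (auto simp: endpoint_def asymptotic_def)
  ultimately have "boundary_map Y f (endpoint Y c) = endpoint Y c"
    unfolding boundary_map_def by auto
  then show ?thesis using c by (auto simp: fixed_points_def boundary_def)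
qed

end

context proper_hadamard
begin

text \<open>A ray along \<open>\<sigma>\<close> cannot be asymptotic to an end of the axis of \<open>g\<close>, since \<open>g\<close> and \<open>h\<close> have no common
fixed point. So \<open>funpow_not_asymptotic\<close> applies to both ends of \<open>\<sigma>\<close>.\<close>

lemma independent_rank_oneE:
  assumes ind: "independent_rank_one Y g h"
  obtains \<sigma> C l where "contracting Y \<sigma> C" "l > 0" "\<And>t. h (\<sigma> t) = \<sigma> (t + l)" "isom Y g" "isom Y h"
    "\<And>k. k \<ge> 1 \<Longrightarrow> \<not> asymptotic Y ((g ^^ k) \<circ> \<sigma>) \<sigma>"
    "\<And>k. k \<ge> 1 \<Longrightarrow> \<not> asymptotic Y ((g ^^ k) \<circ> (\<lambda>t. \<sigma> (- t))) (\<lambda>t. \<sigma> (- t))"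
proof -
  have ax: "\<exists>l c C. is_axis Y f l c \<and> isom Y f \<and> contracting Y c C" if rk: "rank_one_isometry Y f" for f
  proof -
    obtain l c where c: "is_axis Y f l c" "rank_one_line Y c" "f \<in> carrier (isometry_group Y)"
      using rk unfolding rank_one_isometry_def axial_def by blast
    have f: "isom Y f" using c(3) by (rule isometry_group_isom)
    have "periodic_line Y c l"
      by (rule periodic_line_axis[OF f]) (use c(1) in \<open>auto simp: is_axis_def\<close>)
    then show ?thesis using rank_one_contracting[of c l] c f by (auto simp: rank_one_line_def)
  qed
  obtain lh \<sigma> C where \<sigma>: "is_axis Y h lh \<sigma>" "isom Y h" "contracting Y \<sigma> C"
    using ax ind unfolding independent_rank_one_def by blast
  obtain lg \<rho> D where \<rho>: "is_axis Y g lg \<rho>" "isom Y g" "contracting Y \<rho> D"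
    using ax ind unfolding independent_rank_one_def by blast
  have fix_ends: "Inr (endpoint Y c) \<in> fixed_points Y f \<and> Inr (endpoint Y (\<lambda>t. c (- t))) \<in> fixed_points Y f"
    if f: "isom Y f" and c: "is_axis Y f l c" for f l c
  proof
    have line: "geodesic_line Y c" "geodesic_line Y (\<lambda>t. c (- t))"
      using c geodesic_line_reverse by (auto simp: is_axis_def)
    have fc: "f (c t) = c (t + l)" for t using c by (simp add: is_axis_def)
    show "Inr (endpoint Y c) \<in> fixed_points Y f"
      by (rule endpoint_fixed[OF f geodesic_line_ray[OF line(1)]])
        (auto simp: asymptotic_def fc geodesic_lineD[OF line(1)])
    show "Inr (endpoint Y (\<lambda>t. c (- t))) \<in> fixed_points Y f"
      by (rule endpoint_fixed[OF f geodesic_line_ray[OF line(2)]])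
        (auto simp: asymptotic_def fc geodesic_lineD[OF line(1)])
  qed
  have line: "geodesic_line Y \<sigma>" "geodesic_line Y \<rho>" using \<sigma> \<rho> by (auto simp: is_axis_def)
  note rev = line[THEN geodesic_line_reverse]
  have disj: "fixed_points Y g \<inter> fixed_points Y h = {}"
    using ind by (simp add: independent_rank_one_def)
  have na: "\<not> asymptotic Y c e" if "c \<in> {\<sigma>, \<lambda>t. \<sigma> (- t)}" "e \<in> {\<rho>, \<lambda>t. \<rho> (- t)}" for c e
  proof
    assume "asymptotic Y c e"
    then have "endpoint Y c = endpoint Y e"
      by (rule endpoint_eq) (use that line in \<open>auto simp: geodesic_lineD\<close>)
    then show False using that disj fix_ends[OF \<sigma>(2,1)] fix_ends[OF \<rho>(2,1)] by auto
  qed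
  show thesis
  proof (rule that[OF \<sigma>(3)])
    show "lh > 0" "\<And>t. h (\<sigma> t) = \<sigma> (t + lh)" using \<sigma>(1) by (auto simp: is_axis_def)
    have g: "lg > 0" "\<And>t. g (\<rho> t) = \<rho> (t + lg)" using \<rho>(1) by (auto simp: is_axis_def)
    show "\<not> asymptotic Y ((g ^^ k) \<circ> \<sigma>) \<sigma>" if "k \<ge> 1" for k
      by (rule funpow_not_asymptotic[OF \<rho>(3,2) g geodesic_line_ray[OF line(1)] na na that]) auto
    show "\<not> asymptotic Y ((g ^^ k) \<circ> (\<lambda>t. \<sigma> (- t))) (\<lambda>t. \<sigma> (- t))" if "k \<ge> 1" for k
      by (rule funpow_not_asymptotic[OF \<rho>(3,2) g geodesic_line_ray[OF rev(1)] na na that]) auto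
  qed (use \<sigma> \<rho> in auto)
qed

end

section \<open>Discrete groups acting on products\<close>

lemma group_isometry_group: "group (isometry_group Y)"
proof -
  let ?S = "mspace Y"
  let ?H = "{f \<in> Bij ?S. \<forall>x\<in>?S. \<forall>y\<in>?S. mdist Y (f x) (f y) = mdist Y x y}"
  have "subgroup ?H (BijGroup ?S)"
  proof
    show "?H \<subseteq> carrier (BijGroup ?S)" by (auto simp: BijGroup_def)
    show "\<one>\<^bsub>BijGroup ?S\<^esub> \<in> ?H" by (simp add: BijGroup_def id_Bij)
    fix f g assume f: "f \<in> ?H" and g: "g \<in> ?H"
    have "g x \<in> ?S" if "x \<in> ?S" for x using g that Bij_imp_funcset by fastforce
    then show "f \<otimes>\<^bsub>BijGroup ?S\<^esub> g \<in> ?H"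
      using f g by (auto simp: BijGroup_def compose_Bij compose_eq)
  next
    fix f assume f: "f \<in> ?H"
    have inv: "inv\<^bsub>BijGroup ?S\<^esub> f = (\<lambda>x\<in>?S. inv_into ?S f x)" using f by (simp add: inv_BijGroup)
    have surj: "f ` ?S = ?S" using f by (auto simp: Bij_def bij_betw_def)
    have "mdist Y (inv_into ?S f x) (inv_into ?S f y) = mdist Y x y" if "x \<in> ?S" "y \<in> ?S" for x y
    proof -
      have xy: "x \<in> f ` ?S" "y \<in> f ` ?S" using that surj by auto
      have "mdist Y (f (inv_into ?S f x)) (f (inv_into ?S f y)) = mdist Y (inv_into ?S f x) (inv_into ?S f y)"
        using f inv_into_into[OF xy(1)] inv_into_into[OF xy(2)] by simp
      then show ?thesis by (simp add: f_inv_into_f[OF xy(1)] f_inv_into_f[OF xy(2)])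
    qed
    then show "inv\<^bsub>BijGroup ?S\<^esub> f \<in> ?H"
      unfolding inv using f restrict_inv_into_Bij[of f ?S] by auto
  qed
  then show ?thesis
    unfolding isometry_group_def by (rule subgroup.subgroup_is_group[OF _ group_BijGroup])
qed

lemma isometry_group_simps:
  "carrier (isometry_group Y) \<subseteq> Bij (mspace Y)"
  "\<one>\<^bsub>isometry_group Y\<^esub> = (\<lambda>x\<in>mspace Y. x)"
  "f \<in> Bij (mspace Y) \<Longrightarrow> g \<in> Bij (mspace Y) \<Longrightarrow> x \<in> mspace Y \<Longrightarrow>
    (f \<otimes>\<^bsub>isometry_group Y\<^esub> g) x = f (g x)"
  by (auto simp: isometry_group_def BijGroup_def compose_eq)

lemma product_mspaceD: "x \<in> mspace (product_space r X) \<Longrightarrow> i < r \<Longrightarrow> x i \<in> mspace (X i)"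
  unfolding mspace_product_space by (erule PiE_mem) simp

lemma product_mspace_ext:
  assumes "x \<in> mspace (product_space r X)" "y \<in> mspace (product_space r X)" "\<And>i. i < r \<Longrightarrow> x i = y i"
  shows "x = y"
  using assms unfolding mspace_product_space by (intro PiE_ext[of x "{..<r}" _ y]) auto

text \<open>The group structure is used only through the existence of products and inverses with the expected
values (\<open>\<Gamma>_mult\<close>, \<open>\<Gamma>_inv\<close>); an element is determined by its values (\<open>\<Gamma>_ext\<close>).\<close>

locale isometric_action =
  fixes r :: nat and X :: "nat \<Rightarrow> 'a metric" and \<Gamma> :: "(nat \<Rightarrow> 'a \<Rightarrow> 'a) set"
  assumes subgroup: "subgroup \<Gamma> (product_isometry_group r X)"
begin

abbreviation P :: "(nat \<Rightarrow> 'a) metric" where "P \<equiv> product_space r X"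
abbreviation act :: "(nat \<Rightarrow> 'a \<Rightarrow> 'a) \<Rightarrow> (nat \<Rightarrow> 'a) \<Rightarrow> (nat \<Rightarrow> 'a)" where "act \<equiv> product_act r X"

lemma group_product: "group (product_isometry_group r X)"
  unfolding product_isometry_group_def by (intro product_group group_isometry_group)

lemma \<Gamma>_carrier:
  assumes "\<gamma> \<in> \<Gamma>"
  shows "\<gamma> \<in> extensional {..<r}" "i < r \<Longrightarrow> \<gamma> i \<in> carrier (isometry_group (X i))"
proof -
  have "\<gamma> \<in> carrier (product_isometry_group r X)" using subgroup.subset[OF subgroup] assms by (rule subsetD)
  then have "\<gamma> \<in> (\<Pi>\<^sub>E i\<in>{..<r}. carrier (isometry_group (X i)))" by (simp add: product_isometry_group_def)
  then show "\<gamma> \<in> extensional {..<r}" "i < r \<Longrightarrow> \<gamma> i \<in> carrier (isometry_group (X i))"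
    by (simp_all add: PiE_iff)
qed

lemma \<Gamma>_Bij: "\<gamma> \<in> \<Gamma> \<Longrightarrow> i < r \<Longrightarrow> \<gamma> i \<in> Bij (mspace (X i))"
  by (rule subsetD[OF isometry_group_simps(1) \<Gamma>_carrier(2)])

lemma \<Gamma>_isom: "\<gamma> \<in> \<Gamma> \<Longrightarrow> i < r \<Longrightarrow> isom (X i) (\<gamma> i)"
  by (rule isometry_group_isom[OF \<Gamma>_carrier(2)])

lemma \<Gamma>_mspace: "\<gamma> \<in> \<Gamma> \<Longrightarrow> i < r \<Longrightarrow> x \<in> mspace (X i) \<Longrightarrow> \<gamma> i x \<in> mspace (X i)"
  by (rule isom_mspace[OF \<Gamma>_isom])

lemma \<Gamma>_mdist: "\<gamma> \<in> \<Gamma> \<Longrightarrow> i < r \<Longrightarrow> x \<in> mspace (X i) \<Longrightarrow> y \<in> mspace (X i) \<Longrightarrow>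
  mdist (X i) (\<gamma> i x) (\<gamma> i y) = mdist (X i) x y"
  by (rule isom_mdist[OF \<Gamma>_isom])

lemma \<Gamma>_ext:
  assumes "\<gamma> \<in> \<Gamma>" "\<delta> \<in> \<Gamma>" "\<And>i x. i < r \<Longrightarrow> x \<in> mspace (X i) \<Longrightarrow> \<gamma> i x = \<delta> i x"
  shows "\<gamma> = \<delta>"
proof (rule extensionalityI[of _ "{..<r}"])
  fix i assume "i \<in> {..<r}"
  then have i: "i < r" by simp
  show "\<gamma> i = \<delta> i"
    using \<Gamma>_Bij[OF assms(1) i] \<Gamma>_Bij[OF assms(2) i] assms(3)[OF i]
    by (intro extensionalityI[of _ "mspace (X i)"]) (auto intro: Bij_imp_extensional)
qed (use assms \<Gamma>_carrier in auto)

lemma \<Gamma>_one: "\<exists>\<epsilon>\<in>\<Gamma>. \<forall>i<r. \<forall>x\<in>mspace (X i). \<epsilon> i x = x"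
  using subgroup.one_closed[OF subgroup]
  by (intro bexI[of _ "\<one>\<^bsub>product_isometry_group r X\<^esub>"])
    (auto simp: product_isometry_group_def isometry_group_simps(2))

lemma \<Gamma>_mult:
  assumes "\<gamma> \<in> \<Gamma>" "\<delta> \<in> \<Gamma>"
  shows "\<exists>\<epsilon>\<in>\<Gamma>. \<forall>i<r. \<forall>x\<in>mspace (X i). \<epsilon> i x = \<gamma> i (\<delta> i x)"
proof (intro bexI[of _ "\<gamma> \<otimes>\<^bsub>product_isometry_group r X\<^esub> \<delta>"] allI impI ballI)
  show "\<gamma> \<otimes>\<^bsub>product_isometry_group r X\<^esub> \<delta> \<in> \<Gamma>"
    using subgroup.m_closed[OF subgroup assms] .
  fix i x assume "i < r" "x \<in> mspace (X i)"
  then show "(\<gamma> \<otimes>\<^bsub>product_isometry_group r X\<^esub> \<delta>) i x = \<gamma> i (\<delta> i x)"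
    using assms \<Gamma>_Bij by (simp add: product_isometry_group_def isometry_group_simps(3))
qed

lemma \<Gamma>_inv:
  assumes "\<gamma> \<in> \<Gamma>"
  shows "\<exists>\<epsilon>\<in>\<Gamma>. \<forall>i<r. \<forall>x\<in>mspace (X i). \<epsilon> i (\<gamma> i x) = x \<and> \<gamma> i (\<epsilon> i x) = x"
proof -
  interpret group "product_isometry_group r X" by (rule group_product)
  let ?\<epsilon> = "inv\<^bsub>product_isometry_group r X\<^esub> \<gamma>"
  have \<epsilon>: "?\<epsilon> \<in> \<Gamma>" using subgroup.m_inv_closed[OF subgroup assms] .
  have c: "\<gamma> \<in> carrier (product_isometry_group r X)" using subgroup.subset[OF subgroup] assms by auto
  have one: "\<one>\<^bsub>product_isometry_group r X\<^esub> i x = x" if "i < r" "x \<in> mspace (X i)" for i x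
    using that by (simp add: product_isometry_group_def isometry_group_simps(2))
  have mult: "(\<alpha> \<otimes>\<^bsub>product_isometry_group r X\<^esub> \<beta>) i x = \<alpha> i (\<beta> i x)"
    if "i < r" "x \<in> mspace (X i)" "\<alpha> \<in> \<Gamma>" "\<beta> \<in> \<Gamma>" for i x \<alpha> \<beta>
    using that \<Gamma>_Bij by (simp add: product_isometry_group_def isometry_group_simps(3))
  have "?\<epsilon> i (\<gamma> i x) = x \<and> \<gamma> i (?\<epsilon> i x) = x" if "i < r" "x \<in> mspace (X i)" for i x
    using one[OF that] mult[OF that assms \<epsilon>] mult[OF that \<epsilon> assms] l_inv[OF c] r_inv[OF c] by simp
  then show ?thesis using \<epsilon> by blast
qed

lemma \<Gamma>_funpow:
  assumes "\<gamma> \<in> \<Gamma>"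
  shows "\<exists>\<epsilon>\<in>\<Gamma>. \<forall>i<r. \<forall>x\<in>mspace (X i). \<epsilon> i x = (\<gamma> i ^^ n) x"
proof (induction n)
  case 0
  then show ?case using \<Gamma>_one by simp
next
  case (Suc n)
  then obtain \<epsilon> where \<epsilon>: "\<epsilon> \<in> \<Gamma>" "\<forall>i<r. \<forall>x\<in>mspace (X i). \<epsilon> i x = (\<gamma> i ^^ n) x" by blast
  show ?case using \<Gamma>_mult[OF assms \<epsilon>(1)] \<epsilon>(2) by auto
qed

lemma act_apply: "x \<in> mspace P \<Longrightarrow> i < r \<Longrightarrow> act \<gamma> x i = \<gamma> i (x i)"
  by (simp add: product_act_def)

lemma act_mspace: "\<gamma> \<in> \<Gamma> \<Longrightarrow> x \<in> mspace P \<Longrightarrow> act \<gamma> x \<in> mspace P"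
  using \<Gamma>_mspace by (auto simp: product_act_def PiE_def Pi_def)

lemma act_isom:
  assumes \<gamma>: "\<gamma> \<in> \<Gamma>"
  shows "isom P (act \<gamma>)"
proof -
  obtain \<epsilon> where \<epsilon>: "\<epsilon> \<in> \<Gamma>" "\<And>i x. i < r \<Longrightarrow> x \<in> mspace (X i) \<Longrightarrow> \<epsilon> i (\<gamma> i x) = x \<and> \<gamma> i (\<epsilon> i x) = x"
    using \<Gamma>_inv[OF \<gamma>] by blast
  have *: "act \<epsilon> (act \<gamma> x) = x \<and> act \<gamma> (act \<epsilon> x) = x" if x: "x \<in> mspace P" for x
  proof -
    have xi: "x i \<in> mspace (X i)" if "i < r" for i by (rule product_mspaceD[OF x that])
    have "act \<epsilon> (act \<gamma> x) i = x i \<and> act \<gamma> (act \<epsilon> x) i = x i" if "i < r" for i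
      using act_apply[OF act_mspace[OF \<gamma> x] that] act_apply[OF act_mspace[OF \<epsilon>(1) x] that]
        act_apply[OF x that] \<epsilon>(2)[OF that xi[OF that]] by simp
    then show ?thesis
      using product_mspace_ext[OF act_mspace[OF \<epsilon>(1) act_mspace[OF \<gamma> x]] x]
        product_mspace_ext[OF act_mspace[OF \<gamma> act_mspace[OF \<epsilon>(1) x]] x] by blast
  qed
  have "bij_betw (act \<gamma>) (mspace P) (mspace P)"
    by (rule bij_betw_byWitness[where f' = "act \<epsilon>"]) (use * act_mspace \<gamma> \<epsilon>(1) in blast)+
  moreover have "mdist P (act \<gamma> x) (act \<gamma> y) = mdist P x y" if "x \<in> mspace P" "y \<in> mspace P" for x y
    using that \<Gamma>_mdist[OF \<gamma>] unfolding mdist_product_space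
    by (intro L2_set_cong refl) (auto simp: act_apply PiE_def Pi_def)
  ultimately show ?thesis by (simp add: isom_def)
qed

end

lemma mdist_component_le: "i < r \<Longrightarrow> mdist (X i) (x i) (y i) \<le> mdist (product_space r X) x y"
  unfolding mdist_product_space by (rule member_le_L2_set) auto

lemma mdist_product_le_sum: "mdist (product_space r X) x y \<le> (\<Sum>i<r. mdist (X i) (x i) (y i))"
  by (simp add: L2_set_le_sum)

text \<open>Compactness of a product of balls holds for the product topology by Tychonoff's theorem; continuity of the
identity transfers it to the product metric.\<close>

lemma continuous_product_id:
  fixes X :: "nat \<Rightarrow> 'a metric"
  shows "continuous_map (product_topology (\<lambda>i. mtopology_of (X i)) {..<r}) (mtopology_of (product_space r X)) id"
proof -
  let ?T = "product_topology (\<lambda>i. mtopology_of (X i)) {..<r}"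
  interpret P: Metric_space "mspace (product_space r X)" "mdist (product_space r X)"
    by (rule Metric_space_mspace_mdist)
  have "openin ?T U" if U: "openin (mtopology_of (product_space r X)) U" for U
  proof (subst openin_subopen, intro ballI)
    fix x assume x: "x \<in> U"
    have xM: "x \<in> mspace (product_space r X)" using openin_subset[OF U] x by auto
    obtain e where e: "e > 0" "P.mball x e \<subseteq> U"
      using U x unfolding mtopology_of_def P.openin_mtopology by blast
    define V where "V = (\<Pi>\<^sub>E i\<in>{..<r}. mball_of (X i) (x i) (e / (real r + 1)))"
    have "openin (mtopology_of (X i)) (mball_of (X i) (x i) (e / (real r + 1)))" for i
    proof -
      interpret Metric_space "mspace (X i)" "mdist (X i)" by simp
      show ?thesis unfolding mtopology_of_def mball_of_def by simp
    qed
    then have "openin ?T V" unfolding V_def by (simp add: openin_PiE)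
    moreover have "x \<in> V"
      unfolding V_def
    proof (rule PiE_I)
      fix i assume "i \<in> {..<r}"
      then have "x i \<in> mspace (X i)" using product_mspaceD[OF xM] by simp
      then show "x i \<in> mball_of (X i) (x i) (e / (real r + 1))" using e by (simp add: mdist_self)
    next
      show "x i = undefined" if "i \<notin> {..<r}" for i
        using xM that unfolding mspace_product_space by (rule PiE_arb)
    qed
    moreover have "V \<subseteq> U"
    proof
      fix y assume y: "y \<in> V"
      then have yM: "y \<in> mspace (product_space r X)" by (auto simp: V_def PiE_def Pi_def)
      have "(\<Sum>i<r. mdist (X i) (x i) (y i)) \<le> (\<Sum>i<r. e / (real r + 1))"
        using y by (intro sum_mono) (auto simp: V_def PiE_def Pi_def less_imp_le)
      also have "\<dots> < e" using e by (simp add: field_simps)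
      finally have "mdist (product_space r X) x y < e"
        using mdist_product_le_sum[of r X x y] by linarith
      then have "y \<in> P.mball x e" unfolding P.in_mball using xM yM by blast
      then show "y \<in> U" using e(2) by blast
    qed
    ultimately show "\<exists>V. openin ?T V \<and> x \<in> V \<and> V \<subseteq> U" by blast
  qed
  moreover have "topspace ?T = topspace (mtopology_of (product_space r X))" by simp
  ultimately show ?thesis by (metis topology_finer_continuous_id)
qed

text \<open>There are \<open>r + 1\<close> values of \<open>m\<close>, and each of the \<open>r\<close> indices \<open>i\<close> spoils at most one of them.\<close>

lemma pigeonhole_good:
  fixes r :: nat
  assumes "\<And>i m m'. i < r \<Longrightarrow> m \<le> r \<Longrightarrow> m' \<le> r \<Longrightarrow> B i m \<Longrightarrow> B i m' \<Longrightarrow> m = m'"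
  shows "\<exists>m\<le>r. \<forall>i<r. \<not> B i m"
proof (rule ccontr)
  assume "\<not> ?thesis"
  then have "\<forall>m\<in>{..r}. \<exists>i. i < r \<and> B i m" by auto
  then obtain f where f: "\<And>m. m \<le> r \<Longrightarrow> f m < r \<and> B (f m) m" by (metis atMost_iff)
  then have "inj_on f {..r}" using assms by (intro inj_onI) (metis atMost_iff)
  moreover have "f ` {..r} \<subseteq> {..<r}" using f by auto
  ultimately have "card {..r} \<le> card {..<r}" by (rule card_inj_on_le) simp
  then show False by simp
qed

locale rank_one_action = isometric_action +
  fixes h g :: "nat \<Rightarrow> 'a \<Rightarrow> 'a" and p :: "nat \<Rightarrow> 'a"
  assumes hadamard: "\<And>i. i < r \<Longrightarrow> hadamard_space (X i)"
    and loc_compact: "\<And>i. i < r \<Longrightarrow> locally_compact_space (mtopology_of (X i))"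
    and discontinuous: "properly_discontinuous r X \<Gamma>"
    and h\<Gamma>: "h \<in> \<Gamma>" and g\<Gamma>: "g \<in> \<Gamma>"
    and independent: "\<And>i. i < r \<Longrightarrow> independent_rank_one (X i) (g i) (h i)"
    and p: "p \<in> mspace (product_space r X)"
begin

lemma factor: "i < r \<Longrightarrow> proper_hadamard (X i)"
  by unfold_locales (use hadamard loc_compact in auto)

lemma p_mspace: "i < r \<Longrightarrow> p i \<in> mspace (X i)"
  by (rule product_mspaceD[OF p])

lemma finite_orbit_ball: "finite {\<gamma> \<in> \<Gamma>. \<forall>i<r. mdist (X i) (p i) (\<gamma> i (p i)) \<le> R}"
proof -
  define K where "K = (\<Pi>\<^sub>E i\<in>{..<r}. mcball_of (X i) (p i) (max 0 R))"
  have "compactin (mtopology_of (X i)) (mcball_of (X i) (p i) (max 0 R))" if "i < r" for i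
  proof -
    interpret proper_hadamard "X i" using factor[OF that] .
    show ?thesis using compactin_mcball by (simp add: mtopology_of_def mcball_of_def)
  qed
  then have "compactin (product_topology (\<lambda>i. mtopology_of (X i)) {..<r}) K"
    unfolding K_def by (simp add: compactin_PiE)
  from image_compactin[OF this continuous_product_id]
  have "finite {\<gamma> \<in> \<Gamma>. act \<gamma> ` K \<inter> K \<noteq> {}}"
    using discontinuous unfolding properly_discontinuous_def by simp
  moreover have "act \<gamma> ` K \<inter> K \<noteq> {}" if "\<gamma> \<in> \<Gamma>" "\<forall>i<r. mdist (X i) (p i) (\<gamma> i (p i)) \<le> R" for \<gamma>
  proof -
    have K: "x \<in> K" if "x \<in> mspace P" "\<And>i. i < r \<Longrightarrow> mdist (X i) (p i) (x i) \<le> max 0 R" for x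
      unfolding K_def
    proof (rule PiE_I)
      show "x i = undefined" if "i \<notin> {..<r}" for i
        using \<open>x \<in> mspace P\<close> that unfolding mspace_product_space by (rule PiE_arb)
    qed (use that p_mspace product_mspaceD in auto)
    have "p \<in> K"
    proof (rule K[OF p])
      show "mdist (X i) (p i) (p i) \<le> max 0 R" if "i < r" for i
        using p_mspace[OF that] by (simp add: mdist_self)
    qed
    moreover have "act \<gamma> p \<in> K"
      by (rule K[OF act_mspace[OF that(1) p]]) (use that(2) in \<open>simp add: act_apply[OF p] le_max_iff_disj\<close>)
    ultimately show ?thesis by blast
  qed
  ultimately show ?thesis by (elim rev_finite_subset) blast
qed

text \<open>The finite set consists of the elements \<open>g ^ j * h ^ N * g ^ m\<close> for \<open>j \<le> r\<close>. First \<open>m\<close> is chosen, by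
\<open>pigeonhole_good\<close>, such that in no factor the ray \<open>g ^ m \<rho>\<close> tends to the repelling end of \<open>h\<close>; then \<open>N\<close> is chosen large
enough for all factors. Given \<open>y\<close>, the exponent \<open>j\<close> is chosen, again by \<open>pigeonhole_good\<close>, such that in no
factor \<open>y\<close> lies far out along the \<open>j\<close>-th translate of the axis.\<close>

lemma finite_shadow:
  assumes \<rho>: "\<And>i. i < r \<Longrightarrow> geodesic_ray (X i) (\<rho> i)"
  obtains F R where "finite F" "F \<subseteq> \<Gamma>" "F \<noteq> {}" "0 \<le> R"
    "\<forall>y\<in>mspace P. \<exists>f\<in>F. \<forall>i<r. \<forall>s\<ge>0. passes_near (X i) (y i) (f i (\<rho> i s)) (p i) R"
proof -
  define axis where "axis = (\<lambda>i \<sigma> C l. contracting (X i) \<sigma> C \<and> l > 0 \<and> (\<forall>t. h i (\<sigma> t) = \<sigma> (t + l)) \<and>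
    (\<forall>k\<ge>1. \<not> asymptotic (X i) ((g i ^^ k) \<circ> \<sigma>) \<sigma>) \<and>
    (\<forall>k\<ge>1. \<not> asymptotic (X i) ((g i ^^ k) \<circ> (\<lambda>t. \<sigma> (- t))) (\<lambda>t. \<sigma> (- t))))"
  have "\<exists>\<sigma> C l. axis i \<sigma> C l" if "i < r" for i
  proof -
    interpret proper_hadamard "X i" using factor[OF that] .
    show ?thesis using independent_rank_oneE[OF independent[OF that]] unfolding axis_def by metis
  qed
  then obtain \<sigma> C l where ax: "\<And>i. i < r \<Longrightarrow> axis i (\<sigma> i) (C i) (l i)" by metis
  have con: "contracting (X i) (\<sigma> i) (C i)" "l i > 0" "h i (\<sigma> i t) = \<sigma> i (t + l i)"
    "k \<ge> 1 \<Longrightarrow> \<not> asymptotic (X i) ((g i ^^ k) \<circ> \<sigma> i) (\<sigma> i)"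
    "k \<ge> 1 \<Longrightarrow> \<not> asymptotic (X i) ((g i ^^ k) \<circ> (\<lambda>t. \<sigma> i (- t))) (\<lambda>t. \<sigma> i (- t))"
    if "i < r" for i t k
    using ax[OF that] unfolding axis_def by auto
  have line: "geodesic_line (X i) (\<sigma> i)" if "i < r" for i
    using con(1)[OF that] by (simp add: contracting_def)
  note gi = \<Gamma>_isom[OF g\<Gamma>] and hi = \<Gamma>_isom[OF h\<Gamma>]
  have \<rho>M: "\<rho> i s \<in> mspace (X i)" if "i < r" "s \<ge> 0" for i s
    using geodesic_rayD[OF \<rho>[OF that(1)] that(2)] by simp
  have "\<exists>m\<le>r. \<forall>i<r. \<not> asymptotic (X i) ((g i ^^ m) \<circ> \<rho> i) (\<lambda>t. \<sigma> i (- t))"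
  proof (rule pigeonhole_good)
    fix i m m' assume i: "i < r" and a: "asymptotic (X i) ((g i ^^ m) \<circ> \<rho> i) (\<lambda>t. \<sigma> i (- t))"
      "asymptotic (X i) ((g i ^^ m') \<circ> \<rho> i) (\<lambda>t. \<sigma> i (- t))"
    interpret proper_hadamard "X i" using factor[OF i] .
    show "m = m'"
      by (rule translate_asymptotic_unique[OF gi[OF i] \<rho>M[OF i] _ con(5)[OF i] a])
        (use line[OF i] in \<open>auto simp: geodesic_lineD\<close>)
  qed
  then obtain m where m: "\<And>i. i < r \<Longrightarrow> \<not> asymptotic (X i) ((g i ^^ m) \<circ> \<rho> i) (\<lambda>t. \<sigma> i (- t))"
    by blast
  define c where "c = (\<lambda>i. (g i ^^ m) \<circ> \<rho> i)"
  have c: "geodesic_ray (X i) (c i)" if "i < r" for i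
    unfolding c_def by (rule geodesic_ray_isom[OF isom_funpow[OF gi[OF that]] \<rho>[OF that]])
  have cM: "c i s \<in> mspace (X i)" if "i < r" "s \<ge> 0" for i s
    using geodesic_rayD[OF c[OF that(1)] that(2)] by simp
  have "\<exists>a. \<forall>s\<ge>0. beyond (X i) (\<sigma> i) a (c i s)" if i: "i < r" for i
  proof -
    interpret proper_hadamard "X i" using factor[OF i] .
    show ?thesis using beyond_of_not_asymptotic[OF con(1)[OF i] c[OF i]] m[OF i] by (simp add: c_def)
  qed
  then obtain a where a: "\<And>i s. i < r \<Longrightarrow> s \<ge> 0 \<Longrightarrow> beyond (X i) (\<sigma> i) (a i) (c i s)" by metis
  have "\<exists>K. \<forall>y\<in>mspace (X i). \<forall>j\<le>r. \<forall>k\<le>r. beyond (X i) ((g i ^^ j) \<circ> \<sigma> i) K y \<and>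
      beyond (X i) ((g i ^^ k) \<circ> \<sigma> i) K y \<longrightarrow> j = k" if i: "i < r" for i
  proof -
    interpret proper_hadamard "X i" using factor[OF i] .
    show ?thesis by (rule translates_barrier[OF con(1)[OF i] gi[OF i] con(4)[OF i]])
  qed
  then obtain K where K: "\<And>i y j k. i < r \<Longrightarrow> y \<in> mspace (X i) \<Longrightarrow> j \<le> r \<Longrightarrow> k \<le> r \<Longrightarrow>
      beyond (X i) ((g i ^^ j) \<circ> \<sigma> i) (K i) y \<Longrightarrow> beyond (X i) ((g i ^^ k) \<circ> \<sigma> i) (K i) y \<Longrightarrow> j = k"
    by metis
  define pass where
    "pass = (\<lambda>i R N j y. \<forall>s\<ge>0. passes_near (X i) y ((g i ^^ j) ((h i ^^ N) (c i s))) (p i) R)"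
  have "\<exists>N0 R. \<forall>N\<ge>N0. \<forall>j\<le>r. \<forall>y\<in>mspace (X i). \<not> beyond (X i) ((g i ^^ j) \<circ> \<sigma> i) (K i) y \<longrightarrow> pass i R N j y"
    if i: "i < r" for i
  proof -
    interpret proper_hadamard "X i" using factor[OF i] .
    show ?thesis unfolding pass_def
      by (rule geodesics_to_translates_pass_near[OF con(1-3)[OF i] gi[OF i] hi[OF i] p_mspace[OF i]
            cM[OF i] a[OF i]])
  qed
  then obtain N0 R where NR: "\<And>i N j y. i < r \<Longrightarrow> N \<ge> N0 i \<Longrightarrow> j \<le> r \<Longrightarrow> y \<in> mspace (X i) \<Longrightarrow>
      \<not> beyond (X i) ((g i ^^ j) \<circ> \<sigma> i) (K i) y \<Longrightarrow> pass i (R i) N j y" by metis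
  define N where "N = (\<Sum>i<r. N0 i)"
  define R' where "R' = (\<Sum>i<r. \<bar>R i\<bar>)"
  have N: "N0 i \<le> N" if "i < r" for i unfolding N_def using that by (intro member_le_sum) auto
  have R': "R i \<le> R'" if "i < r" for i
  proof -
    have "\<bar>R i\<bar> \<le> R'" unfolding R'_def using that by (intro member_le_sum) auto
    then show ?thesis by simp
  qed
  have "\<exists>f\<in>\<Gamma>. \<forall>i<r. \<forall>x\<in>mspace (X i). f i x = (g i ^^ j) ((h i ^^ N) ((g i ^^ m) x))" for j
  proof -
    obtain f1 where f1: "f1 \<in> \<Gamma>" "\<And>i x. i < r \<Longrightarrow> x \<in> mspace (X i) \<Longrightarrow> f1 i x = (g i ^^ m) x"
      using \<Gamma>_funpow[OF g\<Gamma>] by blast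
    obtain f2 where f2: "f2 \<in> \<Gamma>" "\<And>i x. i < r \<Longrightarrow> x \<in> mspace (X i) \<Longrightarrow> f2 i x = (h i ^^ N) x"
      using \<Gamma>_funpow[OF h\<Gamma>] by blast
    obtain f3 where f3: "f3 \<in> \<Gamma>" "\<And>i x. i < r \<Longrightarrow> x \<in> mspace (X i) \<Longrightarrow> f3 i x = (g i ^^ j) x"
      using \<Gamma>_funpow[OF g\<Gamma>] by blast
    obtain f4 where f4: "f4 \<in> \<Gamma>" "\<And>i x. i < r \<Longrightarrow> x \<in> mspace (X i) \<Longrightarrow> f4 i x = f2 i (f1 i x)"
      using \<Gamma>_mult[OF f2(1) f1(1)] by blast
    obtain f5 where f5: "f5 \<in> \<Gamma>" "\<And>i x. i < r \<Longrightarrow> x \<in> mspace (X i) \<Longrightarrow> f5 i x = f3 i (f4 i x)"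
      using \<Gamma>_mult[OF f3(1) f4(1)] by blast
    have "f5 i x = (g i ^^ j) ((h i ^^ N) ((g i ^^ m) x))" if "i < r" "x \<in> mspace (X i)" for i x
    proof -
      have "f1 i x \<in> mspace (X i)" "f4 i x \<in> mspace (X i)" using \<Gamma>_mspace f1(1) f4(1) that by auto
      then show ?thesis using f5(2)[OF that] f3(2)[OF that(1)] f4(2)[OF that] f2(2)[OF that(1)] f1(2)[OF that]
        by simp
    qed
    then show ?thesis using f5(1) by blast
  qed
  then obtain f where f: "\<And>j. f j \<in> \<Gamma>"
    "\<And>j i x. i < r \<Longrightarrow> x \<in> mspace (X i) \<Longrightarrow> f j i x = (g i ^^ j) ((h i ^^ N) ((g i ^^ m) x))" by metis
  show thesis
  proof (rule that[of "f ` {..r}" R', OF _ _ _ _ ballI])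
    show "0 \<le> R'" by (simp add: R'_def sum_nonneg)
    fix y assume y: "y \<in> mspace P"
    have yi: "y i \<in> mspace (X i)" if "i < r" for i by (rule product_mspaceD[OF y that])
    have "\<exists>j\<le>r. \<forall>i<r. \<not> beyond (X i) ((g i ^^ j) \<circ> \<sigma> i) (K i) (y i)"
      by (rule pigeonhole_good) (use K yi in blast)
    then obtain j where j: "j \<le> r" "\<And>i. i < r \<Longrightarrow> \<not> beyond (X i) ((g i ^^ j) \<circ> \<sigma> i) (K i) (y i)" by blast
    show "\<exists>f\<in>f ` {..r}. \<forall>i<r. \<forall>s\<ge>0. passes_near (X i) (y i) (f i (\<rho> i s)) (p i) R'"
    proof (intro bexI[of _ "f j"] allI impI)
      fix i s assume i: "i < r" and s: "(0 :: real) \<le> s"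
      have eq: "f j i (\<rho> i s) = (g i ^^ j) ((h i ^^ N) (c i s))"
        using f(2)[OF i \<rho>M[OF i s]] by (simp add: c_def)
      have "pass i (R i) N j (y i)" using NR[OF i N[OF i] j(1) yi[OF i] j(2)[OF i]] .
      then show "passes_near (X i) (y i) (f j i (\<rho> i s)) (p i) R'"
        using s R'[OF i] unfolding pass_def eq by (blast intro: passes_near_mono)
    qed (use j in auto)
  qed (use f in auto)
qed

end

section \<open>Boundary points\<close>

lemma boundary_rep:
  assumes "\<eta> \<in> boundary Y" "c \<in> \<eta>"
  shows "geodesic_ray Y c" "\<eta> = endpoint Y c"
proof -
  obtain c0 where c0: "geodesic_ray Y c0" "\<eta> = endpoint Y c0" using assms by (auto simp: boundary_def)
  then show c: "geodesic_ray Y c" using assms by (simp add: endpoint_def)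
  have "asymptotic Y c0 c" using assms c0 by (simp add: endpoint_def)
  then show "\<eta> = endpoint Y c" unfolding c0(2)
    by (rule endpoint_eq) (use c c0 in \<open>auto simp: geodesic_rayD\<close>)
qed

lemma endpoint_self: "geodesic_ray Y c \<Longrightarrow> c \<in> endpoint Y c"
  by (auto simp: mdist_self endpoint_def asymptotic_def geodesic_ray_def)

lemma boundary_nonempty: "\<eta> \<in> boundary Y \<Longrightarrow> \<exists>c. c \<in> \<eta>"
  using endpoint_self by (auto simp: boundary_def)

lemma endpoint_boundary: "geodesic_ray Y c \<Longrightarrow> endpoint Y c \<in> boundary Y"
  by (auto simp: boundary_def)

lemma boundary_asymptotic:
  assumes "\<eta> \<in> boundary Y" "c \<in> \<eta>" "c' \<in> \<eta>"
  shows "asymptotic Y c c'"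
  using boundary_rep(2)[OF assms(1,2)] assms(3) by (auto simp: endpoint_def)

lemma boundary_memI:
  assumes "\<eta> \<in> boundary Y" "c \<in> \<eta>" "geodesic_ray Y c'" "asymptotic Y c c'"
  shows "c' \<in> \<eta>"
  using boundary_rep(2)[OF assms(1,2)] assms(3,4) by (auto simp: endpoint_def)

lemma boundary_eqI:
  assumes "\<eta> \<in> boundary Y" "\<zeta> \<in> boundary Y" "c \<in> \<eta>" "c \<in> \<zeta>"
  shows "\<eta> = \<zeta>"
  using boundary_rep(2)[OF assms(1,3)] boundary_rep(2)[OF assms(2,4)] by simp

lemma boundary_map_eq:
  assumes f: "isom Y f" and \<eta>: "\<eta> \<in> boundary Y" and c: "c \<in> \<eta>"
  shows "boundary_map Y f \<eta> = endpoint Y (f \<circ> c)"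
proof -
  have "endpoint Y (f \<circ> e) = endpoint Y (f \<circ> c)" if e: "e \<in> \<eta>" for e
  proof (rule endpoint_eq)
    have M: "e t \<in> mspace Y" "c t \<in> mspace Y" if "t \<ge> 0" for t
      using boundary_rep(1)[OF \<eta> e] boundary_rep(1)[OF \<eta> c] that by (auto simp: geodesic_rayD)
    have "asymptotic Y (f \<circ> e) (f \<circ> c) \<longleftrightarrow> asymptotic Y e c" by (rule asymptotic_isom[OF f M])
    then show "asymptotic Y (f \<circ> e) (f \<circ> c)" using boundary_asymptotic[OF \<eta> e c] by simp
    show "(f \<circ> e) t \<in> mspace Y" "(f \<circ> c) t \<in> mspace Y" if "t \<ge> 0" for t
      using isom_mspace[OF f M(1)[OF that]] isom_mspace[OF f M(2)[OF that]] by simp_all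
  qed
  then have "(\<Union>e\<in>\<eta>. endpoint Y (f \<circ> e)) = (\<Union>e\<in>\<eta>. endpoint Y (f \<circ> c))" by (rule SUP_cong[OF refl])
  also have "\<dots> = endpoint Y (f \<circ> c)" using c by (metis UN_constant empty_iff)
  finally show ?thesis unfolding boundary_map_def .
qed

lemma boundary_map_mem:
  assumes f: "isom Y f" and \<eta>: "\<eta> \<in> boundary Y" and c: "c \<in> \<eta>"
  shows "f \<circ> c \<in> boundary_map Y f \<eta>"
  unfolding boundary_map_eq[OF assms]
  by (rule endpoint_self[OF geodesic_ray_isom[OF f boundary_rep(1)[OF \<eta> c]]])

lemma boundary_map_inj:
  assumes f: "isom Y f" and "\<eta> \<in> boundary Y" "\<zeta> \<in> boundary Y" and eq: "boundary_map Y f \<eta> = boundary_map Y f \<zeta>"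
  shows "\<eta> = \<zeta>"
proof -
  obtain c e where ce: "c \<in> \<eta>" "e \<in> \<zeta>" using assms boundary_nonempty by blast
  have M: "c t \<in> mspace Y" "e t \<in> mspace Y" if "t \<ge> 0" for t
    using boundary_rep(1)[OF assms(2) ce(1)] boundary_rep(1)[OF assms(3) ce(2)] that by (auto simp: geodesic_rayD)
  have "f \<circ> e \<in> endpoint Y (f \<circ> c)"
    using boundary_map_mem[OF f assms(3) ce(2)] boundary_map_eq[OF f assms(2) ce(1)] eq by simp
  then have "asymptotic Y (f \<circ> c) (f \<circ> e)" by (simp add: endpoint_def)
  moreover have "asymptotic Y (f \<circ> c) (f \<circ> e) \<longleftrightarrow> asymptotic Y c e" by (rule asymptotic_isom[OF f M])
  ultimately have "e \<in> \<eta>" using boundary_memI[OF assms(2) ce(1) boundary_rep(1)[OF assms(3) ce(2)]] by simp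
  then show ?thesis using boundary_eqI assms(2,3) ce(2) by metis
qed

section \<open>Busemann functions\<close>

lemma antimono_tendsto_Inf:
  fixes f :: "real \<Rightarrow> real"
  assumes anti: "\<And>s t. 0 \<le> s \<Longrightarrow> s \<le> t \<Longrightarrow> f t \<le> f s" and bd: "\<And>t. 0 \<le> t \<Longrightarrow> B \<le> f t"
  shows "(f \<longlongrightarrow> Inf (f ` {0..})) at_top"
proof (rule decreasing_tendsto)
  have bb: "bdd_below (f ` {0..})" using bd by (auto intro: bdd_belowI[of _ B])
  show "\<forall>\<^sub>F t in at_top. Inf (f ` {0..}) \<le> f t"
    using eventually_ge_at_top[of 0] by eventually_elim (auto intro: cInf_lower bb)
  fix x assume "Inf (f ` {0..}) < x"
  then obtain s where s: "0 \<le> s" "f s < x" using cInf_lessD[of "f ` {0..}" x] by auto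
  show "\<forall>\<^sub>F t in at_top. f t < x"
    using eventually_ge_at_top[of s] by eventually_elim (use s anti order_le_less_trans in blast)
qed

text \<open>Along a ray \<open>c\<close> the function \<open>s \<mapsto> d(z, c s) - s\<close> is decreasing and bounded, so the limit in the definition
exists.\<close>

lemma busemann_tendsto:
  assumes \<xi>: "\<xi> \<in> boundary Y" and xy: "x \<in> mspace Y" "y \<in> mspace Y"
  shows "((\<lambda>s. mdist Y x ((SOME c. c \<in> \<xi>) s) - mdist Y y ((SOME c. c \<in> \<xi>) s)) \<longlongrightarrow> busemann Y \<xi> x y) at_top"
proof -
  define c where "c = (SOME c. c \<in> \<xi>)"
  have "c \<in> \<xi>" unfolding c_def using boundary_nonempty[OF \<xi>] by (rule someI_ex)
  then have c: "geodesic_ray Y c" by (rule boundary_rep(1)[OF \<xi>])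
  interpret Metric_space "mspace Y" "mdist Y" by (rule Metric_space_mspace_mdist)
  have conv: "\<exists>L. ((\<lambda>s. mdist Y z (c s) - s) \<longlongrightarrow> L) at_top" if z: "z \<in> mspace Y" for z
  proof (rule exI, rule antimono_tendsto_Inf)
    fix s t :: real assume st: "0 \<le> s" "s \<le> t"
    then have "mdist Y (c s) (c t) = t - s" "c s \<in> mspace Y" "c t \<in> mspace Y"
      using geodesic_rayD[OF c, of s] geodesic_rayD[OF c, of t] by auto
    then show "mdist Y z (c t) - t \<le> mdist Y z (c s) - s" using triangle[of z "c s" "c t"] z by simp
  next
    fix t :: real assume t: "0 \<le> t"
    then have "mdist Y (c 0) (c t) = t" "c 0 \<in> mspace Y" "c t \<in> mspace Y"
      using geodesic_rayD[OF c, of 0] geodesic_rayD[OF c, of t] by auto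
    then show "- mdist Y (c 0) z \<le> mdist Y z (c t) - t" using triangle[of "c 0" z "c t"] z by simp
  qed
  obtain L where L: "((\<lambda>s. mdist Y x (c s) - s) \<longlongrightarrow> L) at_top" using conv xy by blast
  obtain L' where L': "((\<lambda>s. mdist Y y (c s) - s) \<longlongrightarrow> L') at_top" using conv xy by blast
  have lim: "((\<lambda>s. mdist Y x (c s) - mdist Y y (c s)) \<longlongrightarrow> L - L') at_top"
    using tendsto_diff[OF L L'] by simp
  have "busemann Y \<xi> x y = L - L'"
    unfolding busemann_def Let_def c_def[symmetric] by (rule tendsto_Lim[OF trivial_limit_at_top_linorder lim])
  then show ?thesis using lim unfolding c_def by simp
qed

text \<open>The number \<open>D\<close> bounds the error made by computing the Busemann function along the curve \<open>e\<close> instead of the ray that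
its definition selects. It must not depend on the points \<open>x\<close> and \<open>y\<close>, since it is used for whole orbits.\<close>

definition busemann_along :: "'a metric \<Rightarrow> (real \<Rightarrow> 'a) set \<Rightarrow> (real \<Rightarrow> 'a) \<Rightarrow> real \<Rightarrow> bool" where
  "busemann_along Y \<xi> e D \<longleftrightarrow> (\<forall>x\<in>mspace Y. \<forall>y\<in>mspace Y. \<forall>lo hi.
     (\<forall>\<^sub>F t in at_top. lo \<le> mdist Y x (e t) - mdist Y y (e t) \<and> mdist Y x (e t) - mdist Y y (e t) \<le> hi) \<longrightarrow>
     lo - D \<le> busemann Y \<xi> x y \<and> busemann Y \<xi> x y \<le> hi + D)"

lemma busemann_alongD:
  assumes "busemann_along Y \<xi> e D" "x \<in> mspace Y" "y \<in> mspace Y"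
    and "\<And>t. t0 \<le> t \<Longrightarrow> lo \<le> mdist Y x (e t) - mdist Y y (e t)"
    and "\<And>t. t0 \<le> t \<Longrightarrow> mdist Y x (e t) - mdist Y y (e t) \<le> hi"
  shows "lo - D \<le> busemann Y \<xi> x y" "busemann Y \<xi> x y \<le> hi + D"
proof -
  have "\<forall>\<^sub>F t in at_top. lo \<le> mdist Y x (e t) - mdist Y y (e t) \<and> mdist Y x (e t) - mdist Y y (e t) \<le> hi"
    using eventually_ge_at_top[of t0] by eventually_elim (use assms(4,5) in blast)
  then show "lo - D \<le> busemann Y \<xi> x y" "busemann Y \<xi> x y \<le> hi + D"
    using assms(1-3) unfolding busemann_along_def by blast+
qed

lemma busemann_approx:
  assumes \<xi>: "\<xi> \<in> boundary Y" and eM: "\<And>t. t \<ge> 0 \<Longrightarrow> e t \<in> mspace Y"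
    and as: "\<And>c. c \<in> \<xi> \<Longrightarrow> \<exists>D. \<forall>t\<ge>0. mdist Y (c t) (e t) \<le> D"
  shows "\<exists>D\<ge>0. busemann_along Y \<xi> e D"
proof -
  define c where "c = (SOME c. c \<in> \<xi>)"
  have c\<xi>: "c \<in> \<xi>" unfolding c_def using boundary_nonempty[OF \<xi>] by (rule someI_ex)
  have cM: "c t \<in> mspace Y" if "t \<ge> 0" for t
    using geodesic_rayD[OF boundary_rep(1)[OF \<xi> c\<xi>] that] by simp
  obtain D where D: "\<And>t. t \<ge> 0 \<Longrightarrow> mdist Y (c t) (e t) \<le> D" using as[OF c\<xi>] by blast
  interpret Metric_space "mspace Y" "mdist Y" by (rule Metric_space_mspace_mdist)
  have D0: "0 \<le> D" using D[of 0] nonneg[of "c 0" "e 0"] by linarith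
  have cl: "\<bar>mdist Y x (c t) - mdist Y x (e t)\<bar> \<le> D" if "x \<in> mspace Y" "t \<ge> 0" for x t
    using triangle[of x "c t" "e t"] triangle[of x "e t" "c t"] that cM[OF that(2)] eM[OF that(2)] D[OF that(2)]
    by (simp add: commute[of "e t" "c t"] abs_le_iff)
  show ?thesis
    unfolding busemann_along_def
  proof (rule exI[of _ "2 * D"], intro conjI[of "0 \<le> 2 * D"] ballI allI impI)
    fix x y lo hi assume xy: "x \<in> mspace Y" "y \<in> mspace Y"
      and ev: "\<forall>\<^sub>F t in at_top. lo \<le> mdist Y x (e t) - mdist Y y (e t) \<and> mdist Y x (e t) - mdist Y y (e t) \<le> hi"
    note lim = busemann_tendsto[OF \<xi> xy, folded c_def]
    have near: "\<forall>\<^sub>F t in at_top. lo - 2 * D \<le> mdist Y x (c t) - mdist Y y (c t) \<and>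
        mdist Y x (c t) - mdist Y y (c t) \<le> hi + 2 * D"
      using ev eventually_ge_at_top[of 0]
    proof eventually_elim
      case (elim t)
      then show ?case using cl[OF xy(1), of t] cl[OF xy(2), of t] by linarith
    qed
    show "lo - 2 * D \<le> busemann Y \<xi> x y \<and> busemann Y \<xi> x y \<le> hi + 2 * D"
    proof
      show "lo - 2 * D \<le> busemann Y \<xi> x y"
        by (rule tendsto_lowerbound[OF lim eventually_mono[OF near]]) auto
      show "busemann Y \<xi> x y \<le> hi + 2 * D"
        by (rule tendsto_upperbound[OF lim eventually_mono[OF near]]) auto
    qed
  qed (use D0 in simp)
qed

section \<open>Slopes\<close>

lemma product_ray_component:
  assumes "geodesic_ray (product_space r X) c" "t \<ge> 0" "i < r"
  shows "c t i \<in> mspace (X i)"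
  by (rule product_mspaceD[OF geodesic_rayD(1)[OF assms(1,2)] assms(3)])

lemma regular_slopeD: "\<theta> \<in> regular_slopes r \<Longrightarrow> i < r \<Longrightarrow> 0 < \<theta> i"
  by (simp add: regular_slopes_def)

lemma slope_support_regular: "\<theta> \<in> regular_slopes r \<Longrightarrow> slope_support r \<theta> = {..<r}"
  by (auto simp: slope_support_def regular_slopes_def)

lemma boundary_slopeE:
  assumes "\<eta> \<in> boundary_slope r X \<theta>" "\<theta> \<in> regular_slopes r"
  obtains c \<rho> where "c \<in> \<eta>" "\<eta> \<in> boundary (product_space r X)" "\<And>i. i < r \<Longrightarrow> geodesic_ray (X i) (\<rho> i)"
    "\<And>t i. t \<ge> 0 \<Longrightarrow> i < r \<Longrightarrow> c t i = \<rho> i (t * \<theta> i)"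
  using assms(1) unfolding boundary_slope_def has_slope_def slope_support_regular[OF assms(2)] by blast

text \<open>All representatives of a boundary point of regular slope have asymptotic components, so the projection is a
single class, namely that of the components of any representative run at unit speed.\<close>

lemma boundary_proj_approx:
  assumes \<eta>: "\<eta> \<in> boundary_slope r X \<theta>" and \<theta>: "\<theta> \<in> regular_slopes r" and e: "e \<in> \<eta>" and i: "i < r"
  shows "boundary_proj X \<theta> \<eta> i \<in> boundary (X i)"
    and "c \<in> boundary_proj X \<theta> \<eta> i \<Longrightarrow> \<exists>D. \<forall>t\<ge>0. mdist (X i) (c t) (e (t / \<theta> i) i) \<le> D"
proof -
  obtain c0 \<rho> where c0: "c0 \<in> \<eta>" "\<eta> \<in> boundary (product_space r X)" "\<And>i. i < r \<Longrightarrow> geodesic_ray (X i) (\<rho> i)"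
    "\<And>t i. t \<ge> 0 \<Longrightarrow> i < r \<Longrightarrow> c0 t i = \<rho> i (t * \<theta> i)"
    using boundary_slopeE[OF \<eta> \<theta>] by metis
  have \<theta>i: "\<theta> i > 0" using regular_slopeD[OF \<theta> i] .
  have as: "asymptotic (X i) (\<lambda>t. e (t / \<theta> i) i) (\<rho> i)" if e: "e \<in> \<eta>" for e
  proof -
    obtain C where C: "\<And>t. t \<ge> 0 \<Longrightarrow> mdist (product_space r X) (e t) (c0 t) \<le> C"
      using boundary_asymptotic[OF c0(2) e c0(1)] by (auto simp only: asymptotic_def)
    have "mdist (X i) (e (t / \<theta> i) i) (\<rho> i t) \<le> C" if t: "t \<ge> 0" for t
    proof -
      have t': "t / \<theta> i \<ge> 0" using t \<theta>i by simp
      have "mdist (X i) (e (t / \<theta> i) i) (c0 (t / \<theta> i) i) \<le> C"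
        using mdist_component_le[OF i, of X "e (t / \<theta> i)" "c0 (t / \<theta> i)"] C[OF t'] by linarith
      then show ?thesis using c0(4)[OF t' i] \<theta>i by simp
    qed
    then show ?thesis unfolding asymptotic_def by blast
  qed
  have eM: "e (t / \<theta> i) i \<in> mspace (X i)" if "e \<in> \<eta>" "t \<ge> 0" for e t
    using product_ray_component[OF boundary_rep(1)[OF c0(2) that(1)] _ i] that(2) \<theta>i by simp
  have "endpoint (X i) (\<lambda>t. e (t / \<theta> i) i) = endpoint (X i) (\<rho> i)" if "e \<in> \<eta>" for e
    by (rule endpoint_eq[OF as[OF that] eM[OF that]]) (use geodesic_rayD[OF c0(3)[OF i]] in auto)
  then have pr: "boundary_proj X \<theta> \<eta> i = endpoint (X i) (\<rho> i)"
    unfolding boundary_proj_def using c0(1) by auto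
  show "boundary_proj X \<theta> \<eta> i \<in> boundary (X i)" unfolding pr by (rule endpoint_boundary[OF c0(3)[OF i]])
  assume c: "c \<in> boundary_proj X \<theta> \<eta> i"
  have cr: "geodesic_ray (X i) c" "asymptotic (X i) (\<rho> i) c" using c unfolding pr endpoint_def by auto
  have "asymptotic (X i) c (\<lambda>t. e (t / \<theta> i) i)"
  proof (rule asymptotic_trans[OF asymptotic_sym[OF cr(2)] asymptotic_sym[OF as[OF e]]])
    show "c t \<in> mspace (X i)" "\<rho> i t \<in> mspace (X i)" "e (t / \<theta> i) i \<in> mspace (X i)" if "t \<ge> 0" for t
      using geodesic_rayD(1)[OF cr(1) that] geodesic_rayD(1)[OF c0(3)[OF i] that] eM[OF e that] by auto
  qed
  then show "\<exists>D. \<forall>t\<ge>0. mdist (X i) (c t) (e (t / \<theta> i) i) \<le> D" by (simp add: asymptotic_def)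
qed

text \<open>Asymptotic rays have components with the same speed. The zero components, which are constant, are included.\<close>

lemma slope_unique:
  assumes \<eta>: "\<eta> \<in> boundary_slope r X \<theta>" "\<eta> \<in> boundary_slope r X \<theta>'" and \<theta>: "\<theta> \<in> slopes r" "\<theta>' \<in> slopes r"
    and i: "i < r"
  shows "\<theta> i = \<theta>' i"
proof -
  have P: "\<eta> \<in> boundary (product_space r X)" using \<eta> by (simp add: boundary_slope_def)
  have *: "\<exists>c\<in>\<eta>. \<forall>t\<ge>0. mdist (X i) (c 0 i) (c t i) = t * \<theta> i"
    if sl: "\<eta> \<in> boundary_slope r X \<theta>" "\<theta> \<in> slopes r" for \<theta>
  proof -
    obtain c c' where c: "c \<in> \<eta>" "\<forall>i\<in>slope_support r \<theta>. geodesic_ray (X i) (c' i)"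
      "\<forall>t\<ge>0. \<forall>i<r. c t i = c' i (t * \<theta> i)"
      using sl(1) unfolding boundary_slope_def has_slope_def by blast
    have "mdist (X i) (c 0 i) (c t i) = t * \<theta> i" if t: "t \<ge> 0" for t
    proof (cases "\<theta> i > 0")
      case True
      then have "geodesic_ray (X i) (c' i)" using c(2) i by (simp add: slope_support_def)
      then show ?thesis using geodesic_rayD(2)[of "X i" "c' i" 0 "t * \<theta> i"] c(3) t i True by simp
    next
      case False
      then have z: "\<theta> i = 0" using sl(2) i by (auto simp: slopes_def intro: antisym)
      have "c 0 i \<in> mspace (X i)" using product_ray_component[OF boundary_rep(1)[OF P c(1)] _ i, of 0] by simp
      then show ?thesis using c(3) t i z by (simp add: mdist_self)
    qed
    then show ?thesis using c(1) by blast
  qed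
  obtain c where c: "c \<in> \<eta>" "\<And>t. t \<ge> 0 \<Longrightarrow> mdist (X i) (c 0 i) (c t i) = t * \<theta> i" using *[OF \<eta>(1) \<theta>(1)] by blast
  obtain e where e: "e \<in> \<eta>" "\<And>t. t \<ge> 0 \<Longrightarrow> mdist (X i) (e 0 i) (e t i) = t * \<theta>' i" using *[OF \<eta>(2) \<theta>(2)] by blast
  obtain C where C: "\<And>t. t \<ge> 0 \<Longrightarrow> mdist (product_space r X) (c t) (e t) \<le> C"
    using boundary_asymptotic[OF P c(1) e(1)] by (auto simp only: asymptotic_def)
  interpret Metric_space "mspace (X i)" "mdist (X i)" by (rule Metric_space_mspace_mdist)
  have "t * \<bar>\<theta> i - \<theta>' i\<bar> \<le> 2 * C" if t: "t \<ge> 0" for t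
  proof -
    have M: "c t i \<in> mspace (X i)" "e t i \<in> mspace (X i)" if "t \<ge> 0" for t
      using product_ray_component[OF boundary_rep(1)[OF P c(1)] that i]
        product_ray_component[OF boundary_rep(1)[OF P e(1)] that i] by auto
    have cl: "mdist (X i) (c t i) (e t i) \<le> C" if "t \<ge> 0" for t
      using mdist_component_le[OF i, of X "c t" "e t"] C[OF that] by linarith
    have "\<bar>t * \<theta> i - t * \<theta>' i\<bar> \<le> 2 * C"
      using triangle[of "c 0 i" "e 0 i" "c t i"] triangle[of "e 0 i" "e t i" "c t i"]
        triangle[of "e 0 i" "c 0 i" "e t i"] triangle[of "c 0 i" "c t i" "e t i"]
        M[of 0] M[OF t] cl[of 0] cl[OF t] c(2)[OF t] e(2)[OF t]
      by (simp add: commute[of "e 0 i" "c 0 i"] commute[of "e t i" "c t i"] abs_le_iff)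
    moreover have "\<bar>t * \<theta> i - t * \<theta>' i\<bar> = t * \<bar>\<theta> i - \<theta>' i\<bar>"
      using t by (simp add: right_diff_distrib[symmetric] abs_mult)
    ultimately show ?thesis by simp
  qed
  then have bd: "t * \<bar>\<theta> i - \<theta>' i\<bar> \<le> 2 * C" if "t \<ge> 0" for t using that .
  show ?thesis
  proof (rule ccontr)
    assume "\<theta> i \<noteq> \<theta>' i"
    then have pos: "\<bar>\<theta> i - \<theta>' i\<bar> > 0" by simp
    have "C \<ge> 0" using bd[of 0] by simp
    then show False using bd[of "(2 * C + 1) / \<bar>\<theta> i - \<theta>' i\<bar>"] pos by simp
  qed
qed

text \<open>For a point \<open>k t\<close> on the geodesic, the vectors of component distances from \<open>x\<close> to \<open>k t\<close> and from \<open>k t\<close> to \<open>y\<close>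
attain equality in Minkowski's inequality, hence are parallel, and their sum is the vector of component distances from \<open>x\<close> to \<open>y\<close>.\<close>

lemma product_geodesic_proportional:
  assumes k: "geodesic (product_space r X) x y k" and xy: "x \<in> mspace (product_space r X)" "y \<in> mspace (product_space r X)"
    and t: "0 < t" "t < mdist (product_space r X) x y" and i: "i < r"
  shows "mdist (X i) (x i) (k t i) / t = mdist (X i) (x i) (y i) / mdist (product_space r X) x y"
proof -
  define L where "L = mdist (product_space r X) x y"
  define u where "u = (\<lambda>i. mdist (X i) (x i) (k t i))"
  define v where "v = (\<lambda>i. mdist (X i) (k t i) (y i))"
  define w where "w = (\<lambda>i. mdist (X i) (x i) (y i))"
  have kM: "k t \<in> mspace (product_space r X)" by (rule geodesicD(3)[OF k]) (use t in auto)
  have sqr: "(\<Sum>i<r. (mdist (X i) (a i) (b i))\<^sup>2) = (mdist (product_space r X) a b)\<^sup>2" for a b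
    by (simp add: L2_set_def sum_nonneg)
  have "mdist (product_space r X) x (k t) = t" by (rule geodesicD(5)[OF k]) (use t in auto)
  then have su: "(\<Sum>i<r. (u i)\<^sup>2) = t\<^sup>2" unfolding u_def sqr by simp
  have "mdist (product_space r X) (k t) y = L - t" unfolding L_def by (rule geodesicD(6)[OF k]) (use t in auto)
  then have sv: "(\<Sum>i<r. (v i)\<^sup>2) = (L - t)\<^sup>2" unfolding v_def sqr by simp
  have sw: "(\<Sum>i<r. (w i)\<^sup>2) = L\<^sup>2" unfolding w_def sqr L_def ..
  have L: "0 < t" "0 < L - t" using t by (auto simp: L_def)
  have wuv: "0 \<le> w i" "w i \<le> u i + v i" if "i < r" for i
    using mdist_triangle[OF product_mspaceD[OF xy(1) that] product_mspaceD[OF kM that] product_mspaceD[OF xy(2) that]]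
    by (auto simp: u_def v_def w_def)
  have "L\<^sup>2 \<le> (\<Sum>i<r. (u i + v i)\<^sup>2)"
    unfolding sw[symmetric] by (intro sum_mono power_mono) (use wuv in auto)
  also have "\<dots> = t\<^sup>2 + (L - t)\<^sup>2 + 2 * (\<Sum>i<r. u i * v i)"
    by (simp add: su[symmetric] sv[symmetric] power2_sum sum.distrib sum_distrib_left algebra_simps)
  finally have uv: "t * (L - t) \<le> (\<Sum>i<r. u i * v i)"
    by (simp add: power2_eq_square algebra_simps)
  have eq0: "(\<Sum>i<r. ((L - t) * u i - t * v i)\<^sup>2) = 0"
  proof -
    have "(\<Sum>i<r. ((L - t) * u i - t * v i)\<^sup>2) =
      (L - t)\<^sup>2 * (\<Sum>i<r. (u i)\<^sup>2) + t\<^sup>2 * (\<Sum>i<r. (v i)\<^sup>2) - 2 * (t * (L - t)) * (\<Sum>i<r. u i * v i)"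
    proof -
      have "(\<Sum>i<r. (a * u i - b * v i)\<^sup>2) =
        a\<^sup>2 * (\<Sum>i<r. (u i)\<^sup>2) + b\<^sup>2 * (\<Sum>i<r. (v i)\<^sup>2) - 2 * (b * a) * (\<Sum>i<r. u i * v i)" for a b :: real
        by (simp add: power2_eq_square sum.distrib sum_subtractf sum_distrib_left algebra_simps)
      then show ?thesis .
    qed
    also have "\<dots> = 2 * (t * (L - t)) * (t * (L - t) - (\<Sum>i<r. u i * v i))"
      unfolding su sv by (simp add: power2_eq_square algebra_simps)
    also have "\<dots> \<le> 0" using L uv by (intro mult_nonneg_nonpos) auto
    finally show ?thesis by (intro antisym sum_nonneg) auto
  qed
  have parallel: "(L - t) * u i = t * v i" if "i < r" for i
    using eq0 that by (subst (asm) sum_nonneg_eq_0_iff) auto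
  have sum_eq: "u i + v i = L / t * u i" if "i < r" for i
    using parallel[OF that] L by (simp add: field_simps)
  have "(\<Sum>i<r. (L / t * u i)\<^sup>2 - (w i)\<^sup>2) = 0"
  proof -
    have "(\<Sum>i<r. (L / t * u i)\<^sup>2) = (L / t)\<^sup>2 * (\<Sum>i<r. (u i)\<^sup>2)"
      by (simp only: power_mult_distrib sum_distrib_left)
    also have "\<dots> = L\<^sup>2" using L by (simp add: su power_divide)
    finally show ?thesis by (simp add: sum_subtractf sw)
  qed
  moreover have "(L / t * u i)\<^sup>2 - (w i)\<^sup>2 \<ge> 0" if "i < r" for i
    using wuv[OF that] sum_eq[OF that] power_mono[of "w i" "u i + v i" 2] by simp
  ultimately have "(L / t * u i)\<^sup>2 = (w i)\<^sup>2"
    using i by (subst (asm) sum_nonneg_eq_0_iff) auto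
  moreover have "0 \<le> L / t * u i" using L by (simp add: u_def)
  ultimately have "L / t * u i = w i" using wuv(1)[OF i] by (metis power2_eq_imp_eq)
  then show ?thesis using L unfolding u_def w_def L_def[symmetric] by (simp add: field_simps)
qed

section \<open>Multiplicity of boundary points in an orbit\<close>

lemma card_le_fibres:
  assumes "finite S" "\<And>y. y \<in> g ` S \<Longrightarrow> card {x \<in> S. g x = y} \<le> k"
  shows "card S \<le> card (g ` S) * k"
proof -
  have "card S = (\<Sum>x\<in>S. 1)" by simp
  also have "\<dots> = (\<Sum>y\<in>g ` S. \<Sum>x\<in>{x \<in> S. g x = y}. 1)" by (rule sum.image_gen[OF assms(1)])
  also have "\<dots> = (\<Sum>y\<in>g ` S. card {x \<in> S. g x = y})" by simp
  also have "\<dots> \<le> (\<Sum>y\<in>g ` S. k)" by (rule sum_mono) (rule assms(2))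
  finally show ?thesis by simp
qed

context rank_one_action
begin

text \<open>The set \<open>S\<close> consists of elements \<open>\<gamma>\<close> for which \<open>\<gamma>\<inverse> f\<close> maps the boundary point of \<open>\<rho>\<close> to that of \<open>e\<close> and
for which the geodesics from \<open>\<gamma> p\<close> to \<open>f \<rho>\<close> pass near \<open>p\<close>. Equivalently, geodesics from \<open>p\<close> to \<open>\<gamma>\<inverse> f \<rho>\<close> pass near
\<open>\<gamma>\<inverse> p\<close>. For large \<open>s\<close> they are, on bounded sets, close to the geodesics \<open>\<kappa> i\<close> from \<open>p i\<close> to \<open>e s i\<close>, which do not depend on
\<open>\<gamma>\<close>. So \<open>\<gamma>\<inverse> p\<close> is determined up to bounded distance by \<open>r\<close> parameters in \<open>{0..n + R}\<close>. Rounding them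
down to integers gives at most \<open>(n + R + 1) ^ r\<close> classes, and each class is bounded by proper
discontinuity.\<close>

lemma coset_multiplicity:
  fixes n R :: real
  assumes \<rho>: "\<And>i. i < r \<Longrightarrow> geodesic_ray (X i) (\<rho> i)" and \<theta>: "\<And>i. i < r \<Longrightarrow> 0 < \<theta> i"
    and f: "f \<in> \<Gamma>" and R: "0 \<le> R" and S: "finite S" "S \<subseteq> \<Gamma>"
    and eM: "\<And>s i. s \<ge> 0 \<Longrightarrow> i < r \<Longrightarrow> e s i \<in> mspace (X i)"
    and close: "\<And>\<gamma>. \<gamma> \<in> S \<Longrightarrow> \<exists>D. \<forall>s\<ge>0. \<forall>i<r. mdist (X i) (\<gamma> i (e s i)) (f i (\<rho> i (s * \<theta> i))) \<le> D"
    and shadow: "\<And>\<gamma> i s. \<gamma> \<in> S \<Longrightarrow> i < r \<Longrightarrow> s \<ge> 0 \<Longrightarrow>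
      passes_near (X i) (\<gamma> i (p i)) (f i (\<rho> i s)) (p i) R"
    and bd: "\<And>\<gamma> i. \<gamma> \<in> S \<Longrightarrow> i < r \<Longrightarrow> mdist (X i) (p i) (\<gamma> i (p i)) \<le> n"
  shows "card S \<le> (nat \<lfloor>n + R\<rfloor> + 1) ^ r * card {\<gamma> \<in> \<Gamma>. \<forall>i<r. mdist (X i) (p i) (\<gamma> i (p i)) \<le> 2 * R + 3}"
proof -
  obtain \<iota> where \<iota>: "\<And>\<gamma>. \<gamma> \<in> \<Gamma> \<Longrightarrow> \<iota> \<gamma> \<in> \<Gamma>"
    "\<And>\<gamma> i x. \<gamma> \<in> \<Gamma> \<Longrightarrow> i < r \<Longrightarrow> x \<in> mspace (X i) \<Longrightarrow> \<iota> \<gamma> i (\<gamma> i x) = x \<and> \<gamma> i (\<iota> \<gamma> i x) = x"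
    using \<Gamma>_inv by metis
  have near: "\<exists>s0. \<forall>s\<ge>s0. \<forall>\<kappa>. geodesic (X i) (p i) (e s i) \<kappa> \<longrightarrow>
      (\<exists>u\<in>{0..n + R}. u \<le> mdist (X i) (p i) (e s i) \<and> mdist (X i) (\<kappa> u) (\<iota> \<gamma> i (p i)) \<le> R + 1)"
    if \<gamma>S: "\<gamma> \<in> S" and i: "i < r" for \<gamma> i
  proof -
    interpret proper_hadamard "X i" using factor[OF i] .
    have \<gamma>: "\<gamma> \<in> \<Gamma>" using \<gamma>S S by blast
    note pM = p_mspace[OF i]
    note \<gamma>M = \<Gamma>_mspace[OF \<gamma> i] and \<iota>M = \<Gamma>_mspace[OF \<iota>(1)[OF \<gamma>] i] and fM = \<Gamma>_mspace[OF f i]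
    note \<gamma>d = \<Gamma>_mdist[OF \<gamma> i] and \<iota>d = \<Gamma>_mdist[OF \<iota>(1)[OF \<gamma>] i]
    note \<iota>\<gamma> = \<iota>(2)[OF \<gamma> i, THEN conjunct1] and \<gamma>\<iota> = \<iota>(2)[OF \<gamma> i, THEN conjunct2]
    obtain D where D: "\<And>s. s \<ge> 0 \<Longrightarrow> d (\<gamma> i (e s i)) (f i (\<rho> i (s * \<theta> i))) \<le> D"
      using close[OF \<gamma>S] i by blast
    have D0: "D \<ge> 0" using D[of 0] nonneg order_trans by blast
    have n0: "n \<ge> 0" using bd[OF \<gamma>S i] nonneg order_trans by blast
    \<comment> \<open>If both geodesics are longer than \<open>T\<close> and their ends are \<open>D\<close>-close, they are 1-close up to time \<open>n + R\<close>.\<close>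
    define T where "T = (n + R) * (D + 1) + 1"
    have T: "T \<ge> 1" "n + R \<le> T" "(n + R) * D \<le> T" using n0 R D0 by (auto simp: T_def algebra_simps)
    have \<rho>M: "\<rho> i t \<in> M" if "t \<ge> 0" for t using geodesic_rayD[OF \<rho>[OF i] that] by simp
    define K where "K = d (\<gamma> i (p i)) (f i (\<rho> i 0))"
    define s0 where "s0 = (T + D + K) / \<theta> i"
    have s00: "s0 \<ge> 0" using T D0 \<theta>[OF i] by (simp add: s0_def K_def)
    have "\<exists>u\<in>{0..n + R}. u \<le> d (p i) (e s i) \<and> d (\<kappa> u) (\<iota> \<gamma> i (p i)) \<le> R + 1"
      if s: "s \<ge> s0" and \<kappa>: "geodesic (X i) (p i) (e s i) \<kappa>" for s \<kappa>
    proof -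
      have sp: "s \<ge> 0" "s * \<theta> i \<ge> 0" using s s00 \<theta>[OF i] by auto
      define z where "z = f i (\<rho> i (s * \<theta> i))"
      have zM: "z \<in> M" unfolding z_def by (rule fM[OF \<rho>M[OF sp(2)]])
      define E where "E = \<iota> \<gamma> i z"
      have EM: "E \<in> M" unfolding E_def by (rule \<iota>M[OF zM])
      have \<gamma>E: "\<gamma> i E = z" unfolding E_def by (rule \<gamma>\<iota>[OF zM])
      have esM: "e s i \<in> M" by (rule eM[OF sp(1) i])
      define N where "N = d (p i) E"
      define L where "L = d (p i) (e s i)"
      have "d (f i (\<rho> i 0)) z = s * \<theta> i"
        unfolding z_def using \<Gamma>_mdist[OF f i \<rho>M[of 0] \<rho>M[OF sp(2)]] geodesic_rayD(2)[OF \<rho>[OF i], of 0 "s * \<theta> i"] sp by simp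
      then have "s * \<theta> i \<le> K + d (\<gamma> i (p i)) z"
        using triangle[of "f i (\<rho> i 0)" "\<gamma> i (p i)" z] fM[OF \<rho>M[of 0]] \<gamma>M[OF pM] zM by (simp add: K_def commute)
      moreover have "d (\<gamma> i (p i)) z = N" using \<gamma>d[OF pM EM] by (simp add: \<gamma>E N_def)
      moreover have "T + D + K \<le> s * \<theta> i" using s \<theta>[OF i] by (simp add: s0_def pos_divide_le_eq)
      ultimately have N: "T + D \<le> N" by linarith
      have DE: "d E (e s i) \<le> D"
        using D[OF sp(1)] \<gamma>d[OF EM esM] by (simp add: \<gamma>E z_def commute)
      then have L: "T \<le> L" using N triangle[OF pM esM EM] by (simp add: N_def L_def commute)
      obtain k where k: "geodesic (X i) (p i) E k" using geodesic_exists[OF pM EM] by blast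
      have "geodesic (X i) (\<gamma> i (p i)) z (\<gamma> i \<circ> k)"
        using geodesic_isom[OF \<Gamma>_isom[OF \<gamma> i] k pM EM] by (simp add: \<gamma>E)
      then obtain u where u: "0 \<le> u" "u \<le> d (\<gamma> i (p i)) z" "d (\<gamma> i (k u)) (p i) \<le> R"
        using shadow[OF \<gamma>S i sp(2)] unfolding passes_near_def z_def by fastforce
      have uN: "u \<le> N" using u(2) \<open>d (\<gamma> i (p i)) z = N\<close> by simp
      have kuM: "k u \<in> M" using geodesicD(3)[OF k u(1)] uN by (simp add: N_def)
      define x where "x = \<iota> \<gamma> i (p i)"
      have xM: "x \<in> M" unfolding x_def by (rule \<iota>M[OF pM])
      have \<gamma>x: "\<gamma> i x = p i" unfolding x_def by (rule \<gamma>\<iota>[OF pM])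
      have kx: "d (k u) x \<le> R" using \<gamma>d[OF kuM xM] u(3) by (simp add: \<gamma>x)
      have "d (p i) x \<le> n" using \<gamma>d[OF pM xM] bd[OF \<gamma>S i] by (simp add: \<gamma>x commute)
      moreover have "d (p i) (k u) = u" using geodesicD(5)[OF k u(1)] uN by (simp add: N_def)
      ultimately have un: "u \<le> n + R" using triangle[OF pM xM kuM] kx by (simp add: commute)
      have uL: "u \<le> L" using un T L by linarith
      have \<kappa>M: "\<kappa> u \<in> M" using geodesicD(3)[OF \<kappa> u(1)] uL by (simp add: L_def)
      have ne: "p i \<noteq> E" "p i \<noteq> e s i" using N L T D0 pM by (auto simp: N_def L_def)
      have "(d (k u) (\<kappa> u))\<^sup>2 \<le> (u - u)\<^sup>2 + u * u / (d (p i) E * d (p i) (e s i)) *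
          ((d E (e s i))\<^sup>2 - (d (p i) E - d (p i) (e s i))\<^sup>2)"
        by (rule cat0_two_sides[OF k \<kappa>]) (use pM EM esM ne u uN uL in \<open>auto simp: N_def L_def\<close>)
      also have "\<dots> = u * u / (N * L) * ((d E (e s i))\<^sup>2 - (N - L)\<^sup>2)" by (simp add: N_def L_def)
      also have "\<dots> \<le> u * u / (N * L) * D\<^sup>2"
      proof (rule mult_left_mono)
        have "(d E (e s i))\<^sup>2 \<le> D\<^sup>2" using DE by (intro power_mono) auto
        then show "(d E (e s i))\<^sup>2 - (N - L)\<^sup>2 \<le> D\<^sup>2" by (smt (verit) zero_le_power2)
        show "0 \<le> u * u / (N * L)" using N L T D0 by auto
      qed
      also have "\<dots> = (u * D) * (u * D) / (N * L)" by (simp add: power2_eq_square)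
      also have "\<dots> \<le> 1"
      proof -
        have "u * D \<le> T" using un T(3) D0 mult_right_mono[OF un D0] by linarith
        then have "(u * D) * (u * D) \<le> N * L" using N L D0 u(1) T by (intro mult_mono) auto
        moreover have "0 < N * L" using N L T D0 by auto
        ultimately show ?thesis by (simp add: pos_divide_le_eq)
      qed
      finally have "(d (k u) (\<kappa> u))\<^sup>2 \<le> 1\<^sup>2" by simp
      then have "d (k u) (\<kappa> u) \<le> 1" by (rule power2_le_imp_le) simp
      then have "d (\<kappa> u) x \<le> R + 1" using triangle[OF \<kappa>M kuM xM] kx by (simp add: commute)
      then show ?thesis using u(1) un uL by (auto simp: L_def x_def)
    qed
    then show ?thesis by blast
  qed
  then obtain s0 where s0: "\<And>\<gamma> i s \<kappa>. \<gamma> \<in> S \<Longrightarrow> i < r \<Longrightarrow> s \<ge> s0 \<gamma> i \<Longrightarrow> geodesic (X i) (p i) (e s i) \<kappa> \<Longrightarrow>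
      \<exists>u\<in>{0..n + R}. u \<le> mdist (X i) (p i) (e s i) \<and> mdist (X i) (\<kappa> u) (\<iota> \<gamma> i (p i)) \<le> R + 1" by metis
  define s where "s = (\<Sum>\<gamma>\<in>S. \<Sum>i<r. \<bar>s0 \<gamma> i\<bar>)"
  have s: "s0 \<gamma> i \<le> s" "0 \<le> s" if "\<gamma> \<in> S" "i < r" for \<gamma> i
  proof -
    have "\<bar>s0 \<gamma> i\<bar> \<le> (\<Sum>i<r. \<bar>s0 \<gamma> i\<bar>)" using that by (intro member_le_sum) auto
    also have "\<dots> \<le> s" unfolding s_def using that S by (intro member_le_sum) (auto intro: sum_nonneg)
    finally show "s0 \<gamma> i \<le> s" "0 \<le> s" by auto
  qed
  have s_nn: "0 \<le> s" by (auto simp: s_def intro!: sum_nonneg)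
  have "\<exists>\<kappa>. geodesic (X i) (p i) (e s i) \<kappa>" if i: "i < r" for i
  proof -
    interpret proper_hadamard "X i" using factor[OF i] .
    show ?thesis by (rule geodesic_exists[OF p_mspace[OF i] eM[OF s_nn i]])
  qed
  then obtain \<kappa> where \<kappa>: "\<And>i. i < r \<Longrightarrow> geodesic (X i) (p i) (e s i) (\<kappa> i)" by metis
  have "\<exists>u. u \<in> {0..n + R} \<and> u \<le> mdist (X i) (p i) (e s i) \<and> mdist (X i) (\<kappa> i u) (\<iota> \<gamma> i (p i)) \<le> R + 1"
    if "\<gamma> \<in> S" "i < r" for \<gamma> i
    using s0[OF that s(1)[OF that] \<kappa>[OF that(2)]] by blast
  then obtain u where u: "\<And>\<gamma> i. \<gamma> \<in> S \<Longrightarrow> i < r \<Longrightarrow> u \<gamma> i \<in> {0..n + R} \<and>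
      u \<gamma> i \<le> mdist (X i) (p i) (e s i) \<and> mdist (X i) (\<kappa> i (u \<gamma> i)) (\<iota> \<gamma> i (p i)) \<le> R + 1" by metis
  define \<Phi> where "\<Phi> = (\<lambda>\<gamma>. \<lambda>i\<in>{..<r}. nat \<lfloor>u \<gamma> i\<rfloor>)"
  let ?W = "{\<gamma> \<in> \<Gamma>. \<forall>i<r. mdist (X i) (p i) (\<gamma> i (p i)) \<le> 2 * R + 3}"
  have "\<Phi> ` S \<subseteq> (\<Pi>\<^sub>E i\<in>{..<r}. {..nat \<lfloor>n + R\<rfloor>})"
  proof (rule image_subsetI, rule PiE_I)
    fix \<gamma> i assume "\<gamma> \<in> S" "i \<in> {..<r}"
    then show "\<Phi> \<gamma> i \<in> {..nat \<lfloor>n + R\<rfloor>}" using u[of \<gamma> i] by (auto simp: \<Phi>_def intro!: nat_mono floor_mono)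
  qed (simp add: \<Phi>_def)
  then have "card (\<Phi> ` S) \<le> card (\<Pi>\<^sub>E i\<in>{..<r}. {..nat \<lfloor>n + R\<rfloor>})" by (intro card_mono finite_PiE) auto
  also have "\<dots> = (nat \<lfloor>n + R\<rfloor> + 1) ^ r" by (simp add: card_PiE)
  finally have c\<Phi>: "card (\<Phi> ` S) \<le> (nat \<lfloor>n + R\<rfloor> + 1) ^ r" .
  have fib: "card {\<gamma> \<in> S. \<Phi> \<gamma> = y} \<le> card ?W" if "y \<in> \<Phi> ` S" for y
  proof -
    obtain \<alpha> where \<alpha>: "\<alpha> \<in> S" "\<Phi> \<alpha> = y" using \<open>y \<in> \<Phi> ` S\<close> by blast
    have \<alpha>\<Gamma>: "\<alpha> \<in> \<Gamma>" using \<alpha> S by blast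
    have "\<exists>\<epsilon>\<in>\<Gamma>. \<forall>i<r. \<forall>x\<in>mspace (X i). \<epsilon> i x = \<gamma> i (\<iota> \<alpha> i x)" if "\<gamma> \<in> S" for \<gamma>
      using \<Gamma>_mult[OF _ \<iota>(1)[OF \<alpha>\<Gamma>], of \<gamma>] that S by blast
    then obtain q where q: "\<And>\<gamma>. \<gamma> \<in> S \<Longrightarrow> q \<gamma> \<in> \<Gamma>"
      "\<And>\<gamma> i x. \<gamma> \<in> S \<Longrightarrow> i < r \<Longrightarrow> x \<in> mspace (X i) \<Longrightarrow> q \<gamma> i x = \<gamma> i (\<iota> \<alpha> i x)" by metis
    have inj: "inj_on q {\<gamma> \<in> S. \<Phi> \<gamma> = y}"
    proof (rule inj_onI)
      fix \<gamma> \<gamma>' assume g: "\<gamma> \<in> {\<gamma> \<in> S. \<Phi> \<gamma> = y}" "\<gamma>' \<in> {\<gamma> \<in> S. \<Phi> \<gamma> = y}" and eq: "q \<gamma> = q \<gamma>'"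
      show "\<gamma> = \<gamma>'"
      proof (rule \<Gamma>_ext)
        show "\<gamma> \<in> \<Gamma>" "\<gamma>' \<in> \<Gamma>" using g S by auto
        fix i x assume ix: "i < r" "x \<in> mspace (X i)"
        have "\<alpha> i x \<in> mspace (X i)" by (rule \<Gamma>_mspace[OF \<alpha>\<Gamma> ix])
        then have "q \<gamma> i (\<alpha> i x) = \<gamma> i (\<iota> \<alpha> i (\<alpha> i x))" "q \<gamma>' i (\<alpha> i x) = \<gamma>' i (\<iota> \<alpha> i (\<alpha> i x))"
          using q(2) g ix by auto
        then show "\<gamma> i x = \<gamma>' i x" using \<iota>(2)[OF \<alpha>\<Gamma> ix] eq by simp
      qed
    qed
    have "q ` {\<gamma> \<in> S. \<Phi> \<gamma> = y} \<subseteq> ?W"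
    proof (rule image_subsetI)
      fix \<gamma> assume "\<gamma> \<in> {\<gamma> \<in> S. \<Phi> \<gamma> = y}"
      then have \<gamma>: "\<gamma> \<in> S" "\<Phi> \<gamma> = y" by auto
      have \<gamma>\<Gamma>: "\<gamma> \<in> \<Gamma>" using \<gamma> S by blast
      have "mdist (X i) (p i) (q \<gamma> i (p i)) \<le> 2 * R + 3" if i: "i < r" for i
      proof -
        interpret proper_hadamard "X i" using factor[OF i] .
        note pM = p_mspace[OF i]
        define x where "x = \<iota> \<gamma> i (p i)"
        define x' where "x' = \<iota> \<alpha> i (p i)"
        have xM: "x \<in> M" "x' \<in> M"
          unfolding x_def x'_def using \<Gamma>_mspace[OF \<iota>(1)[OF \<gamma>\<Gamma>] i pM] \<Gamma>_mspace[OF \<iota>(1)[OF \<alpha>\<Gamma>] i pM] by auto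
        have "\<Phi> \<gamma> i = \<Phi> \<alpha> i" using \<gamma> \<alpha> by simp
        then have "nat \<lfloor>u \<gamma> i\<rfloor> = nat \<lfloor>u \<alpha> i\<rfloor>" using i by (simp add: \<Phi>_def)
        moreover have "0 \<le> u \<gamma> i" "0 \<le> u \<alpha> i" using u[OF \<gamma>(1) i] u[OF \<alpha>(1) i] by auto
        ultimately have "\<lfloor>u \<gamma> i\<rfloor> = \<lfloor>u \<alpha> i\<rfloor>" by (metis eq_nat_nat_iff zero_le_floor)
        then have uu: "\<bar>u \<gamma> i - u \<alpha> i\<bar> \<le> 1" by linarith
        have "d (\<kappa> i (u \<gamma> i)) (\<kappa> i (u \<alpha> i)) = \<bar>u \<gamma> i - u \<alpha> i\<bar>" "\<kappa> i (u \<gamma> i) \<in> M" "\<kappa> i (u \<alpha> i) \<in> M"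
          using geodesicD(3,4)[OF \<kappa>[OF i]] u[OF \<gamma>(1) i] u[OF \<alpha>(1) i] by auto
        then have "d x x' \<le> 2 * R + 3"
          using uu u[OF \<gamma>(1) i] u[OF \<alpha>(1) i] triangle[of x "\<kappa> i (u \<gamma> i)" x'] xM
            triangle[of "\<kappa> i (u \<gamma> i)" "\<kappa> i (u \<alpha> i)" x']
          by (simp add: x_def x'_def commute[of "\<iota> \<gamma> i (p i)" "\<kappa> i (u \<gamma> i)"])
        moreover have "d (\<gamma> i x) (\<gamma> i x') = d x x'" by (rule \<Gamma>_mdist[OF \<gamma>\<Gamma> i xM])
        moreover have "\<gamma> i x = p i" using \<iota>(2)[OF \<gamma>\<Gamma> i pM] by (simp add: x_def)
        moreover have "q \<gamma> i (p i) = \<gamma> i x'" using q(2)[OF \<gamma>(1) i pM] by (simp add: x'_def)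
        ultimately show ?thesis by simp
      qed
      then show "q \<gamma> \<in> ?W" using q(1)[OF \<gamma>(1)] by blast
    qed
    then show ?thesis by (rule card_inj_on_le[OF inj]) (rule finite_orbit_ball)
  qed
  have "card S \<le> card (\<Phi> ` S) * card ?W" by (rule card_le_fibres[OF S(1) fib])
  also have "\<dots> \<le> (nat \<lfloor>n + R\<rfloor> + 1) ^ r * card ?W" using c\<Phi> by (rule mult_right_mono) simp
  finally show ?thesis .
qed

end

section \<open>Atoms of an invariant density\<close>

lemma cone_nbhd_mem:
  assumes \<eta>: "\<eta> \<in> boundary Y" and c: "c \<in> \<eta>" and R: "0 < R" and \<epsilon>: "0 < \<epsilon>"
  shows "Inr \<eta> \<in> cone_nbhd Y c R \<epsilon>"
proof -
  have "c R \<in> mspace Y" using geodesic_rayD(1)[OF boundary_rep(1)[OF \<eta> c]] R by simp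
  then have "\<exists>g\<in>\<eta>. g 0 = c 0 \<and> mdist Y (g R) (c R) < \<epsilon>"
    using c \<epsilon> by (intro bexI[OF _ c]) (simp add: mdist_self)
  then show ?thesis unfolding cone_nbhd_def using \<eta> by blast
qed

lemma topspace_boundary_topology: "topspace (boundary_topology Y) = boundary Y"
proof -
  have "Inr \<eta> \<in> topspace (cone_topology Y)" if \<eta>: "\<eta> \<in> boundary Y" for \<eta>
  proof -
    obtain c where c: "c \<in> \<eta>" using boundary_nonempty[OF \<eta>] by blast
    have ray: "geodesic_ray Y c" by (rule boundary_rep(1)[OF \<eta> c])
    have "Inr \<eta> \<in> cone_nbhd Y c 1 1" by (rule cone_nbhd_mem[OF \<eta> c]) auto
    moreover have "cone_nbhd Y c 1 1 \<in> {cone_nbhd Y c R \<epsilon> | c R \<epsilon>. geodesic_ray Y c \<and> R > 0 \<and> \<epsilon> > 0}"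
      using ray by (intro CollectI exI[of _ c] exI[of _ 1]) auto
    ultimately show ?thesis unfolding cone_topology_def topology_generated_by_topspace by blast
  qed
  then show ?thesis unfolding boundary_topology_def topspace_pullback_topology by auto
qed

locale rank_one_density = rank_one_action +
  fixes b \<theta> :: "nat \<Rightarrow> real" and \<mu> :: "(nat \<Rightarrow> 'a) \<Rightarrow> (real \<Rightarrow> nat \<Rightarrow> 'a) set measure"
  assumes \<theta>: "\<theta> \<in> regular_slopes r"
    and density: "invariant_density r X \<Gamma> p b \<theta> \<mu>"
begin

lemma density_facts:
  assumes "x \<in> mspace P"
  shows "finite_measure (\<mu> x)" "space (\<mu> x) = boundary P" "sets (\<mu> x) = sets (boundary_borel P)"
    "measure_support (boundary_topology P) (\<mu> x) \<subseteq> boundary_slope r X \<theta>"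
    "\<gamma> \<in> \<Gamma> \<Longrightarrow> A \<in> sets (\<mu> x) \<Longrightarrow>
      emeasure (\<mu> (act \<gamma> x)) A = emeasure (\<mu> x) (boundary_map P (act \<gamma>) -` A \<inter> boundary P)"
    "absolutely_continuous (\<mu> p) (\<mu> x)"
    "AE \<eta> in \<mu> p. \<eta> \<in> measure_support (boundary_topology P) (\<mu> p) \<longrightarrow>
      RN_deriv (\<mu> p) (\<mu> x) \<eta> =
        ennreal (exp (\<Sum>i<r. b i * busemann (X i) (boundary_proj X \<theta> \<eta> i) (p i) (x i)))"
  using density[unfolded invariant_density_def slope_support_regular[OF \<theta>], THEN conjunct2, THEN conjunct2,
      THEN bspec, OF assms] by blast+

sublocale \<mu>: finite_measure "\<mu> p" by (rule density_facts(1)[OF p])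

definition mass :: "(real \<Rightarrow> nat \<Rightarrow> 'a) set \<Rightarrow> real" where "mass \<eta> = measure (\<mu> p) {\<eta>}"

text \<open>This is the logarithm of the density of \<open>\<mu> x\<close> with respect to \<open>\<mu> p\<close> at \<open>\<eta>\<close>.\<close>

definition weight :: "(real \<Rightarrow> nat \<Rightarrow> 'a) set \<Rightarrow> (nat \<Rightarrow> 'a) \<Rightarrow> real" where
  "weight \<eta> x = (\<Sum>i<r. b i * busemann (X i) (boundary_proj X \<theta> \<eta> i) (p i) (x i))"

lemma atom_sets: "0 < mass \<eta> \<Longrightarrow> {\<eta>} \<in> sets (\<mu> p)"
  unfolding mass_def using measure_notin_sets by fastforce

lemma atom_boundary: "0 < mass \<eta> \<Longrightarrow> \<eta> \<in> boundary P"
  using sets.sets_into_space[OF atom_sets] density_facts(2)[OF p] by blast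

lemma openin_boundary_sets:
  assumes "openin (boundary_topology P) U"
  shows "U \<in> sets (\<mu> p)"
proof -
  have "{U. openin (boundary_topology P) U} \<subseteq> Pow (boundary P)"
    using openin_subset topspace_boundary_topology by blast
  then have "U \<in> sets (boundary_borel P)"
    unfolding boundary_borel_def by (rule in_measure_of) (use assms in simp)
  then show ?thesis by (simp add: density_facts(3)[OF p])
qed

lemma atom_support:
  assumes "0 < mass \<eta>"
  shows "\<eta> \<in> measure_support (boundary_topology P) (\<mu> p)"
proof -
  have "0 < emeasure (\<mu> p) U" if U: "openin (boundary_topology P) U" "\<eta> \<in> U" for U
  proof -
    have "0 < emeasure (\<mu> p) {\<eta>}" using assms by (simp add: mass_def \<mu>.emeasure_eq_measure)
    also have "\<dots> \<le> emeasure (\<mu> p) U" using U by (intro emeasure_mono openin_boundary_sets) auto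
    finally show ?thesis .
  qed
  then show ?thesis using atom_boundary[OF assms] by (simp add: measure_support_def topspace_boundary_topology)
qed

lemma atom_slope: "0 < mass \<eta> \<Longrightarrow> \<eta> \<in> boundary_slope r X \<theta>"
  using atom_support density_facts(4)[OF p] by blast

text \<open>The formula for the Radon--Nikodym derivative holds almost everywhere, hence at every atom.\<close>

lemma density_at_atom:
  assumes \<eta>: "0 < mass \<eta>" and x: "x \<in> mspace P"
  shows "emeasure (\<mu> x) {\<eta>} = ennreal (exp (weight \<eta> x)) * emeasure (\<mu> p) {\<eta>}"
proof -
  note sing = atom_sets[OF \<eta>]
  have rn: "RN_deriv (\<mu> p) (\<mu> x) \<eta> = ennreal (exp (weight \<eta> x))"
  proof (rule ccontr)
    assume neq: "\<not> ?thesis"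
    obtain N where N: "{\<eta> \<in> space (\<mu> p). \<not> (\<eta> \<in> measure_support (boundary_topology P) (\<mu> p) \<longrightarrow>
      RN_deriv (\<mu> p) (\<mu> x) \<eta> =
        ennreal (exp (\<Sum>i<r. b i * busemann (X i) (boundary_proj X \<theta> \<eta> i) (p i) (x i))))} \<subseteq> N"
      "emeasure (\<mu> p) N = 0" "N \<in> sets (\<mu> p)"
      using AE_E[OF density_facts(7)[OF x]] by blast
    have "\<eta> \<in> N" using N(1) neq atom_support[OF \<eta>] atom_boundary[OF \<eta>] density_facts(2)[OF p]
      unfolding weight_def by blast
    then have "emeasure (\<mu> p) {\<eta>} \<le> emeasure (\<mu> p) N" using N(3) by (intro emeasure_mono) auto
    then show False using \<eta> N(2) by (simp add: mass_def \<mu>.emeasure_eq_measure)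
  qed
  have "density (\<mu> p) (RN_deriv (\<mu> p) (\<mu> x)) = \<mu> x"
    using density_facts(6)[OF x] density_facts(3)[OF x] density_facts(3)[OF p] by (intro \<mu>.density_RN_deriv) auto
  then have "emeasure (\<mu> x) {\<eta>} = emeasure (density (\<mu> p) (RN_deriv (\<mu> p) (\<mu> x))) {\<eta>}" by simp
  also have "\<dots> = (\<integral>\<^sup>+ \<xi>. RN_deriv (\<mu> p) (\<mu> x) \<xi> * indicator {\<eta>} \<xi> \<partial>\<mu> p)"
    by (rule emeasure_density[OF borel_measurable_RN_deriv sing])
  also have "\<dots> = RN_deriv (\<mu> p) (\<mu> x) \<eta> * emeasure (\<mu> p) {\<eta>}"
    using sing by (intro nn_integral_indicator_singleton) auto
  finally show ?thesis by (simp add: rn)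
qed

text \<open>By invariance, the preimage of \<open>\<eta>\<close> has the mass that \<open>\<mu> (act \<gamma> p)\<close> gives to \<open>\<eta>\<close>. As this is positive, the
preimage is nonempty, and it is a singleton because \<open>\<gamma>\<close> acts injectively on the boundary.\<close>

lemma atom_preimage:
  assumes \<eta>: "0 < mass \<eta>" and \<gamma>: "\<gamma> \<in> \<Gamma>"
  shows "\<exists>\<zeta>\<in>boundary P. boundary_map P (act \<gamma>) \<zeta> = \<eta> \<and> mass \<zeta> = exp (weight \<eta> (act \<gamma> p)) * mass \<eta>"
proof -
  let ?A = "boundary_map P (act \<gamma>) -` {\<eta>} \<inter> boundary P"
  have eq: "emeasure (\<mu> p) ?A = ennreal (exp (weight \<eta> (act \<gamma> p))) * emeasure (\<mu> p) {\<eta>}"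
    using density_facts(5)[OF p \<gamma> atom_sets[OF \<eta>]] density_at_atom[OF \<eta> act_mspace[OF \<gamma> p]] by simp
  also have "\<dots> > 0" using \<eta> by (simp add: mass_def \<mu>.emeasure_eq_measure ennreal_mult[symmetric])
  finally have "?A \<noteq> {}" by force
  then obtain \<zeta> where \<zeta>: "\<zeta> \<in> boundary P" "boundary_map P (act \<gamma>) \<zeta> = \<eta>" by blast
  have "\<zeta>' = \<zeta>" if "\<zeta>' \<in> ?A" for \<zeta>'
    by (rule boundary_map_inj[OF act_isom[OF \<gamma>]]) (use that \<zeta> in auto)
  then have "?A = {\<zeta>}" using \<zeta> by blast
  then have "emeasure (\<mu> p) {\<zeta>} = ennreal (exp (weight \<eta> (act \<gamma> p))) * emeasure (\<mu> p) {\<eta>}" using eq by simp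
  then have "ennreal (mass \<zeta>) = ennreal (exp (weight \<eta> (act \<gamma> p)) * mass \<eta>)"
    using \<eta> by (simp add: mass_def \<mu>.emeasure_eq_measure ennreal_mult)
  then have "mass \<zeta> = exp (weight \<eta> (act \<gamma> p)) * mass \<eta>" using \<eta> by (simp add: mass_def)
  then show ?thesis using \<zeta> by blast
qed

text \<open>This is \<open>atom_preimage\<close> for the inverse of \<open>f\<close>.\<close>

lemma atom_image:
  assumes \<eta>: "0 < mass \<eta>" and f: "f \<in> \<Gamma>" and c: "c \<in> \<eta>"
  shows "\<exists>\<zeta>\<in>boundary P. act f \<circ> c \<in> \<zeta> \<and> 0 < mass \<zeta>"
proof -
  obtain \<epsilon> where \<epsilon>: "\<epsilon> \<in> \<Gamma>" "\<And>i x. i < r \<Longrightarrow> x \<in> mspace (X i) \<Longrightarrow> \<epsilon> i (f i x) = x \<and> f i (\<epsilon> i x) = x"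
    using \<Gamma>_inv[OF f] by blast
  obtain \<zeta> where \<zeta>: "\<zeta> \<in> boundary P" "boundary_map P (act \<epsilon>) \<zeta> = \<eta>"
    "mass \<zeta> = exp (weight \<eta> (act \<epsilon> p)) * mass \<eta>"
    using atom_preimage[OF \<eta> \<epsilon>(1)] by blast
  obtain e where e: "e \<in> \<zeta>" using boundary_nonempty[OF \<zeta>(1)] by blast
  note ray = boundary_rep(1)[OF \<zeta>(1) e]
  note cray = boundary_rep(1)[OF atom_boundary[OF \<eta>] c]
  have "act \<epsilon> \<circ> e \<in> \<eta>" using boundary_map_mem[OF act_isom[OF \<epsilon>(1)] \<zeta>(1) e] \<zeta>(2) by simp
  then have as: "asymptotic P (act \<epsilon> \<circ> e) c" by (rule boundary_asymptotic[OF atom_boundary[OF \<eta>] _ c])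
  have M: "(act \<epsilon> \<circ> e) t \<in> mspace P" "c t \<in> mspace P" "e t \<in> mspace P" if "t \<ge> 0" for t
    using act_mspace[OF \<epsilon>(1) geodesic_rayD(1)[OF ray that]] geodesic_rayD(1)[OF cray that]
      geodesic_rayD(1)[OF ray that] by auto
  have "asymptotic P (act f \<circ> (act \<epsilon> \<circ> e)) (act f \<circ> c) \<longleftrightarrow> asymptotic P (act \<epsilon> \<circ> e) c"
    by (rule asymptotic_isom[OF act_isom[OF f] M(1,2)])
  then obtain C where C: "\<And>t. t \<ge> 0 \<Longrightarrow> mdist P (act f (act \<epsilon> (e t))) (act f (c t)) \<le> C"
    using as by (auto simp only: asymptotic_def comp_apply)
  have "act f (act \<epsilon> (e t)) = e t" if t: "t \<ge> 0" for t
  proof (rule product_mspace_ext)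
    show "act f (act \<epsilon> (e t)) \<in> mspace P" using act_mspace[OF f] M(1)[OF t] by simp
    show "e t \<in> mspace P" by (rule M(3)[OF t])
    fix i assume i: "i < r"
    show "act f (act \<epsilon> (e t)) i = e t i"
      using act_apply[OF M(1)[OF t, simplified comp_apply] i] act_apply[OF M(3)[OF t] i]
        \<epsilon>(2)[OF i product_mspaceD[OF M(3)[OF t] i]] by simp
  qed
  then have "asymptotic P e (act f \<circ> c)" unfolding asymptotic_def using C by (intro exI[of _ C]) auto
  then have "act f \<circ> c \<in> \<zeta>"
    by (rule boundary_memI[OF \<zeta>(1) e geodesic_ray_isom[OF act_isom[OF f] cray]])
  moreover have "0 < mass \<zeta>" using \<zeta>(3) \<eta> by simp
  ultimately show ?thesis using \<zeta>(1) by blast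
qed

lemma card_atoms_le:
  assumes "finite Z" "\<And>\<zeta>. \<zeta> \<in> Z \<Longrightarrow> w \<le> mass \<zeta>" "0 < w"
  shows "real (card Z) * w \<le> measure (\<mu> p) (space (\<mu> p))"
proof -
  have "real (card Z) * w = (\<Sum>\<zeta>\<in>Z. w)" by simp
  also have "\<dots> \<le> (\<Sum>\<zeta>\<in>Z. measure (\<mu> p) {\<zeta>})" using assms(2) by (intro sum_mono) (auto simp: mass_def)
  also have "\<dots> = measure (\<mu> p) Z"
    using assms atom_sets by (intro \<mu>.finite_measure_eq_sum_singleton[symmetric]) (auto dest: order_less_le_trans)
  also have "\<dots> \<le> measure (\<mu> p) (space (\<mu> p))" by (rule \<mu>.bounded_measure)
  finally show ?thesis .
qed

end

section \<open>Subexponential growth from an atom\<close>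

lemma ln_count_mono: "k \<le> l \<Longrightarrow> ln_count k \<le> ln_count l"
  by (auto simp: ln_count_def)

context rank_one_action
begin

definition slope_orbit :: "(nat \<Rightarrow> real) \<Rightarrow> real \<Rightarrow> nat \<Rightarrow> (nat \<Rightarrow> 'a \<Rightarrow> 'a) set" where
  "slope_orbit \<theta> \<epsilon> n = {\<gamma> \<in> \<Gamma>. 0 < mdist P p (act \<gamma> p) \<and> mdist P p (act \<gamma> p) < real n \<and>
     (\<forall>i<r. \<bar>mdist (X i) (p i) (\<gamma> i (p i)) / mdist P p (act \<gamma> p) - \<theta> i\<bar> < \<epsilon>)}"

lemma orbit_count_eq: "orbit_count r X \<Gamma> p \<theta> \<epsilon> n = card (slope_orbit \<theta> \<epsilon> n)"
  by (simp add: orbit_count_def slope_orbit_def)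

lemma orbit_component_le:
  assumes "i < r"
  shows "mdist (X i) (p i) (\<gamma> i (p i)) \<le> mdist P p (act \<gamma> p)"
  using mdist_component_le[OF assms, of X p "act \<gamma> p"] act_apply[OF p assms] by simp

lemma slope_orbit_component:
  assumes "\<gamma> \<in> slope_orbit \<theta> \<epsilon> n" "i < r"
  shows "mdist (X i) (p i) (\<gamma> i (p i)) \<le> real n"
  using orbit_component_le[OF assms(2), of \<gamma>] assms(1) unfolding slope_orbit_def by force

lemma finite_slope_orbit: "finite (slope_orbit \<theta> \<epsilon> n)"
proof (rule finite_subset[OF _ finite_orbit_ball])
  show "slope_orbit \<theta> \<epsilon> n \<subseteq> {\<gamma> \<in> \<Gamma>. \<forall>i<r. mdist (X i) (p i) (\<gamma> i (p i)) \<le> real n}"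
    using slope_orbit_component by (auto simp: slope_orbit_def)
qed

lemma orbit_count_mono:
  assumes "\<epsilon> \<le> \<epsilon>'"
  shows "orbit_count r X \<Gamma> p \<theta> \<epsilon> n \<le> orbit_count r X \<Gamma> p \<theta> \<epsilon>' n"
  unfolding orbit_count_eq
proof (rule card_mono[OF finite_slope_orbit])
  show "slope_orbit \<theta> \<epsilon> n \<subseteq> slope_orbit \<theta> \<epsilon>' n"
    using assms by (auto simp: slope_orbit_def intro: order_less_le_trans)
qed

text \<open>The exponent for fixed \<open>\<epsilon>\<close> is at most \<open>\<epsilon> * B\<close>, and it is monotone in \<open>\<epsilon>\<close>, so its limit for \<open>\<epsilon> \<rightarrow> 0\<close> exists and is
the infimum.\<close>

lemma growth_exponent_le_0:
  fixes A B :: real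
  assumes A: "0 < A" and count: "\<And>\<epsilon> n. 0 < \<epsilon> \<Longrightarrow> 1 \<le> n \<Longrightarrow>
    real (orbit_count r X \<Gamma> p \<theta> \<epsilon> n) \<le> A * real n ^ r * exp (\<epsilon> * B * real n)"
  shows "growth_exponent r X \<Gamma> p \<theta> \<le> 0"
proof -
  define G where "G = (\<lambda>\<epsilon>. limsup (\<lambda>n. ln_count (orbit_count r X \<Gamma> p \<theta> \<epsilon> n) / ereal (real n)))"
  have G_le: "G \<epsilon> \<le> ereal (\<epsilon> * B)" if \<epsilon>: "0 < \<epsilon>" for \<epsilon>
  proof -
    define u where "u = (\<lambda>n :: nat. ln A / real n + real r * (ln (real n) / real n) + \<epsilon> * B)"
    have ulim: "u \<longlonglongrightarrow> 0 + real r * 0 + \<epsilon> * B"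
      unfolding u_def by (intro tendsto_intros lim_ln_over_n lim_const_over_n)
    have "ln_count (orbit_count r X \<Gamma> p \<theta> \<epsilon> n) / ereal (real n) \<le> ereal (u n)" if n: "1 \<le> n" for n
    proof (cases "orbit_count r X \<Gamma> p \<theta> \<epsilon> n = 0")
      case True
      then show ?thesis using n by (simp add: ln_count_def)
    next
      case False
      let ?k = "orbit_count r X \<Gamma> p \<theta> \<epsilon> n"
      have "ln (real ?k) \<le> ln (A * real n ^ r * exp (\<epsilon> * B * real n))"
        using count[OF \<epsilon> n] False by (subst ln_le_cancel_iff) (use A n in auto)
      also have "\<dots> = ln A + real r * ln (real n) + \<epsilon> * B * real n"
        using A n by (simp add: ln_mult ln_realpow)
      finally have "ln (real ?k) / real n \<le> (ln A + real r * ln (real n) + \<epsilon> * B * real n) / real n"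
        by (rule divide_right_mono) simp
      also have "\<dots> = u n" using n by (simp add: u_def add_divide_distrib)
      finally show ?thesis using False n by (simp add: ln_count_def)
    qed
    then have "G \<epsilon> \<le> limsup (\<lambda>n. ereal (u n))"
      unfolding G_def by (intro Limsup_mono) (auto simp: eventually_sequentially)
    also have "limsup (\<lambda>n. ereal (u n)) = ereal (\<epsilon> * B)"
      using ulim by (intro lim_imp_Limsup) auto
    finally show ?thesis .
  qed
  have G_mono: "G \<epsilon> \<le> G \<epsilon>'" if "\<epsilon> \<le> \<epsilon>'" for \<epsilon> \<epsilon>'
    unfolding G_def
  proof (rule Limsup_mono)
    show "\<forall>\<^sub>F n in sequentially. ln_count (orbit_count r X \<Gamma> p \<theta> \<epsilon> n) / ereal (real n)
        \<le> ln_count (orbit_count r X \<Gamma> p \<theta> \<epsilon>' n) / ereal (real n)"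
      using eventually_gt_at_top[of 0]
    proof eventually_elim
      case (elim n)
      then show ?case by (intro ereal_divide_right_mono ln_count_mono orbit_count_mono that) auto
    qed
  qed
  define L where "L = (INF \<epsilon>\<in>{0<..}. G \<epsilon>)"
  have "(G \<longlongrightarrow> L) (at_right 0)"
  proof (rule decreasing_tendsto)
    show "\<forall>\<^sub>F \<epsilon> in at_right 0. L \<le> G \<epsilon>"
      using eventually_at_right_less[of "0 :: real"]
    proof eventually_elim
      case (elim \<epsilon>)
      then show ?case unfolding L_def by (intro INF_lower) simp
    qed
    fix x assume "L < x"
    then obtain \<epsilon>0 where \<epsilon>0: "0 < \<epsilon>0" "G \<epsilon>0 < x" unfolding L_def INF_less_iff by auto
    show "\<forall>\<^sub>F \<epsilon> in at_right 0. G \<epsilon> < x"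
      using eventually_at_right_real[OF \<epsilon>0(1)]
    proof eventually_elim
      case (elim \<epsilon>)
      then have "G \<epsilon> \<le> G \<epsilon>0" by (intro G_mono) auto
      then show ?case using \<epsilon>0(2) by (rule order_le_less_trans)
    qed
  qed
  then have gL: "growth_exponent r X \<Gamma> p \<theta> = L"
    unfolding growth_exponent_def G_def by (intro tendsto_Lim) auto
  have "L \<le> 0"
  proof (rule ccontr)
    assume "\<not> L \<le> 0"
    then have "0 < L" by simp
    then obtain x where x: "0 < ereal x" "ereal x < L" using ereal_dense2 by blast
    have "L \<le> ereal (x / (\<bar>B\<bar> + 1) * B)"
    proof -
      have pos: "0 < x / (\<bar>B\<bar> + 1)" using x by simp
      have "L \<le> G (x / (\<bar>B\<bar> + 1))" unfolding L_def using pos by (intro INF_lower) auto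
      also have "\<dots> \<le> ereal (x / (\<bar>B\<bar> + 1) * B)" by (rule G_le[OF pos])
      finally show ?thesis .
    qed
    also have "x / (\<bar>B\<bar> + 1) * B \<le> x"
    proof -
      have "x * B \<le> x * (\<bar>B\<bar> + 1)" using x by (intro mult_left_mono) auto
      then show ?thesis by (simp add: pos_divide_le_eq)
    qed
    finally show False using x by simp
  qed
  then show ?thesis by (simp add: gL)
qed

end

context rank_one_density
begin

lemma busemann_along_atom:
  assumes \<eta>: "0 < mass \<eta>" and e: "e \<in> \<eta>" and i: "i < r"
  shows "\<exists>D\<ge>0. busemann_along (X i) (boundary_proj X \<theta> \<eta> i) (\<lambda>t. e (t / \<theta> i) i) D"
proof (rule busemann_approx)
  note sl = atom_slope[OF \<eta>]
  show "boundary_proj X \<theta> \<eta> i \<in> boundary (X i)" by (rule boundary_proj_approx(1)[OF sl \<theta> e i])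
  show "e (t / \<theta> i) i \<in> mspace (X i)" if "t \<ge> 0" for t
    using product_ray_component[OF boundary_rep(1)[OF atom_boundary[OF \<eta>] e] _ i] that
      regular_slopeD[OF \<theta> i] by simp
  show "\<exists>D. \<forall>t\<ge>0. mdist (X i) (c t) (e (t / \<theta> i) i) \<le> D" if "c \<in> boundary_proj X \<theta> \<eta> i" for c
    by (rule boundary_proj_approx(2)[OF sl \<theta> e i that])
qed

lemma weight_lower_bound:
  assumes "\<And>i. i < r \<Longrightarrow> \<bar>busemann (X i) (boundary_proj X \<theta> \<eta> i) (p i) (x i) - w i\<bar> \<le> E"
  shows "(\<Sum>i<r. b i * w i) - (\<Sum>i<r. \<bar>b i\<bar>) * E \<le> weight \<eta> x"
proof -
  have "b i * w i - \<bar>b i\<bar> * E \<le> b i * busemann (X i) (boundary_proj X \<theta> \<eta> i) (p i) (x i)" if "i < r" for i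
  proof -
    have "\<bar>b i * (busemann (X i) (boundary_proj X \<theta> \<eta> i) (p i) (x i) - w i)\<bar> \<le> \<bar>b i\<bar> * E"
      unfolding abs_mult by (rule mult_left_mono[OF assms[OF that]]) simp
    then show ?thesis by (simp add: abs_le_iff right_diff_distrib)
  qed
  then have "(\<Sum>i<r. b i * w i - \<bar>b i\<bar> * E) \<le> weight \<eta> x" unfolding weight_def by (intro sum_mono) auto
  then show ?thesis by (simp add: sum_subtractf sum_distrib_right)
qed

text \<open>Every \<open>\<gamma>\<close> in the orbit count is mapped to the pair of the element \<open>sel \<gamma> \<in> F\<close> provided by \<open>finite_shadow\<close> and the atom
\<open>Z \<gamma> = \<gamma>\<inverse> (sel \<gamma>) \<eta>\<close>. Since \<open>\<Sum>i. b i * \<theta> i \<le> 0\<close>, these atoms have mass at least \<open>exp (- \<epsilon> * \<beta> * n)\<close> up to a constant, where \<open>\<beta>\<close>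
bounds the effect of the deviation \<open>\<epsilon>\<close> from the slope \<open>\<theta>\<close>. Finiteness of \<open>\<mu> p\<close> bounds their number, and
\<open>coset_multiplicity\<close> bounds the fibres.\<close>

lemma growth_exponent_of_atom:
  assumes \<eta>: "0 < mass \<eta>" and neg: "(\<Sum>i<r. b i * \<theta> i) \<le> 0"
  shows "growth_exponent r X \<Gamma> p \<theta> \<le> 0"
proof -
  obtain c \<rho> where c: "c \<in> \<eta>" and \<rho>: "\<And>i. i < r \<Longrightarrow> geodesic_ray (X i) (\<rho> i)"
    and c\<rho>: "\<And>t i. t \<ge> 0 \<Longrightarrow> i < r \<Longrightarrow> c t i = \<rho> i (t * \<theta> i)"
    using boundary_slopeE[OF atom_slope[OF \<eta>] \<theta>] by metis
  have \<theta>pos: "0 < \<theta> i" if "i < r" for i by (rule regular_slopeD[OF \<theta> that])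
  have cM: "c s \<in> mspace P" if "s \<ge> 0" for s
    using geodesic_rayD(1)[OF boundary_rep(1)[OF atom_boundary[OF \<eta>] c] that] .
  obtain F R where F: "finite F" "F \<subseteq> \<Gamma>" "F \<noteq> {}" and R: "0 \<le> R"
    and sh: "\<forall>y\<in>mspace P. \<exists>f\<in>F. \<forall>i<r. \<forall>s\<ge>0. passes_near (X i) (y i) (f i (\<rho> i s)) (p i) R"
    using finite_shadow[of \<rho>, OF \<rho>] by blast
  have "\<exists>\<zeta>. \<zeta> \<in> boundary P \<and> act f \<circ> c \<in> \<zeta> \<and> 0 < mass \<zeta>" if "f \<in> F" for f
  proof -
    have "f \<in> \<Gamma>" using F that by blast
    from atom_image[OF \<eta> this c] show ?thesis by (simp only: Bex_def)
  qed
  then obtain \<zeta>F where \<zeta>F: "\<And>f. f \<in> F \<Longrightarrow> \<zeta>F f \<in> boundary P" "\<And>f. f \<in> F \<Longrightarrow> act f \<circ> c \<in> \<zeta>F f"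
    "\<And>f. f \<in> F \<Longrightarrow> 0 < mass (\<zeta>F f)" by metis
  have "\<exists>D\<ge>0. busemann_along (X i) (boundary_proj X \<theta> (\<zeta>F f) i) (\<lambda>t. (act f \<circ> c) (t / \<theta> i) i) D"
    if "f \<in> F" "i < r" for f i
    by (rule busemann_along_atom[OF \<zeta>F(3)[OF that(1)] \<zeta>F(2)[OF that(1)] that(2)])
  then obtain D where D0: "\<And>f i. f \<in> F \<Longrightarrow> i < r \<Longrightarrow> 0 \<le> D f i"
    and D: "\<And>f i. f \<in> F \<Longrightarrow> i < r \<Longrightarrow>
      busemann_along (X i) (boundary_proj X \<theta> (\<zeta>F f) i) (\<lambda>t. (act f \<circ> c) (t / \<theta> i) i) (D f i)" by metis
  define E where "E = 2 * R + (\<Sum>f\<in>F. \<Sum>i<r. D f i)"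
  have DE: "D f i \<le> (\<Sum>f\<in>F. \<Sum>i<r. D f i)" if "f \<in> F" "i < r" for f i
  proof -
    have "D f i \<le> (\<Sum>i<r. D f i)" using that D0 by (intro member_le_sum) auto
    also have "\<dots> \<le> (\<Sum>f\<in>F. \<Sum>i<r. D f i)" using that D0 F by (intro member_le_sum) (auto intro: sum_nonneg)
    finally show ?thesis .
  qed
  define good where
    "good = (\<lambda>\<gamma> f. \<forall>i<r. \<forall>s\<ge>0. passes_near (X i) (\<gamma> i (p i)) (f i (\<rho> i s)) (p i) R)"
  have "\<exists>f\<in>F. good \<gamma> f" if "\<gamma> \<in> \<Gamma>" for \<gamma>
    using bspec[OF sh act_mspace[OF that p]] unfolding good_def by (simp add: act_apply[OF p])
  then obtain sel where sel: "\<And>\<gamma>. \<gamma> \<in> \<Gamma> \<Longrightarrow> sel \<gamma> \<in> F" "\<And>\<gamma>. \<gamma> \<in> \<Gamma> \<Longrightarrow> good \<gamma> (sel \<gamma>)" by metis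
  have bus: "\<bar>busemann (X i) (boundary_proj X \<theta> (\<zeta>F (sel \<gamma>)) i) (p i) (act \<gamma> p i)
      - (- mdist (X i) (p i) (\<gamma> i (p i)))\<bar> \<le> E" if \<gamma>: "\<gamma> \<in> \<Gamma>" and i: "i < r" for \<gamma> i
  proof -
    interpret proper_hadamard "X i" using factor[OF i] .
    define f where "f = sel \<gamma>"
    define y where "y = \<gamma> i (p i)"
    have fF: "f \<in> F" and f\<Gamma>: "f \<in> \<Gamma>" using sel(1)[OF \<gamma>] F by (auto simp: f_def)
    note pM = p_mspace[OF i]
    have yM: "y \<in> M" unfolding y_def by (rule \<Gamma>_mspace[OF \<gamma> i pM])
    have zM: "(act f \<circ> c) s i \<in> M" if "s \<ge> 0" for s
      using product_mspaceD[OF act_mspace[OF f\<Gamma> cM[OF that]] i] by simp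
    have lower: "- d (p i) y \<le> d (p i) ((act f \<circ> c) s i) - d y ((act f \<circ> c) s i)" if s: "0 \<le> s" for s
      using triangle[OF yM pM zM[OF s]] by (simp add: commute)
    have upper: "d (p i) ((act f \<circ> c) s i) - d y ((act f \<circ> c) s i) \<le> - d (p i) y + 2 * R" if s: "0 \<le> s" for s
    proof -
      define z where "z = (act f \<circ> c) s i"
      have zz: "z = f i (\<rho> i (s * \<theta> i))"
        using act_apply[OF cM[OF s] i, of f] c\<rho>[OF s i] by (simp add: z_def)
      have zM': "z \<in> M" unfolding z_def by (rule zM[OF s])
      obtain e where e: "geodesic (X i) y z e" using geodesic_exists[OF yM zM'] by blast
      have "0 \<le> s * \<theta> i" using s \<theta>pos[OF i] by simp
      then have "passes_near (X i) y z (p i) R"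
        using sel(2)[OF \<gamma>] i unfolding good_def f_def[symmetric] y_def zz by blast
      then obtain u where u: "0 \<le> u" "u \<le> d y z" "d (e u) (p i) \<le> R"
        using e unfolding passes_near_def by (meson atLeastAtMost_iff)
      have eM: "e u \<in> M" by (rule geodesicD(3)[OF e u(1,2)])
      have "d y (e u) + d (e u) z = d y z" using geodesicD(5,6)[OF e u(1,2)] by simp
      then show ?thesis
        using u(3) triangle[OF yM eM pM] triangle[OF pM eM zM'] by (simp add: commute z_def)
    qed
    have t\<theta>: "0 \<le> t / \<theta> i" if "0 \<le> t" for t using that \<theta>pos[OF i] by simp
    have ay: "act \<gamma> p i = y" using act_apply[OF p i] by (simp add: y_def)
    note B = busemann_alongD[OF D[OF fF i] pM yM, of 0, OF lower[OF t\<theta>] upper[OF t\<theta>]]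
    have "busemann (X i) (boundary_proj X \<theta> (\<zeta>F f) i) (p i) y \<le> - d (p i) y + 2 * R + D f i"
      by (rule B(2))
    moreover have "- d (p i) y - D f i \<le> busemann (X i) (boundary_proj X \<theta> (\<zeta>F f) i) (p i) y"
      by (rule B(1))
    ultimately show ?thesis
      unfolding ay f_def[symmetric] y_def[symmetric] E_def using DE[OF fF i] R by linarith
  qed
  define \<beta> where "\<beta> = (\<Sum>i<r. \<bar>b i\<bar>)"
  have \<beta>0: "0 \<le> \<beta>" by (simp add: \<beta>_def sum_nonneg)
  have "\<exists>\<zeta>\<in>boundary P. boundary_map P (act \<gamma>) \<zeta> = \<zeta>F (sel \<gamma>) \<and>
      mass \<zeta> = exp (weight (\<zeta>F (sel \<gamma>)) (act \<gamma> p)) * mass (\<zeta>F (sel \<gamma>))" if "\<gamma> \<in> \<Gamma>" for \<gamma>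
    by (rule atom_preimage[OF \<zeta>F(3)[OF sel(1)[OF that]] that])
  then obtain Z where Z: "\<And>\<gamma>. \<gamma> \<in> \<Gamma> \<Longrightarrow> Z \<gamma> \<in> boundary P"
    "\<And>\<gamma>. \<gamma> \<in> \<Gamma> \<Longrightarrow> boundary_map P (act \<gamma>) (Z \<gamma>) = \<zeta>F (sel \<gamma>)"
    "\<And>\<gamma>. \<gamma> \<in> \<Gamma> \<Longrightarrow> mass (Z \<gamma>) = exp (weight (\<zeta>F (sel \<gamma>)) (act \<gamma> p)) * mass (\<zeta>F (sel \<gamma>))" by metis
  define m where "m = Min ((\<lambda>f. mass (\<zeta>F f)) ` F)"
  have m: "0 < m" "\<And>f. f \<in> F \<Longrightarrow> m \<le> mass (\<zeta>F f)" using F \<zeta>F(3) by (auto simp: m_def)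
  define V where "V = measure (\<mu> p) (space (\<mu> p))"
  have V0: "0 \<le> V" by (simp add: V_def)
  define W where "W = card {\<gamma> \<in> \<Gamma>. \<forall>i<r. mdist (X i) (p i) (\<gamma> i (p i)) \<le> 2 * R + 3}"
  define A where "A = real (card F) * (V + 1) / (m * exp (- \<beta> * E)) * (R + 2) ^ r * (real W + 1)"
  have A: "0 < A" using F m V0 R by (auto simp: A_def card_gt_0_iff intro!: mult_pos_pos divide_pos_pos)
  show ?thesis
  proof (rule growth_exponent_le_0[OF A, of \<theta> \<beta>])
    fix \<epsilon> :: real and n :: nat assume \<epsilon>: "0 < \<epsilon>" and n: "1 \<le> n"
    let ?S = "slope_orbit \<theta> \<epsilon> n"
    have S\<Gamma>: "\<gamma> \<in> \<Gamma>" if "\<gamma> \<in> ?S" for \<gamma> using that by (simp add: slope_orbit_def)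
    define w where "w = m * exp (- \<beta> * E) * exp (- (\<epsilon> * \<beta> * real n))"
    have w: "0 < w" using m by (simp add: w_def)
    have mass_ge: "w \<le> mass (Z \<gamma>)" if \<gamma>S: "\<gamma> \<in> ?S" for \<gamma>
    proof -
      note \<gamma> = S\<Gamma>[OF \<gamma>S]
      define T where "T = mdist P p (act \<gamma> p)"
      define di where "di = (\<lambda>i. mdist (X i) (p i) (\<gamma> i (p i)))"
      have T: "0 < T" "T < real n" "\<And>i. i < r \<Longrightarrow> \<bar>di i / T - \<theta> i\<bar> < \<epsilon>"
        using \<gamma>S by (auto simp: slope_orbit_def T_def di_def simp del: mdist_product_space)
      have each: "b i * di i \<le> T * (b i * \<theta> i) + \<bar>b i\<bar> * (\<epsilon> * real n)" if i: "i < r" for i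
      proof -
        have "\<bar>di i - T * \<theta> i\<bar> = T * \<bar>di i / T - \<theta> i\<bar>"
          using T(1) by (simp add: abs_mult[of T, symmetric, unfolded abs_of_pos[OF T(1)]] right_diff_distrib)
        also have "\<dots> \<le> real n * \<epsilon>" using T(1,2) T(3)[OF i] by (intro mult_mono) auto
        finally have "\<bar>b i * (di i - T * \<theta> i)\<bar> \<le> \<bar>b i\<bar> * (\<epsilon> * real n)"
          unfolding abs_mult by (intro mult_left_mono) (auto simp: mult.commute)
        then show ?thesis by (simp add: abs_le_iff algebra_simps)
      qed
      have "(\<Sum>i<r. b i * di i) \<le> (\<Sum>i<r. T * (b i * \<theta> i) + \<bar>b i\<bar> * (\<epsilon> * real n))"
        using each by (intro sum_mono) auto
      also have "\<dots> = T * (\<Sum>i<r. b i * \<theta> i) + \<beta> * (\<epsilon> * real n)"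
        by (simp add: sum.distrib sum_distrib_left sum_distrib_right \<beta>_def)
      also have "\<dots> \<le> \<epsilon> * \<beta> * real n" using neg T(1) by (simp add: mult_nonneg_nonpos)
      finally have "- (\<epsilon> * \<beta> * real n) - \<beta> * E \<le> (\<Sum>i<r. b i * (- di i)) - \<beta> * E"
        by (simp add: sum_negf)
      also have "\<dots> \<le> weight (\<zeta>F (sel \<gamma>)) (act \<gamma> p)"
        unfolding \<beta>_def by (rule weight_lower_bound) (use bus[OF \<gamma>] in \<open>simp add: di_def\<close>)
      finally have "exp (- (\<epsilon> * \<beta> * real n) - \<beta> * E) \<le> exp (weight (\<zeta>F (sel \<gamma>)) (act \<gamma> p))" by simp
      then have "exp (- (\<epsilon> * \<beta> * real n) - \<beta> * E) * m \<le> mass (Z \<gamma>)"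
        unfolding Z(3)[OF \<gamma>] using m(2)[OF sel(1)[OF \<gamma>]] m(1) by (intro mult_mono) auto
      then show ?thesis by (simp add: w_def exp_diff exp_minus field_simps)
    qed
    have card_Z: "real (card (Z ` ?S)) \<le> V / w"
    proof -
      have "real (card (Z ` ?S)) * w \<le> V"
        unfolding V_def by (rule card_atoms_le) (use mass_ge w finite_slope_orbit in auto)
      then show ?thesis using w by (simp add: pos_le_divide_eq)
    qed
    define \<Psi> where "\<Psi> = (\<lambda>\<gamma>. (sel \<gamma>, Z \<gamma>))"
    define q where "q = (nat \<lfloor>real n + R\<rfloor> + 1) ^ r * W"
    have fib: "card {\<gamma> \<in> ?S. \<Psi> \<gamma> = y} \<le> q" if y: "y \<in> \<Psi> ` ?S" for y
    proof -
      obtain \<alpha> where \<alpha>: "\<alpha> \<in> ?S" "y = (sel \<alpha>, Z \<alpha>)" using y by (auto simp: \<Psi>_def)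
      define f where "f = sel \<alpha>"
      have f: "f \<in> F" "f \<in> \<Gamma>" using sel(1)[OF S\<Gamma>[OF \<alpha>(1)]] F by (auto simp: f_def)
      have ZB: "Z \<alpha> \<in> boundary P" by (rule Z(1)[OF S\<Gamma>[OF \<alpha>(1)]])
      obtain e where e: "e \<in> Z \<alpha>" using boundary_nonempty[OF ZB] by blast
      note eray = boundary_rep(1)[OF ZB e]
      let ?T = "{\<gamma> \<in> ?S. \<Psi> \<gamma> = y}"
      have T: "\<gamma> \<in> ?S" "\<gamma> \<in> \<Gamma>" "sel \<gamma> = f" "Z \<gamma> = Z \<alpha>" if "\<gamma> \<in> ?T" for \<gamma>
        using that S\<Gamma> \<alpha>(2) by (auto simp: \<Psi>_def f_def)
      have close: "\<exists>D. \<forall>s\<ge>0. \<forall>i<r. mdist (X i) (\<gamma> i (e s i)) (f i (\<rho> i (s * \<theta> i))) \<le> D" if \<gamma>: "\<gamma> \<in> ?T" for \<gamma>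
      proof -
        have "act \<gamma> \<circ> e \<in> \<zeta>F f"
          using boundary_map_mem[OF act_isom[OF T(2)[OF \<gamma>]] ZB e] Z(2)[OF T(2)[OF \<gamma>]] T(3,4)[OF \<gamma>] by simp
        then have "asymptotic P (act \<gamma> \<circ> e) (act f \<circ> c)"
          by (rule boundary_asymptotic[OF \<zeta>F(1)[OF f(1)] _ \<zeta>F(2)[OF f(1)]])
        then obtain D where D: "\<And>s. s \<ge> 0 \<Longrightarrow> mdist P (act \<gamma> (e s)) (act f (c s)) \<le> D"
          by (auto simp only: asymptotic_def comp_apply)
        have "mdist (X i) (\<gamma> i (e s i)) (f i (\<rho> i (s * \<theta> i))) \<le> D" if s: "s \<ge> 0" and i: "i < r" for s i
          using mdist_component_le[OF i, of X "act \<gamma> (e s)" "act f (c s)"] D[OF s]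
            act_apply[OF geodesic_rayD(1)[OF eray s] i] act_apply[OF cM[OF s] i] c\<rho>[OF s i] by simp
        then show ?thesis by blast
      qed
      show ?thesis
        unfolding q_def W_def
      proof (rule coset_multiplicity[OF \<rho> \<theta>pos f(2) R])
        show "finite ?T" using finite_slope_orbit by simp
        show "?T \<subseteq> \<Gamma>" using T(2) by blast
        show "e s i \<in> mspace (X i)" if "s \<ge> 0" "i < r" for s i
          by (rule product_ray_component[OF eray that])
        show "\<exists>D. \<forall>s\<ge>0. \<forall>i<r. mdist (X i) (\<gamma> i (e s i)) (f i (\<rho> i (s * \<theta> i))) \<le> D" if "\<gamma> \<in> ?T" for \<gamma>
          by (rule close[OF that])
        show "passes_near (X i) (\<gamma> i (p i)) (f i (\<rho> i s)) (p i) R"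
          if "\<gamma> \<in> ?T" "i < r" "s \<ge> 0" for \<gamma> i s
          using sel(2)[OF T(2)[OF that(1)]] T(3)[OF that(1)] that(2,3) unfolding good_def by blast
        show "mdist (X i) (p i) (\<gamma> i (p i)) \<le> real n" if "\<gamma> \<in> ?T" "i < r" for \<gamma> i
          by (rule slope_orbit_component[OF T(1)[OF that(1)] that(2)])
      qed
    qed
    have "card ?S \<le> card (\<Psi> ` ?S) * q" by (rule card_le_fibres[OF finite_slope_orbit fib])
    also have "\<dots> \<le> card (F \<times> Z ` ?S) * q"
    proof (intro mult_right_mono card_mono)
      show "finite (F \<times> Z ` ?S)" using F(1) finite_slope_orbit by simp
      show "\<Psi> ` ?S \<subseteq> F \<times> Z ` ?S" using sel(1) S\<Gamma> by (auto simp: \<Psi>_def)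
    qed simp
    finally have "real (card ?S) \<le> real (card (F \<times> Z ` ?S) * q)" by (rule of_nat_mono)
    also have "\<dots> = real (card F) * real (card (Z ` ?S)) * real q" by (simp add: card_cartesian_product)
    also have "\<dots> \<le> real (card F) * (V / w) * ((R + 2) ^ r * real n ^ r * real W)"
    proof (intro mult_mono card_Z)
      have "real (nat \<lfloor>real n + R\<rfloor> + 1) \<le> real n + R + 1" using R by simp
      also have "\<dots> \<le> (R + 2) * real n"
      proof -
        have "R + 1 \<le> (R + 1) * real n" using n R by (simp add: mult_le_cancel_left1)
        then show ?thesis by (simp add: algebra_simps)
      qed
      finally have "real (nat \<lfloor>real n + R\<rfloor> + 1) ^ r \<le> ((R + 2) * real n) ^ r" by (intro power_mono) auto
      then have "real (nat \<lfloor>real n + R\<rfloor> + 1) ^ r * real W \<le> ((R + 2) * real n) ^ r * real W"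
        by (rule mult_right_mono) simp
      then show "real q \<le> (R + 2) ^ r * real n ^ r * real W"
        unfolding q_def by (simp add: power_mult_distrib)
    qed (use V0 w in auto)
    also have "\<dots> \<le> real (card F) * ((V + 1) / w) * ((R + 2) ^ r * real n ^ r * (real W + 1))"
      using V0 w R by (intro mult_mono divide_right_mono) auto
    also have "(V + 1) / w = (V + 1) / (m * exp (- \<beta> * E)) * exp (\<epsilon> * \<beta> * real n)"
      by (simp add: w_def exp_minus field_simps)
    finally show "real (orbit_count r X \<Gamma> p \<theta> \<epsilon> n) \<le> A * real n ^ r * exp (\<epsilon> * \<beta> * real n)"
      unfolding orbit_count_eq A_def by (simp add: mult_ac)
  qed
qed

section \<open>Radial limit points\<close>

text \<open>Cone neighbourhoods may be based at the origin of any ray \<open>c\<close> in the class \<open>\<xi>\<close>. A geodesic from \<open>c 0\<close> to \<open>y n\<close> that is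
1-close to \<open>c\<close> at time \<open>R\<close> has slope within \<open>1 / R\<close> of \<open>\<theta>\<close>, and its slope is constant by
\<open>product_geodesic_proportional\<close>.\<close>

lemma converging_orbit_slope:
  assumes \<xi>: "\<xi> \<in> boundary_slope r X \<theta>"
    and lim: "limitin (cone_topology P) (\<lambda>n. Inl (y n)) (Inr \<xi>) sequentially"
  shows "\<exists>x\<in>mspace P. \<forall>R>0. \<forall>\<^sub>F n in sequentially. y n \<in> mspace P \<and> R < mdist P x (y n) \<and>
    (\<forall>i<r. \<bar>mdist (X i) (x i) (y n i) / mdist P x (y n) - \<theta> i\<bar> \<le> 1 / R)"
proof -
  obtain c \<rho> where c: "c \<in> \<xi>" "\<xi> \<in> boundary P" and \<rho>: "\<And>i. i < r \<Longrightarrow> geodesic_ray (X i) (\<rho> i)"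
    and c\<rho>: "\<And>t i. t \<ge> 0 \<Longrightarrow> i < r \<Longrightarrow> c t i = \<rho> i (t * \<theta> i)"
    using boundary_slopeE[OF \<xi> \<theta>] by metis
  note ray = boundary_rep(1)[OF c(2,1)]
  have c0: "c 0 \<in> mspace P" using geodesic_rayD(1)[OF ray, of 0] by simp
  show ?thesis
  proof (intro bexI[OF _ c0] allI impI)
    fix R :: real assume R: "0 < R"
    have cR: "c R \<in> mspace P" using geodesic_rayD(1)[OF ray, of R] R by simp
    have "openin (cone_topology P) (cone_nbhd P c R 1)"
      unfolding cone_topology_def
    proof (rule topology_generated_by_Basis, rule UnI2, rule CollectI)
      show "\<exists>c' R' \<epsilon>. cone_nbhd P c R 1 = cone_nbhd P c' R' \<epsilon> \<and> geodesic_ray P c' \<and> 0 < R' \<and> 0 < \<epsilon>"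
        using ray R zero_less_one by blast
    qed
    then have "\<forall>\<^sub>F n in sequentially. Inl (y n) \<in> cone_nbhd P c R 1"
      using lim cone_nbhd_mem[OF c(2,1) R, of 1] unfolding limitin_def by simp
    then show "\<forall>\<^sub>F n in sequentially. y n \<in> mspace P \<and> R < mdist P (c 0) (y n) \<and>
      (\<forall>i<r. \<bar>mdist (X i) (c 0 i) (y n i) / mdist P (c 0) (y n) - \<theta> i\<bar> \<le> 1 / R)"
    proof eventually_elim
      case (elim n)
      then obtain k where y: "y n \<in> mspace P" "R < mdist P (c 0) (y n)"
        and k: "geodesic P (c 0) (y n) k" "mdist P (k R) (c R) < 1"
        unfolding cone_nbhd_def by blast
      have kR: "k R \<in> mspace P" by (rule geodesicD(3)[OF k(1)]) (use R y in auto)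
      have "\<bar>mdist (X i) (c 0 i) (y n i) / mdist P (c 0) (y n) - \<theta> i\<bar> \<le> 1 / R" if i: "i < r" for i
      proof -
        interpret proper_hadamard "X i" using factor[OF i] .
        have M: "c 0 i \<in> M" "k R i \<in> M" "c R i \<in> M" using product_mspaceD[OF _ i] c0 kR cR by auto
        have R\<theta>: "0 \<le> R * \<theta> i" using R regular_slopeD[OF \<theta> i] by simp
        have "d (c 0 i) (c R i) = R * \<theta> i"
          using c\<rho>[of 0 i] c\<rho>[of R i] i R geodesic_rayD(2)[OF \<rho>[OF i], of 0 "R * \<theta> i"] R\<theta> by simp
        moreover have "d (k R i) (c R i) \<le> 1"
          using mdist_component_le[OF i, of X "k R" "c R"] k(2) by linarith
        ultimately have "\<bar>d (c 0 i) (k R i) - R * \<theta> i\<bar> \<le> 1"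
          using abs_dist_diff_le[OF M(2,3,1)] by (simp add: commute)
        then have "\<bar>d (c 0 i) (k R i) - R * \<theta> i\<bar> / R \<le> 1 / R" using R by (intro divide_right_mono) auto
        moreover have "\<bar>d (c 0 i) (k R i) - R * \<theta> i\<bar> / R = \<bar>d (c 0 i) (k R i) / R - \<theta> i\<bar>"
        proof -
          have "\<bar>d (c 0 i) (k R i) - R * \<theta> i\<bar> / R = \<bar>(d (c 0 i) (k R i) - R * \<theta> i) / R\<bar>" using R by simp
          also have "(d (c 0 i) (k R i) - R * \<theta> i) / R = d (c 0 i) (k R i) / R - \<theta> i"
            using R by (simp add: diff_divide_distrib)
          finally show ?thesis .
        qed
        ultimately show ?thesis
          using product_geodesic_proportional[OF k(1) c0 y(1) R y(2) i] by simp
      qed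
      then show ?case using y by blast
    qed
  qed
qed

text \<open>By \<open>growth_exponent_of_atom\<close>, \<open>\<tau> = (\<Sum>i<r. b i * \<theta> i)\<close> is positive. Near a radial limit point the Busemann
functions are the distances up to a bounded error, so the masses of the atoms \<open>\<gamma>\<^sub>n\<inverse> \<xi>\<close> are unbounded. An atom is
contained in the support of \<open>\<mu> p\<close> and hence has slope \<open>\<theta>\<close>, so the slope \<open>\<theta>'\<close> in the definition of radial limit
points agrees with \<open>\<theta>\<close>.\<close>

lemma radial_not_atom:
  assumes growth: "0 < growth_exponent r X \<Gamma> p \<theta>"
    and \<theta>': "\<theta>' \<in> slopes r" and rad: "radial_limit_point r X \<Gamma> p \<theta>' \<xi>"
  shows "mass \<xi> = 0"
proof (rule ccontr)
  assume "mass \<xi> \<noteq> 0"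
  then have \<xi>: "0 < mass \<xi>" by (simp add: mass_def zero_less_measure_iff)
  define \<tau> where "\<tau> = (\<Sum>i<r. b i * \<theta> i)"
  have \<tau>: "0 < \<tau>" using growth_exponent_of_atom[OF \<xi>] growth unfolding \<tau>_def by fastforce
  note sl = atom_slope[OF \<xi>]
  have \<theta>s: "\<theta> \<in> slopes r" using \<theta> by (auto simp: slopes_def regular_slopes_def less_imp_le)
  have sl': "\<xi> \<in> boundary_slope r X \<theta>'" using rad by (simp add: radial_limit_point_def)
  have \<theta>eq: "\<theta>' i = \<theta> i" if "i < r" for i using slope_unique[OF sl' sl \<theta>' \<theta>s that] .
  have supp: "slope_support r \<theta>' = {..<r}"
    using \<theta>eq regular_slopeD[OF \<theta>] by (auto simp: slope_support_def)
  obtain \<gamma> where \<gamma>: "\<And>n. \<gamma> n \<in> \<Gamma>"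
    and lim: "limitin (cone_topology P) (\<lambda>n. Inl (act (\<gamma> n) p)) (Inr \<xi>) sequentially"
    and close: "\<forall>i\<in>slope_support r \<theta>'. \<exists>c\<in>boundary_proj X \<theta>' \<xi> i. \<exists>C. \<forall>n. \<exists>t\<ge>0.
      mdist (X i) (\<gamma> n i (p i)) (c t) \<le> C"
    using rad unfolding radial_limit_point_def by blast
  have bus: "\<exists>E. \<forall>n. \<bar>busemann (X i) (boundary_proj X \<theta> \<xi> i) (p i) (act (\<gamma> n) p i)
      - mdist (X i) (p i) (\<gamma> n i (p i))\<bar> \<le> E" if i: "i < r" for i
  proof -
    interpret proper_hadamard "X i" using factor[OF i] .
    have "boundary_proj X \<theta>' \<xi> i = boundary_proj X \<theta> \<xi> i" by (simp add: boundary_proj_def \<theta>eq[OF i])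
    then obtain c C where c: "c \<in> boundary_proj X \<theta> \<xi> i" and C: "\<And>n. \<exists>t\<ge>0. d (\<gamma> n i (p i)) (c t) \<le> C"
      using close i unfolding supp by (metis lessThan_iff)
    obtain e where e: "e \<in> \<xi>" using boundary_nonempty[OF atom_boundary[OF \<xi>]] by blast
    note pr = boundary_proj_approx(1)[OF sl \<theta> e i]
    note cray = boundary_rep(1)[OF pr c]
    have cM: "c t \<in> M" if "t \<ge> 0" for t by (rule geodesic_rayD(1)[OF cray that])
    have as: "\<exists>D. \<forall>t\<ge>0. d (e t) (c t) \<le> D" if "e \<in> boundary_proj X \<theta> \<xi> i" for e
      using boundary_asymptotic[OF pr that c] by (simp add: asymptotic_def)
    obtain D where D: "D \<ge> 0" "busemann_along (X i) (boundary_proj X \<theta> \<xi> i) c D"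
      using busemann_approx[OF pr cM as] by blast
    note pM = p_mspace[OF i]
    define E where "E = 2 * C + 2 * d (p i) (c 0) + D"
    have "\<bar>busemann (X i) (boundary_proj X \<theta> \<xi> i) (p i) (act (\<gamma> n) p i) - d (p i) (\<gamma> n i (p i))\<bar> \<le> E" for n
    proof -
      define y where "y = \<gamma> n i (p i)"
      have yM: "y \<in> M" unfolding y_def by (rule \<Gamma>_mspace[OF \<gamma> i pM])
      obtain t where t: "t \<ge> 0" "d y (c t) \<le> C" using C[of n] by (auto simp: y_def)
      have up: "d (p i) (c s) - d y (c s) \<le> d (p i) y" if "t \<le> s" for s
        using triangle[OF pM yM cM[of s]] t(1) that by simp
      have low: "d (p i) y - 2 * C - 2 * d (p i) (c 0) \<le> d (p i) (c s) - d y (c s)" if "t \<le> s" for s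
      proof -
        have s: "s \<ge> 0" using t that by simp
        have "d (c 0) (c s) = s" "d (c 0) (c t) = t" "d (c t) (c s) = s - t"
          using geodesic_rayD(2)[OF cray] s t that by auto
        then show ?thesis
          using triangle[OF cM[of 0] pM cM[OF s]] triangle[OF yM cM[OF t(1)] cM[OF s]]
            triangle[OF pM cM[of 0] cM[OF t(1)]] triangle[OF pM cM[OF t(1)] yM] t(2)
          by (simp add: commute[of "c 0" "p i"] commute[of "c t" y])
      qed
      note B = busemann_alongD[OF D(2) pM yM, of t, OF low up]
      have "busemann (X i) (boundary_proj X \<theta> \<xi> i) (p i) y \<le> d (p i) y + D" by (rule B(2))
      moreover have "d (p i) y - 2 * C - 2 * d (p i) (c 0) - D \<le> busemann (X i) (boundary_proj X \<theta> \<xi> i) (p i) y"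
        by (rule B(1))
      moreover have ay: "act (\<gamma> n) p i = y" using act_apply[OF p i] by (simp add: y_def)
      moreover have "0 \<le> C" using t(2) nonneg order_trans by blast
      ultimately show ?thesis
        unfolding E_def y_def[symmetric] ay using nonneg[of "p i" "c 0"] D(1) by linarith
    qed
    then show ?thesis by blast
  qed
  then obtain E0 where E0: "\<And>i n. i < r \<Longrightarrow> \<bar>busemann (X i) (boundary_proj X \<theta> \<xi> i) (p i) (act (\<gamma> n) p i)
      - mdist (X i) (p i) (\<gamma> n i (p i))\<bar> \<le> E0 i" by metis
  obtain x where x: "x \<in> mspace P" and conv: "\<forall>R>0. \<forall>\<^sub>F n in sequentially. act (\<gamma> n) p \<in> mspace P \<and>
    R < mdist P x (act (\<gamma> n) p) \<and>
    (\<forall>i<r. \<bar>mdist (X i) (x i) (act (\<gamma> n) p i) / mdist P x (act (\<gamma> n) p) - \<theta> i\<bar> \<le> 1 / R)"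
    using converging_orbit_slope[OF sl lim] by blast
  define \<beta> where "\<beta> = (\<Sum>i<r. \<bar>b i\<bar>)"
  have \<beta>0: "0 \<le> \<beta>" by (simp add: \<beta>_def sum_nonneg)
  define E where "E = (\<Sum>i<r. \<bar>E0 i\<bar>) + mdist P x p"
  have E: "E0 i + mdist P x p \<le> E" if "i < r" for i
  proof -
    have "\<bar>E0 i\<bar> \<le> (\<Sum>i<r. \<bar>E0 i\<bar>)" using that by (intro member_le_sum) auto
    then show ?thesis by (simp add: E_def del: mdist_product_space)
  qed
  define V where "V = measure (\<mu> p) (space (\<mu> p))"
  \<comment> \<open>\<open>R\<close> is so large that half of \<open>T * \<tau>\<close> absorbs the deviation from the slope and the other half exceeds \<open>K\<close>.\<close>
  define K where "K = V / mass \<xi> + \<beta> * \<bar>E\<bar> + 1"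
  define R where "R = max 1 (max (2 * \<beta> / \<tau>) (2 * K / \<tau>))"
  have "0 < R" by (simp add: R_def)
  have R\<tau>: "2 * \<beta> \<le> \<tau> * R" "2 * K \<le> \<tau> * R"
  proof -
    have "2 * \<beta> / \<tau> \<le> R" "2 * K / \<tau> \<le> R" by (auto simp: R_def)
    then show "2 * \<beta> \<le> \<tau> * R" "2 * K \<le> \<tau> * R" using \<tau> by (simp_all add: pos_divide_le_eq mult.commute)
  qed
  obtain n where yP: "act (\<gamma> n) p \<in> mspace P" and far: "R < mdist P x (act (\<gamma> n) p)"
    and ratio: "\<And>i. i < r \<Longrightarrow> \<bar>mdist (X i) (x i) (act (\<gamma> n) p i) / mdist P x (act (\<gamma> n) p) - \<theta> i\<bar> \<le> 1 / R"
    using eventually_happens[OF conv[rule_format, OF \<open>0 < R\<close>]] by auto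
  define T where "T = mdist P x (act (\<gamma> n) p)"
  define w where "w = (\<lambda>i. mdist (X i) (x i) (act (\<gamma> n) p i))"
  have T: "R < T" "0 < T" using far \<open>0 < R\<close> by (auto simp: T_def simp del: mdist_product_space)
  have each: "T * (b i * \<theta> i) - \<bar>b i\<bar> * (T / R) \<le> b i * w i" if i: "i < r" for i
  proof -
    have "\<bar>w i - T * \<theta> i\<bar> = T * \<bar>w i / T - \<theta> i\<bar>"
      using T(2) by (simp add: abs_mult[of T, symmetric, unfolded abs_of_pos[OF T(2)]] right_diff_distrib)
    also have "\<dots> \<le> T * (1 / R)" using ratio[OF i] T(2) by (intro mult_left_mono) (auto simp: w_def T_def)
    finally have "\<bar>b i * (w i - T * \<theta> i)\<bar> \<le> \<bar>b i\<bar> * (T / R)"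
      unfolding abs_mult by (intro mult_left_mono) auto
    then show ?thesis by (simp add: abs_le_iff algebra_simps)
  qed
  have "\<tau> * R \<le> \<tau> * T" using T(1) \<tau> by (intro mult_left_mono) auto
  then have "K \<le> T * \<tau> / 2" using R\<tau>(2) by (simp add: mult.commute)
  also have "\<dots> \<le> T * \<tau> - \<beta> * (T / R)"
  proof -
    have "\<beta> * T \<le> \<tau> * R / 2 * T" using R\<tau>(1) T(2) by (intro mult_right_mono) auto
    then have "\<beta> * (T / R) \<le> T * \<tau> / 2" using \<open>0 < R\<close> by (simp add: field_simps)
    then show ?thesis by simp
  qed
  also have "\<dots> = (\<Sum>i<r. T * (b i * \<theta> i) - \<bar>b i\<bar> * (T / R))"
    by (simp add: sum_subtractf sum_distrib_left sum_distrib_right sum_divide_distrib \<tau>_def \<beta>_def)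
  also have "\<dots> \<le> (\<Sum>i<r. b i * w i)" using each by (intro sum_mono) auto
  finally have "K - \<beta> * E \<le> (\<Sum>i<r. b i * w i) - \<beta> * E" by simp
  also have "\<dots> \<le> weight \<xi> (act (\<gamma> n) p)"
    unfolding \<beta>_def
  proof (rule weight_lower_bound)
    fix i assume i: "i < r"
    interpret proper_hadamard "X i" using factor[OF i] .
    have ai: "act (\<gamma> n) p i = \<gamma> n i (p i)" by (rule act_apply[OF p i])
    have "\<bar>d (p i) (\<gamma> n i (p i)) - w i\<bar> \<le> mdist P x p"
    proof -
      have "\<bar>d (p i) (\<gamma> n i (p i)) - w i\<bar> \<le> d (p i) (x i)"
        unfolding w_def ai
        by (rule abs_dist_diff_le[OF p_mspace[OF i] product_mspaceD[OF x i] \<Gamma>_mspace[OF \<gamma> i p_mspace[OF i]]])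
      also have "\<dots> \<le> mdist P x p" using mdist_component_le[OF i, of X x p] by (simp add: commute)
      finally show ?thesis .
    qed
    then show "\<bar>busemann (X i) (boundary_proj X \<theta> \<xi> i) (p i) (act (\<gamma> n) p i) - w i\<bar> \<le> E"
      using E0[OF i, of n] E[OF i] by linarith
  qed
  finally have "V / mass \<xi> + \<beta> * \<bar>E\<bar> + 1 - \<beta> * E \<le> weight \<xi> (act (\<gamma> n) p)" unfolding K_def .
  moreover have "\<beta> * E \<le> \<beta> * \<bar>E\<bar>" using \<beta>0 by (intro mult_left_mono) auto
  ultimately have "V / mass \<xi> + 1 \<le> weight \<xi> (act (\<gamma> n) p)" by linarith
  also have "\<dots> < exp (weight \<xi> (act (\<gamma> n) p))" using exp_ge_add_one_self[of "weight \<xi> (act (\<gamma> n) p)"] by linarith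
  finally have "V / mass \<xi> < exp (weight \<xi> (act (\<gamma> n) p))" by simp
  then have "V < exp (weight \<xi> (act (\<gamma> n) p)) * mass \<xi>" using \<xi> by (simp add: pos_divide_less_eq)
  moreover obtain \<zeta> where "mass \<zeta> = exp (weight \<xi> (act (\<gamma> n) p)) * mass \<xi>"
    using atom_preimage[OF \<xi> \<gamma>[of n]] by blast
  moreover have "mass \<zeta> \<le> V" unfolding mass_def V_def by (rule \<mu>.bounded_measure)
  ultimately show False by linarith
qed

end

theorem theoremE:
  fixes r :: nat
    and X :: "nat \<Rightarrow> 'a metric"
    and \<Gamma> :: "(nat \<Rightarrow> 'a \<Rightarrow> 'a) set"
    and h g :: "nat \<Rightarrow> 'a \<Rightarrow> 'a"
    and p :: "nat \<Rightarrow> 'a"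
    and \<theta> b :: "nat \<Rightarrow> real"
    and \<mu> :: "(nat \<Rightarrow> 'a) \<Rightarrow> (real \<Rightarrow> nat \<Rightarrow> 'a) set measure"
  assumes "r \<ge> 1"
    and "\<And>i. i < r \<Longrightarrow> hadamard_space (X i)"
    and "\<And>i. i < r \<Longrightarrow> locally_compact_space (mtopology_of (X i))"
    and "subgroup \<Gamma> (product_isometry_group r X)"
    and "properly_discontinuous r X \<Gamma>"
    and "h \<in> \<Gamma>" and "g \<in> \<Gamma>"
    and "\<And>i. i < r \<Longrightarrow> independent_rank_one (X i) (g i) (h i)"
    and "p \<in> Ax (product_space r X) (product_act r X h)"
    and "\<theta> \<in> regular_slopes r"
    and "growth_exponent r X \<Gamma> p \<theta> > 0"
    and "invariant_density r X \<Gamma> p b \<theta> \<mu>"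
  shows "\<forall>\<eta>\<in>radial_limit_set r X \<Gamma> p. emeasure (\<mu> p) {\<eta>} = 0"
proof
  fix \<eta> assume "\<eta> \<in> radial_limit_set r X \<Gamma> p"
  then obtain \<theta>' where \<theta>': "\<theta>' \<in> slopes r" "radial_limit_point r X \<Gamma> p \<theta>' \<eta>"
    by (auto simp: radial_limit_set_def)
  have p: "p \<in> mspace (product_space r X)" using assms(9) unfolding Ax_def by blast
  interpret rank_one_density r X \<Gamma> h g p b \<theta> \<mu>
    by (intro rank_one_density.intro rank_one_action.intro isometric_action.intro
        rank_one_action_axioms.intro rank_one_density_axioms.intro) (fact assms p)+
  have "measure (\<mu> p) {\<eta>} = 0" using radial_not_atom[OF assms(11) \<theta>'] by (simp add: mass_def)
  then show "emeasure (\<mu> p) {\<eta>} = 0" by (simp add: \<mu>.emeasure_eq_measure)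
qed

end
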